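(* Let $f(x,y)\in\mathbf C\{x,y\}$ be irreducible with $1<\mathrm{ord}\, f(0,y)<\infty$, and suppose that the branch $f(x,y)=0$ has $h$ characteristic exponents. Let $\mathcal D(u,v)$ be the discriminant of the morphism $(x,f)$. 1. If $h=1$ then $\mathcal D(u,v)$ is non-degenerate if and only if $\mathrm{ord}\, f(0,y)=2$. 2. If $h=2$ then $\mathcal D(u,v)$ is non-degenerate if and only if $\mathrm{ord}\, f(0,y)=4$. 3. If $h>2$ then $\mathcal D(u,v)$ is degenerate (i.e. not non-degenerate).
   Context: Let $p=\mathrm{ord}\, f(0,y)$ and write $f=u\prod_{i=1}^p[y-\alpha_i(x)]$, $\frac{\partial f}{\partial y}=\tilde u\prod_{j=1}^{p-1}[y-\gamma_j(x)]$ with $u,\tilde u$ units in $\mathbf C\{x,y\}$ and $\alpha_i,\gamma_j$ convergent Puiseux series in $x$ of positive order. The characteristic exponents of $f$ are the elements of the finite set $\{\mathrm{ord}(\alpha_i-\alpha_j): i\ne j\}$ of rational numbers; $h$ is the number of elements of this set. The discriminant of $(x,f)$ is $\mathcal D(u,v)=\prod_{j=1}^{p-1}(v-f(u,\gamma_j(u)))$, defined up to multiplication by an invertible power series. Non-degeneracy: for $g=\sum a_{ij}u^iv^j\ne0$ the Newton diagram is the convex hull of $\{(i,j):a_{ij}\ne0\}+\mathbf R_{\ge 0}^2$. For a compact edge $S$, $g_S=\sum_{(i,j)\in S}a_{ij}u^iv^j=c\,u^kv^l\prod_{i=1}^r(v^{q_0}-a_iu^{p_0})^{s_i}$ with $p_0,q_0$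 coprime positive integers, $c,a_i$ nonzero and the $a_i$ pairwise different; $g$ is non-degenerate if for every compact edge all $s_i=1$. *)

theory Defs
  imports "HOL-Analysis.Analysis"
begin

section \<open>Convergent power series in two variables\<close>

text \<open>
  A formal power series in two variables is an element of \<^typ>\<open>complex fps fps\<close>: the outer
  variable is the second one (\<open>y\<close> or \<open>v\<close>), the inner variable is the first one (\<open>x\<close> or \<open>u\<close>),
  so \<open>fps_nth (fps_nth f j) i\<close> is the coefficient of \<open>x\<^sup>i y\<^sup>j\<close>.
\<close>

definition convergent2 :: "complex fps fps \<Rightarrow> bool" where
  "convergent2 f \<longleftrightarrow>
     (\<exists>r>0. (\<lambda>(i, j). norm (fps_nth (fps_nth f j) i) * r ^ i * r ^ j) summable_on (UNIV :: (nat \<times> nat) set))"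

lemma convergent2_iff_bounded:
  "convergent2 f \<longleftrightarrow> (\<exists>r>0. \<exists>M. \<forall>i j. norm (fps_nth (fps_nth f j) i) * r ^ (i + j) \<le> M)"
proof
  assume "convergent2 f"
  then obtain r where r: "r > 0"
    and s: "(\<lambda>(i, j). norm (fps_nth (fps_nth f j) i) * r ^ i * r ^ j) summable_on (UNIV :: (nat \<times> nat) set)"
    by (auto simp: convergent2_def)
  let ?g = "\<lambda>(i, j). norm (fps_nth (fps_nth f j) i) * r ^ i * r ^ j"
  have "norm (fps_nth (fps_nth f j) i) * r ^ (i + j) \<le> infsum ?g UNIV" for i j
  proof -
    have "sum ?g {(i, j)} \<le> infsum ?g UNIV"
      by (rule finite_sum_le_infsum[OF s]) (use r in auto)
    then show ?thesis by (simp add: power_add mult.assoc)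
  qed
  with r show "\<exists>r>0. \<exists>M. \<forall>i j. norm (fps_nth (fps_nth f j) i) * r ^ (i + j) \<le> M" by blast
next
  assume "\<exists>r>0. \<exists>M. \<forall>i j. norm (fps_nth (fps_nth f j) i) * r ^ (i + j) \<le> M"
  then obtain r M where r: "r > 0" and M: "\<And>i j. norm (fps_nth (fps_nth f j) i) * r ^ (i + j) \<le> M"
    by blast
  have M0: "M \<ge> 0" using order_trans[OF norm_ge_zero M[of 0 0, simplified]] .
  let ?g = "\<lambda>(i, j). norm (fps_nth (fps_nth f j) i) * (r/2) ^ i * (r/2) ^ j"
  have geo: "(\<Sum>i\<le>n. (1/2::real) ^ i) \<le> 2" for n
  proof -
    have "(\<Sum>i\<le>n. (1/2::real) ^ i) = 2 - (1/2) ^ n" by (induction n) auto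
    then show ?thesis by simp
  qed
  have "?g summable_on UNIV"
  proof (rule nonneg_bdd_above_summable_on)
    show "0 \<le> ?g x" for x using r by (auto split: prod.splits)
    show "bdd_above (sum ?g ` {F. F \<subseteq> UNIV \<and> finite F})"
    proof (rule bdd_aboveI2)
      fix F :: "(nat \<times> nat) set" assume "F \<in> {F. F \<subseteq> UNIV \<and> finite F}"
      then have fin: "finite F" by simp
      define n where "n = Max (fst ` F \<union> snd ` F)"
      have sub: "F \<subseteq> {..n} \<times> {..n}"
      proof
        fix p assume p: "p \<in> F"
        have "fst p \<le> n" "snd p \<le> n" unfolding n_def using p fin by (auto intro!: Max_ge)
        then show "p \<in> {..n} \<times> {..n}" by (cases p) auto
      qed
      have "sum ?g F \<le> (\<Sum>(i,j)\<in>{..n} \<times> {..n}. M * ((1/2) ^ i * (1/2) ^ j))"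
      proof (rule order_trans[OF sum_mono2[OF _ sub]])
        show "sum ?g ({..n} \<times> {..n}) \<le> (\<Sum>(i,j)\<in>{..n} \<times> {..n}. M * ((1/2) ^ i * (1/2) ^ j))"
        proof (rule sum_mono, clarify)
          fix i j
          have "norm (fps_nth (fps_nth f j) i) * (r/2) ^ i * (r/2) ^ j =
                (norm (fps_nth (fps_nth f j) i) * r ^ (i + j)) * ((1/2) ^ i * (1/2) ^ j)"
            by (simp add: power_add power_divide field_simps)
          also have "\<dots> \<le> M * ((1/2) ^ i * (1/2) ^ j)"
            by (rule mult_right_mono[OF M]) auto
          finally show "norm (fps_nth (fps_nth f j) i) * (r/2) ^ i * (r/2) ^ j \<le> M * ((1/2) ^ i * (1/2) ^ j)" .
        qed
      qed (use r in \<open>auto split: prod.splits\<close>)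
      also have "\<dots> = M * ((\<Sum>i\<le>n. (1/2) ^ i) * (\<Sum>j\<le>n. (1/2) ^ j))"
        by (simp only: sum_product sum.cartesian_product) (simp only: sum_distrib_left case_prod_unfold)
      also have "\<dots> \<le> M * (2 * 2)"
        by (intro mult_left_mono mult_mono geo M0 sum_nonneg) auto
      finally show "sum ?g F \<le> M * (2 * 2)" .
    qed
  qed
  then show "convergent2 f" unfolding convergent2_def using r by (intro exI[of _ "r/2"]) auto
qed

lemma convergent2_zero: "convergent2 0"
  unfolding convergent2_iff_bounded by (intro exI[of _ 1]) auto

lemma convergent2_one: "convergent2 1"
proof -
  have "norm (fps_nth (fps_nth (1 :: complex fps fps) j) i) * 1 ^ (i + j) \<le> 1" for i j
    by (simp add: fps_one_nth)
  then show ?thesis unfolding convergent2_iff_bounded using zero_less_one by blast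
qed

lemma convergent2_uminus: "convergent2 f \<Longrightarrow> convergent2 (- f)"
  by (simp add: convergent2_def)

lemma convergent2_common_radius:
  assumes "convergent2 f" "convergent2 g"
  obtains r M where "r > 0" "M \<ge> 0"
    "\<And>i j. norm (fps_nth (fps_nth f j) i) * r ^ (i + j) \<le> M"
    "\<And>i j. norm (fps_nth (fps_nth g j) i) * r ^ (i + j) \<le> M"
proof -
  obtain r1 M1 where 1: "r1 > 0" "\<And>i j. norm (fps_nth (fps_nth f j) i) * r1 ^ (i + j) \<le> M1"
    using assms(1) unfolding convergent2_iff_bounded by blast
  obtain r2 M2 where 2: "r2 > 0" "\<And>i j. norm (fps_nth (fps_nth g j) i) * r2 ^ (i + j) \<le> M2"
    using assms(2) unfolding convergent2_iff_bounded by blast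
  let ?r = "min r1 r2" and ?M = "max 0 (max M1 M2)"
  have "norm (fps_nth (fps_nth f j) i) * ?r ^ (i + j) \<le> ?M" for i j
  proof -
    have "norm (fps_nth (fps_nth f j) i) * ?r ^ (i + j) \<le> norm (fps_nth (fps_nth f j) i) * r1 ^ (i + j)"
      using 1(1) 2(1) by (intro mult_left_mono power_mono) auto
    with 1(2)[of j i] show ?thesis by linarith
  qed
  moreover have "norm (fps_nth (fps_nth g j) i) * ?r ^ (i + j) \<le> ?M" for i j
  proof -
    have "norm (fps_nth (fps_nth g j) i) * ?r ^ (i + j) \<le> norm (fps_nth (fps_nth g j) i) * r2 ^ (i + j)"
      using 1(1) 2(1) by (intro mult_left_mono power_mono) auto
    with 2(2)[of j i] show ?thesis by linarith
  qed
  ultimately show ?thesis using 1(1) 2(1) that[of ?r ?M] by auto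
qed

lemma convergent2_add:
  assumes "convergent2 f" "convergent2 g" shows "convergent2 (f + g)"
proof -
  obtain r M where r: "r > 0" "M \<ge> 0"
    and f: "\<And>i j. norm (fps_nth (fps_nth f j) i) * r ^ (i + j) \<le> M"
    and g: "\<And>i j. norm (fps_nth (fps_nth g j) i) * r ^ (i + j) \<le> M"
    using convergent2_common_radius[OF assms] by blast
  have "norm (fps_nth (fps_nth (f + g) j) i) * r ^ (i + j) \<le> 2 * M" for i j
  proof -
    have "norm (fps_nth (fps_nth (f + g) j) i) * r ^ (i + j)
      \<le> (norm (fps_nth (fps_nth f j) i) + norm (fps_nth (fps_nth g j) i)) * r ^ (i + j)"
      using r by (intro mult_right_mono) (auto simp: norm_triangle_ineq)
    with f[of j i] g[of j i] show ?thesis by (simp add: algebra_simps)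
  qed
  with r(1) show ?thesis unfolding convergent2_iff_bounded by blast
qed

lemma convergent2_diff: "convergent2 f \<Longrightarrow> convergent2 g \<Longrightarrow> convergent2 (f - g)"
  using convergent2_add[of f "- g"] convergent2_uminus[of g] by simp

lemma convergent2_mult:
  assumes "convergent2 f" "convergent2 g" shows "convergent2 (f * g)"
proof -
  obtain r M where r: "r > 0" "M \<ge> 0"
    and f: "\<And>i j. norm (fps_nth (fps_nth f j) i) * r ^ (i + j) \<le> M"
    and g: "\<And>i j. norm (fps_nth (fps_nth g j) i) * r ^ (i + j) \<le> M"
    using convergent2_common_radius[OF assms] by blast
  have "norm (fps_nth (fps_nth (f * g) j) i) * (r/2) ^ (i + j) \<le> M * M" for i j
  proof -
    have eq: "fps_nth (fps_nth (f * g) j) i =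
       (\<Sum>b=0..j. \<Sum>a=0..i. fps_nth (fps_nth f b) a * fps_nth (fps_nth g (j - b)) (i - a))"
      by (simp add: fps_mult_nth fps_sum_nth)
    have "norm (fps_nth (fps_nth (f * g) j) i) * r ^ (i + j) \<le>
       (\<Sum>b=0..j. \<Sum>a=0..i. norm (fps_nth (fps_nth f b) a * fps_nth (fps_nth g (j - b)) (i - a))) * r ^ (i + j)"
      unfolding eq using r by (intro mult_right_mono order_trans[OF norm_sum] sum_mono norm_sum) auto
    also have "\<dots> = (\<Sum>b=0..j. \<Sum>a=0..i. (norm (fps_nth (fps_nth f b) a) * r ^ (a + b)) *
        (norm (fps_nth (fps_nth g (j - b)) (i - a)) * r ^ ((i - a) + (j - b))))"
      unfolding sum_distrib_right
    proof (intro sum.cong refl)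
      fix b a assume "b \<in> {0..j}" "a \<in> {0..i}"
      then have "r ^ (i + j) = r ^ (a + b) * r ^ ((i - a) + (j - b))"
        by (simp flip: power_add)
      then show "norm (fps_nth (fps_nth f b) a * fps_nth (fps_nth g (j - b)) (i - a)) * r ^ (i + j) =
        (norm (fps_nth (fps_nth f b) a) * r ^ (a + b)) *
        (norm (fps_nth (fps_nth g (j - b)) (i - a)) * r ^ ((i - a) + (j - b)))"
        by (simp add: norm_mult)
    qed
    also have "\<dots> \<le> (\<Sum>b=0..j. \<Sum>a=0..i. M * M)"
      using r by (intro sum_mono mult_mono f g) auto
    also have "\<dots> = real ((i + 1) * (j + 1)) * (M * M)"
      by (simp add: algebra_simps)
    also have "\<dots> \<le> 2 ^ (i + j) * (M * M)"
    proof (rule mult_right_mono)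
      have "i + 1 \<le> 2 ^ i" "j + 1 \<le> 2 ^ j" by (simp_all add: Suc_le_eq)
      then have "(i + 1) * (j + 1) \<le> 2 ^ i * 2 ^ j" by (rule mult_le_mono)
      then have "(i + 1) * (j + 1) \<le> 2 ^ (i + j)" by (simp add: power_add)
      then have "real ((i + 1) * (j + 1)) \<le> real (2 ^ (i + j))" by (simp only: of_nat_le_iff)
      then show "real ((i + 1) * (j + 1)) \<le> 2 ^ (i + j)" by simp
    qed (use r in auto)
    finally show ?thesis by (simp add: power_divide field_simps)
  qed
  with r(1) show ?thesis unfolding convergent2_iff_bounded
    by (intro exI[of _ "r/2"]) auto
qed

typedef cps2 = "{f :: complex fps fps. convergent2 f}"
  morphisms fps_of_cps2 Abs_cps2
  using convergent2_zero by blast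

setup_lifting type_definition_cps2

instantiation cps2 :: idom
begin

lift_definition zero_cps2 :: cps2 is 0 by (rule convergent2_zero)
lift_definition one_cps2 :: cps2 is 1 by (rule convergent2_one)
lift_definition plus_cps2 :: "cps2 \<Rightarrow> cps2 \<Rightarrow> cps2" is "(+)" by (rule convergent2_add)
lift_definition minus_cps2 :: "cps2 \<Rightarrow> cps2 \<Rightarrow> cps2" is "(-)" by (rule convergent2_diff)
lift_definition uminus_cps2 :: "cps2 \<Rightarrow> cps2" is uminus by (rule convergent2_uminus)
lift_definition times_cps2 :: "cps2 \<Rightarrow> cps2 \<Rightarrow> cps2" is "(*)" by (rule convergent2_mult)

instance
  by standard (transfer; simp add: algebra_simps)+

end

definition coeff2 :: "cps2 \<Rightarrow> nat \<Rightarrow> nat \<Rightarrow> complex" where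
  "coeff2 f i j = fps_nth (fps_nth (fps_of_cps2 f) j) i"

text \<open>The univariate series \<open>f(0,y)\<close>.\<close>

definition at_x0 :: "cps2 \<Rightarrow> complex fps" where
  "at_x0 f = Abs_fps (\<lambda>j. coeff2 f 0 j)"


section \<open>Puiseux factorizations and characteristic exponents\<close>

text \<open>
  Finitely many convergent Puiseux series in \<open>x\<close> have a common denominator \<open>N\<close>, and are then
  convergent power series in \<open>t = x\<^sup>1\<^sup>/\<^sup>N\<close>. Identities between them are stated after the
  substitution \<open>x = t\<^sup>N\<close>, and the order with respect to \<open>x\<close> is the order in \<open>t\<close> divided by \<open>N\<close>.
\<close>

text \<open>\<open>f(t\<^sup>N, y)\<close>\<close>

definition ramify :: "nat \<Rightarrow> complex fps fps \<Rightarrow> complex fps fps" where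
  "ramify N f = Abs_fps (\<lambda>j. fps_nth f j oo fps_X ^ N)"

text \<open>
  \<open>f(t\<^sup>N, a(t))\<close> for \<open>a(0) = 0\<close>; the sum converges in the \<open>t\<close>-adic topology of
  \<^typ>\<open>complex fps\<close> because \<open>a\<^sup>j\<close> has order at least \<open>j\<close>.
\<close>

definition subst_puiseux :: "nat \<Rightarrow> complex fps fps \<Rightarrow> complex fps \<Rightarrow> complex fps" where
  "subst_puiseux N f a = (\<Sum>j. fps_nth (ramify N f) j * a ^ j)"

lemma subst_puiseux_nth:
  assumes "fps_nth a 0 = 0"
  shows "fps_nth (subst_puiseux N f a) n = (\<Sum>j\<le>n. fps_nth (fps_nth (ramify N f) j * a ^ j) n)"
proof -
  let ?c = "\<lambda>j. fps_nth (ramify N f) j * a ^ j"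
  let ?s = "Abs_fps (\<lambda>n. \<Sum>j\<le>n. fps_nth (?c j) n)"
  have z: "fps_nth (?c j) n = 0" if "n < j" for j n
  proof -
    have "fps_nth (a ^ j) k = 0" if "k < j" for k
      using startsby_zero_power_prefix[OF assms] that by blast
    then show ?thesis using that by (auto simp: fps_mult_nth intro!: sum.neutral)
  qed
  have "?c sums ?s"
    unfolding sums_def
  proof (rule tendsto_fpsI)
    fix n
    show "\<forall>\<^sub>F m in sequentially. fps_nth (\<Sum>j<m. ?c j) n = fps_nth ?s n"
      using eventually_gt_at_top[of n]
    proof eventually_elim
      fix m assume "m > n"
      then have "(\<Sum>j<m. fps_nth (?c j) n) = (\<Sum>j\<le>n. fps_nth (?c j) n)"
        by (intro sum.mono_neutral_right) (auto intro!: z)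
      then show "fps_nth (\<Sum>j<m. ?c j) n = fps_nth ?s n"
        by (simp add: fps_sum_nth)
    qed
  qed
  then have "subst_puiseux N f a = ?s"
    unfolding subst_puiseux_def by (rule sums_unique[symmetric])
  then show ?thesis by simp
qed

text \<open>
  \<open>g = w \<cdot> \<Prod>\<^bsub>i<p\<^esub> (y - \<alpha>\<^sub>i)\<close> with a unit \<open>w\<close> of \<open>\<complex>{x,y}\<close> and convergent Puiseux series
  \<open>\<alpha>\<^sub>i\<close> of positive order. Here \<^term>\<open>fps_X\<close> is \<open>y\<close>.
\<close>

definition puiseux_factorization ::
    "complex fps fps \<Rightarrow> nat \<Rightarrow> nat \<Rightarrow> (nat \<Rightarrow> complex fps) \<Rightarrow> bool" where
  "puiseux_factorization g N p \<alpha> \<longleftrightarrow> N > 0 \<and>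
     (\<forall>i<p. fps_nth (\<alpha> i) 0 = 0 \<and> fps_conv_radius (\<alpha> i) > 0) \<and>
     (\<exists>w :: cps2. w dvd 1 \<and>
        ramify N g = ramify N (fps_of_cps2 w) * (\<Prod>i<p. fps_X - fps_const (\<alpha> i)))"

definition puiseux_ord :: "nat \<Rightarrow> complex fps \<Rightarrow> rat" where
  "puiseux_ord N a = of_nat (subdegree a) / of_nat N"

text \<open>
  The condition \<open>\<alpha> i \<noteq> \<alpha> j\<close> is automatic for \<open>i \<noteq> j\<close> when \<open>f\<close> has no multiple factors; it
  is needed because \<^term>\<open>subdegree 0 = 0\<close>, whereas \<open>ord 0\<close> is infinite.
\<close>

definition char_exponents :: "cps2 \<Rightarrow> rat set" where
  "char_exponents f = {puiseux_ord N (\<alpha> i - \<alpha> j) | N \<alpha> i j.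
     puiseux_factorization (fps_of_cps2 f) N (subdegree (at_x0 f)) \<alpha> \<and>
     i < subdegree (at_x0 f) \<and> j < subdegree (at_x0 f) \<and> i \<noteq> j \<and> \<alpha> i \<noteq> \<alpha> j}"


section \<open>The discriminant of \<open>(x,f)\<close>\<close>

text \<open>
  \<open>D\<close> is a discriminant if it equals \<open>\<Prod>\<^sub>j (v - f(u, \<gamma>\<^sub>j(u)))\<close> up to a unit \<open>w\<close> of \<open>\<complex>{u,v}\<close>,
  where \<open>u = t\<^sup>N\<close>. The derivative \<^const>\<open>fps_deriv\<close> is \<open>\<partial>/\<partial>y\<close>, as \<open>y\<close> is the outer variable.
\<close>

definition is_discriminant :: "cps2 \<Rightarrow> cps2 \<Rightarrow> bool" where
  "is_discriminant f D \<longleftrightarrow> (\<exists>N \<gamma>.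
     puiseux_factorization (fps_deriv (fps_of_cps2 f)) N (subdegree (at_x0 f) - 1) \<gamma> \<and>
     (\<exists>w :: cps2. w dvd 1 \<and>
        ramify N (fps_of_cps2 D) = ramify N (fps_of_cps2 w) *
          (\<Prod>j<subdegree (at_x0 f) - 1.
             fps_X - fps_const (subst_puiseux N (fps_of_cps2 f) (\<gamma> j)))))"


section \<open>Newton diagram and non-degeneracy\<close>

definition newton_diagram :: "cps2 \<Rightarrow> (real \<times> real) set" where
  "newton_diagram g = convex hull
     {(real i + s, real j + t) | i j s t. coeff2 g i j \<noteq> 0 \<and> s \<ge> 0 \<and> t \<ge> 0}"

definition compact_edge :: "(real \<times> real) set \<Rightarrow> cps2 \<Rightarrow> bool" where
  "compact_edge S g \<longleftrightarrow> S edge_of newton_diagram g \<and> compact S"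

definition edge_part :: "cps2 \<Rightarrow> (real \<times> real) set \<Rightarrow> complex fps fps" where
  "edge_part g S =
     Abs_fps (\<lambda>j. Abs_fps (\<lambda>i. if (real i, real j) \<in> S then coeff2 g i j else 0))"

text \<open>
  \<open>g\<^sub>S = c u\<^sup>k v\<^sup>l \<Prod>\<^bsub>i<r\<^esub> (v\<^sup>q - a\<^sub>i u\<^sup>p)\<^bsup>s\<^sub>i\<^esup>\<close>; the inner \<^term>\<open>fps_X\<close> is \<open>u\<close>, the outer one is \<open>v\<close>.
\<close>

definition edge_factorization :: "cps2 \<Rightarrow> (real \<times> real) set \<Rightarrow> complex \<Rightarrow> nat \<Rightarrow> nat \<Rightarrow>
    nat \<Rightarrow> nat \<Rightarrow> nat \<Rightarrow> (nat \<Rightarrow> complex) \<Rightarrow> (nat \<Rightarrow> nat) \<Rightarrow> bool" where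
  "edge_factorization g S c k l p q r a s \<longleftrightarrow>
     c \<noteq> 0 \<and> p > 0 \<and> q > 0 \<and> coprime p q \<and>
     (\<forall>i<r. a i \<noteq> 0 \<and> s i > 0) \<and> inj_on a {..<r} \<and>
     edge_part g S = fps_const (fps_const c * fps_X ^ k) * fps_X ^ l *
       (\<Prod>i<r. (fps_X ^ q - fps_const (fps_const (a i) * fps_X ^ p)) ^ s i)"

text \<open>
  Every compact edge has such a factorization, unique up to the order of the factors.
\<close>

definition nondegenerate :: "cps2 \<Rightarrow> bool" where
  "nondegenerate g \<longleftrightarrow> (\<forall>S. compact_edge S g \<longrightarrow>
     (\<exists>c k l p q r a s. edge_factorization g S c k l p q r a s \<and> (\<forall>i<r. s i = 1)))"

end

theory Submission
  imports Defs
begin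

text \<open>
  Let \<open>x = t\<^sup>N\<close>, let \<open>\<xi>\<close> be a primitive \<open>N\<close>-th root of unity and let \<open>a(t)\<close> be a Puiseux root of \<open>f\<close>.
  As \<open>f\<close> is irreducible, its roots are the distinct conjugates of \<open>a\<close>, obtained by substituting
  \<open>\<xi>\<^sup>k t\<close> for \<open>t\<close>. They form a tree whose vertices (bars) at height \<open>d\<close> have \<open>n\<close> branches each, where
  \<open>n\<close> depends only on the characteristic exponent \<open>d\<close>. At least \<open>n - 1\<close> roots \<open>\<gamma>\<^sub>j\<close> of \<open>\<partial>f/\<partial>y\<close> leave a bar
  along its center, and the leading term of \<open>f(\<gamma>\<^sub>j)\<close> is the same for all of them. Two factors
  \<open>v - f(\<gamma>\<^sub>j)\<close> with equal leading terms give a multiple factor on an edge of the Newton diagram, so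
  non-degeneracy forces \<open>n = 2\<close> for every characteristic exponent. This yields \<open>p = 2\<close> if \<open>h = 1\<close> and
  \<open>p = 4\<close> if \<open>h = 2\<close>. If \<open>h > 2\<close>, then \<open>8\<close> divides \<open>p\<close>, and the order of \<open>f(\<gamma>\<^sub>j)\<close> on the two bars of
  the second level is an integer, so their conjugate leading terms coincide. If \<open>h = 2\<close> and
  \<open>p = 4\<close>, this order is a proper half-integer and the leading coefficients are \<open>K\<close> and \<open>-K\<close>.
\<close>

text \<open>The shape of the tree is handled purely by divisibility: conjugation by
  \<open>\<xi> ^ k\<close> fixes the nonzero coefficient of t^s in a root exactly when
  \<open>N dvd k * s\<close>, and branch numbers, \<open>p\<close> and the order of
  f(\<open>\<gamma>\<close>) all follow from such relations. The leading terms agree because f at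
  the center of a bar starts with a constant of the bar times P(0), where P has the coefficients of
  the roots on the bar as zeros; P(0) is nonzero since conjugation only multiplies a nonzero
  coefficient by a root of unity. The obstacle is that the factors v - f(\<open>\<gamma>\<close>)
  live over t, while Newton diagrams and their edges live over u = t^N. Positive weights bridge the
  gap: compact edges are cut out by them, initial forms are multiplicative, and ramification only
  rescales the weight of u. In units of t, the order E on the second level is (p/2)(d1 + d2). If p =
  4, then N divides 2 d1 and 4 d2 but not 2 d2, which produces the sign of -K; if p = 8r, then E =
  4r (d1 + d2) is a multiple of N.\<close>

unbundle no vec_syntax and fps_syntax

section \<open>Substitutions in power series\<close>

text \<open>A common form of two substitutions: \<open>c = fps_X ^ N\<close> is ramification,
  \<open>c = fps_const z * fps_X\<close> is rotation of the parameter. Both respect products because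
  \<open>c\<close> has no constant term.\<close>

definition comp_coeffs :: "'a::idom fps \<Rightarrow> 'a fps fps \<Rightarrow> 'a fps fps" where
  "comp_coeffs c F = Abs_fps (\<lambda>j. F $ j oo c)"

lemma comp_coeffs_nth [simp]: "comp_coeffs c F $ j = F $ j oo c"
  by (simp add: comp_coeffs_def)

lemma comp_coeffs_mult:
  "c $ 0 = 0 \<Longrightarrow> comp_coeffs c (F * G) = comp_coeffs c F * comp_coeffs c G"
  by (rule fps_ext) (simp add: fps_mult_nth fps_compose_sum_distrib fps_compose_mult_distrib)

lemma comp_coeffs_1 [simp]: "comp_coeffs c 1 = 1"
  by (rule fps_ext) (simp add: fps_one_nth)

lemma comp_coeffs_diff: "comp_coeffs c (F - G) = comp_coeffs c F - comp_coeffs c G"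
  by (rule fps_ext) (simp add: fps_compose_sub_distrib)

lemma comp_coeffs_X [simp]: "comp_coeffs c fps_X = fps_X"
  by (rule fps_ext) (simp add: fps_X_def)

lemma comp_coeffs_const [simp]: "comp_coeffs c (fps_const a) = fps_const (a oo c)"
  by (rule fps_ext) simp

lemma comp_coeffs_prod:
  "c $ 0 = 0 \<Longrightarrow> comp_coeffs c (\<Prod>i\<in>A. F i) = (\<Prod>i\<in>A. comp_coeffs c (F i))"
  by (induction A rule: infinite_finite_induct) (simp_all add: comp_coeffs_mult)

lemma comp_coeffs_power: "c $ 0 = 0 \<Longrightarrow> comp_coeffs c (F ^ n) = comp_coeffs c F ^ n"
  by (induction n) (simp_all add: comp_coeffs_mult)

lemma comp_coeffs_linear_prod:
  "c $ 0 = 0 \<Longrightarrow> comp_coeffs c (\<Prod>i\<in>A. fps_X - fps_const (\<alpha> i)) =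
     (\<Prod>i\<in>A. fps_X - fps_const (\<alpha> i oo c))"
  by (simp add: comp_coeffs_prod comp_coeffs_diff)

lemma comp_coeffs_deriv: "comp_coeffs c (fps_deriv F) = fps_deriv (comp_coeffs c F)"
proof (rule fps_ext)
  fix j
  have "(of_nat (j+1) * F $ (j+1)) oo c = of_nat (j+1) * (F $ (j+1) oo c)"
    by (simp only: fps_of_nat[symmetric] fps_const_mult_apply_left)
  then show "comp_coeffs c (fps_deriv F) $ j = fps_deriv (comp_coeffs c F) $ j" by simp
qed

lemma ramify_eq_comp_coeffs: "ramify N F = comp_coeffs (fps_X ^ N) F"
  by (simp add: ramify_def comp_coeffs_def)

lemma X_power_nth_0: "N > 0 \<Longrightarrow> (fps_X ^ N :: 'a::comm_ring_1 fps) $ 0 = 0"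
  by (simp add: fps_X_power_nth)

lemma ramify_mult: "N > 0 \<Longrightarrow> ramify N (F * G) = ramify N F * ramify N G"
  by (simp add: ramify_eq_comp_coeffs comp_coeffs_mult X_power_nth_0)

lemma compose_X_power_nth:
  assumes N: "N > 0"
  shows "(a oo fps_X ^ N) $ n = (if N dvd n then a $ (n div N) else (0::'a::idom))"
proof -
  have "(a oo fps_X ^ N) $ n = (\<Sum>i=0..n. if n = N * i then a $ i else 0)"
    unfolding fps_compose_nth power_mult[symmetric] fps_X_power_nth
    by (intro sum.cong refl) auto
  also have "\<dots> = (\<Sum>i\<in>{i\<in>{0..n}. n = N * i}. a $ i)"
    by (rule sum.inter_filter[symmetric]) auto
  also have "{i\<in>{0..n}. n = N * i} = (if N dvd n then {n div N} else {})"
    using N by auto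
  finally show ?thesis by simp
qed

lemma ramify_nth:
  "N > 0 \<Longrightarrow> ramify N F $ j $ n = (if N dvd n then F $ j $ (n div N) else 0)"
  by (simp add: ramify_def compose_X_power_nth)

lemma ramify_nth_mult: "N > 0 \<Longrightarrow> ramify N F $ j $ (N * n) = F $ j $ n"
  by (simp add: ramify_nth)

lemma ramify_inject: "N > 0 \<Longrightarrow> ramify N F = ramify N G \<longleftrightarrow> F = G"
  by (metis fps_ext ramify_nth_mult)

lemma ramify_ramify:
  assumes "N > 0" "k > 0" shows "comp_coeffs (fps_X ^ k) (ramify N F) = ramify (N * k) F"
proof -
  have "(a oo fps_X ^ N) oo fps_X ^ k = a oo fps_X ^ (N * k)" for a :: "complex fps"
    using assms by (simp add: fps_compose_assoc[symmetric] X_power_nth_0 fps_compose_power[symmetric] power_mult[symmetric] mult.commute)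
  then show ?thesis by (intro fps_ext) (simp add: ramify_def)
qed

text \<open>Substitution of \<open>a\<close> for \<open>y\<close>; meaningful only if \<open>a(0) = 0\<close>, since the sum is cut off at \<open>j = n\<close>.\<close>

definition eval_y :: "complex fps fps \<Rightarrow> complex fps \<Rightarrow> complex fps" where
  "eval_y F a = Abs_fps (\<lambda>n. (\<Sum>j\<le>n. F $ j * a ^ j) $ n)"

lemma subst_puiseux_eq_eval: "a $ 0 = 0 \<Longrightarrow> subst_puiseux N F a = eval_y (ramify N F) a"
  by (rule fps_ext) (simp add: subst_puiseux_nth eval_y_def fps_sum_nth)

lemma mult_power_nth_eq_0:
  assumes "a $ 0 = 0" "k < j" shows "(b * a ^ j) $ k = (0::complex)"
proof -
  have "a ^ j $ l = 0" if "l < j" for l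
    using startsby_zero_power_prefix[OF assms(1)] that by blast
  then show ?thesis using assms(2) by (auto simp: fps_mult_nth intro!: sum.neutral)
qed

text \<open>As \<open>a ^ j\<close> has order at least j, a higher cutoff adds only terms that
  vanish at \<open>k\<close>. A common cutoff turns evaluation into an identity of finite
  sums.\<close>

lemma eval_y_nth:
  assumes "a $ 0 = 0" "k \<le> K"
  shows "eval_y F a $ k = (\<Sum>j\<le>K. F $ j * a ^ j) $ k"
proof -
  have "(\<Sum>j\<le>K. (F $ j * a ^ j) $ k) = (\<Sum>j\<le>k. (F $ j * a ^ j) $ k)"
    using assms by (intro sum.mono_neutral_right) (auto simp: mult_power_nth_eq_0)
  then show ?thesis by (simp add: eval_y_def fps_sum_nth)
qed

lemma eval_y_add: "eval_y (F + G) a = eval_y F a + eval_y G a"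
  by (rule fps_ext) (simp add: eval_y_def fps_sum_nth algebra_simps sum.distrib)

lemma eval_y_diff: "eval_y (F - G) a = eval_y F a - eval_y G a"
  by (rule fps_ext) (simp add: eval_y_def fps_sum_nth algebra_simps sum_subtractf)

lemma eval_y_sum: "eval_y (\<Sum>i\<in>A. F i) a = (\<Sum>i\<in>A. eval_y (F i) a)"
proof (induction A rule: infinite_finite_induct)
  case (infinite A) then show ?case by (simp add: eval_y_def fps_ext)
next
  case empty then show ?case by (simp add: eval_y_def fps_ext)
next
  case (insert x A) then show ?case by (simp add: eval_y_add)
qed

lemma eval_y_const [simp]:
  assumes "a $ 0 = 0" shows "eval_y (fps_const b) a = b"
proof (rule fps_ext)
  fix n
  have "(\<Sum>j\<le>n. (fps_const b $ j * a ^ j) $ n) = (\<Sum>j\<in>{0}. (fps_const b $ j * a ^ j) $ n)"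
    by (rule sum.mono_neutral_right) auto
  then show "eval_y (fps_const b) a $ n = b $ n" by (simp add: eval_y_def fps_sum_nth)
qed

lemma eval_y_1 [simp]: "a $ 0 = 0 \<Longrightarrow> eval_y 1 a = 1"
  using eval_y_const[of a 1] by simp

lemma eval_y_X [simp]:
  assumes "a $ 0 = 0" shows "eval_y fps_X a = a"
proof (rule fps_ext)
  fix n
  have "eval_y fps_X a $ n = (\<Sum>j\<le>Suc n. (fps_X $ j * a ^ j) $ n)"
    using eval_y_nth[OF assms, of n "Suc n" fps_X] by (simp add: fps_sum_nth)
  also have "\<dots> = (\<Sum>j\<in>{1}. (fps_X $ j * a ^ j) $ n)"
    by (rule sum.mono_neutral_right) (auto simp: fps_X_def)
  finally show "eval_y fps_X a $ n = a $ n" by simp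
qed

lemma eval_y_mult:
  assumes a: "a $ 0 = 0" shows "eval_y (F * G) a = eval_y F a * eval_y G a"
proof (rule fps_ext)
  fix n
  define PF where "PF = (\<Sum>j\<le>n. F $ j * a ^ j)"
  define PG where "PG = (\<Sum>j\<le>n. G $ j * a ^ j)"
  have "(eval_y F a * eval_y G a) $ n = (PF * PG) $ n"
    unfolding fps_mult_nth PF_def PG_def
    by (intro sum.cong refl) (simp add: eval_y_nth[OF a, of _ n])
  also have "PF * PG = (\<Sum>(b,l)\<in>{..n} \<times> {..n}. F $ b * G $ l * a ^ (b + l))"
    unfolding PF_def PG_def sum_product sum.cartesian_product
    by (intro sum.cong refl) (auto simp: power_add)
  also have "\<dots> $ n = (\<Sum>(b,l)\<in>{..n} \<times> {..n}. (F $ b * G $ l * a ^ (b + l)) $ n)"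
    by (simp add: fps_sum_nth case_prod_unfold)
  also have "\<dots> = (\<Sum>(b,l)\<in>{(b,l). b + l \<le> n}. (F $ b * G $ l * a ^ (b + l)) $ n)"
  proof (rule sum.mono_neutral_right)
    show "\<forall>x\<in>{..n} \<times> {..n} - {(b,l). b + l \<le> n}.
        (case x of (b, l) \<Rightarrow> (F $ b * G $ l * a ^ (b + l)) $ n) = 0"
      by (auto intro!: mult_power_nth_eq_0[OF a])
  qed auto
  also have "\<dots> = (\<Sum>j\<le>n. \<Sum>b\<le>j. (F $ b * G $ (j - b) * a ^ (b + (j - b))) $ n)"
    by (rule sum.triangle_reindex_eq)
  also have "\<dots> = (\<Sum>j\<le>n. ((F * G) $ j * a ^ j) $ n)"
  proof (intro sum.cong refl)
    fix j
    have "(F * G) $ j * a ^ j = (\<Sum>b\<le>j. F $ b * G $ (j - b) * a ^ (b + (j - b)))"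
      unfolding fps_mult_nth sum_distrib_right atLeast0AtMost
      by (intro sum.cong refl) auto
    then show "(\<Sum>b\<le>j. (F $ b * G $ (j - b) * a ^ (b + (j - b))) $ n) = ((F * G) $ j * a ^ j) $ n"
      by (simp add: fps_sum_nth)
  qed
  finally show "eval_y (F * G) a $ n = (eval_y F a * eval_y G a) $ n"
    by (simp add: eval_y_def fps_sum_nth)
qed

lemma eval_y_prod:
  "a $ 0 = 0 \<Longrightarrow> eval_y (\<Prod>i\<in>A. F i) a = (\<Prod>i\<in>A. eval_y (F i) a)"
  by (induction A rule: infinite_finite_induct) (simp_all add: eval_y_mult)

lemma eval_y_power: "a $ 0 = 0 \<Longrightarrow> eval_y (F ^ n) a = eval_y F a ^ n"
  by (induction n) (simp_all add: eval_y_mult)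

lemma eval_y_linear_prod:
  "a $ 0 = 0 \<Longrightarrow> eval_y (\<Prod>i\<in>A. fps_X - fps_const (\<alpha> i)) a = (\<Prod>i\<in>A. a - \<alpha> i)"
  by (simp add: eval_y_prod eval_y_diff)

lemma eval_y_nth_0: "eval_y F a $ 0 = F $ 0 $ 0"
  by (simp add: eval_y_def)

lemma eval_y_comp_coeffs:
  assumes a: "a $ 0 = 0" and c: "c $ 0 = 0"
  shows "eval_y (comp_coeffs c F) (a oo c) = eval_y F a oo c"
proof (rule fps_ext)
  fix n
  have "(eval_y F a oo c) $ n = ((\<Sum>j\<le>n. F $ j * a ^ j) oo c) $ n"
    unfolding fps_compose_nth by (intro sum.cong refl) (simp add: eval_y_nth[OF a, of _ n])
  also have "(\<Sum>j\<le>n. F $ j * a ^ j) oo c = (\<Sum>j\<le>n. comp_coeffs c F $ j * (a oo c) ^ j)"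
    by (simp add: fps_compose_sum_distrib fps_compose_mult_distrib[OF c] fps_compose_power[OF c])
  finally show "eval_y (comp_coeffs c F) (a oo c) $ n = (eval_y F a oo c) $ n"
    by (simp add: eval_y_def)
qed

section \<open>Galois action on the parameter\<close>

definition rot :: "'a::idom \<Rightarrow> 'a fps \<Rightarrow> 'a fps" where
  "rot z a = a oo (fps_const z * fps_X)"

lemma rot_nth [simp]: "rot z a $ n = z ^ n * a $ n"
  by (simp add: rot_def fps_compose_linear)

lemma rot_rot: "rot z (rot w a) = rot (z * w) a"
  by (rule fps_ext) (simp add: power_mult_distrib)

lemma rot_1 [simp]: "rot 1 a = a"
  by (rule fps_ext) simp

lemma rot_diff: "rot z (a - b) = rot z a - rot z b"
  by (rule fps_ext) (simp add: algebra_simps)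

lemma rot_inject: "z \<noteq> 0 \<Longrightarrow> rot z a = rot z b \<longleftrightarrow> a = b"
  by (auto simp: fps_eq_iff)

lemma subdegree_rot: "z \<noteq> 0 \<Longrightarrow> subdegree (rot z a) = subdegree a"
proof (cases "a = 0")
  case True
  then show ?thesis by (metis fps_ext fps_zero_nth mult_zero_right rot_nth)
next
  case False
  then show "z \<noteq> 0 \<Longrightarrow> subdegree (rot z a) = subdegree a"
    by (intro subdegreeI) (auto simp: nth_less_subdegree_zero)
qed

definition rotY :: "complex \<Rightarrow> complex fps fps \<Rightarrow> complex fps fps" where
  "rotY z F = comp_coeffs (fps_const z * fps_X) F"

lemma rotY_nth [simp]: "rotY z F $ j = rot z (F $ j)"
  by (simp add: rotY_def rot_def)

lemma rotY_mult: "rotY z (F * G) = rotY z F * rotY z G"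
  by (simp add: rotY_def comp_coeffs_mult)

lemma rotY_linear_prod:
  "rotY z (\<Prod>i\<in>A. fps_X - fps_const (\<alpha> i)) = (\<Prod>i\<in>A. fps_X - fps_const (rot z (\<alpha> i)))"
  by (simp add: rotY_def comp_coeffs_linear_prod rot_def)

lemma rotY_ramify: "N > 0 \<Longrightarrow> z ^ N = 1 \<Longrightarrow> rotY z (ramify N F) = ramify N F"
  by (intro fps_ext) (auto simp: ramify_nth power_mult)

lemma eval_y_rot: "a $ 0 = 0 \<Longrightarrow> eval_y (rotY z F) (rot z a) = rot z (eval_y F a)"
  unfolding rotY_def rot_def by (rule eval_y_comp_coeffs) simp_all

section \<open>Galois conjugation of Puiseux roots\<close>

lemma ex_primitive_root_of_unity:
  assumes "N > 0" shows "\<exists>\<xi>::complex. \<forall>m. \<xi> ^ m = 1 \<longleftrightarrow> N dvd m"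
proof (intro exI allI)
  fix m
  have "exp (2 * of_real pi * \<i> / of_nat N) ^ m = exp (2 * of_real pi * \<i> * of_nat m / of_nat N)"
    by (simp add: exp_of_nat_mult[symmetric] algebra_simps)
  then show "exp (2 * of_real pi * \<i> / of_nat N) ^ m = 1 \<longleftrightarrow> N dvd m"
    using complex_root_unity_eq_1[of N m] assms by simp
qed

lemma unit_nth_00: "w dvd 1 \<Longrightarrow> fps_of_cps2 w $ 0 $ 0 \<noteq> 0"
proof
  assume "w dvd 1" and z: "fps_of_cps2 w $ 0 $ 0 = 0"
  then obtain k where "1 = w * k" by (elim dvdE)
  then have "1 = fps_of_cps2 w * fps_of_cps2 k" by (metis one_cps2.rep_eq times_cps2.rep_eq)
  then have "(1::complex fps fps) $ 0 $ 0 = (fps_of_cps2 w * fps_of_cps2 k) $ 0 $ 0" by simp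
  then show False using z by simp
qed

lemma bounded_nth_of_conv_radius_pos:
  assumes "fps_conv_radius (a :: complex fps) > 0"
  shows "\<exists>r>0. \<exists>M. \<forall>i. norm (a $ i) * r ^ i \<le> M"
proof -
  obtain r where r: "0 < ereal r" "ereal r < fps_conv_radius a"
    using ereal_dense2[OF assms] by blast
  have "summable (\<lambda>n. a $ n * of_real r ^ n)"
    using r by (intro summable_fps) auto
  then have "Bseq (\<lambda>n. a $ n * of_real r ^ n)"
    using summable_LIMSEQ_zero Bseq_eq_bounded convergent_imp_Bseq convergentI by metis
  then obtain M where "\<And>n. norm (a $ n * of_real r ^ n) \<le> M"
    unfolding Bseq_def by blast
  then have "norm (a $ n) * r ^ n \<le> M" for n
    using r by (simp add: norm_mult norm_power)
  with r show ?thesis by auto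
qed

lemma convergent2_X: "convergent2 fps_X"
proof -
  have "norm ((fps_X :: complex fps fps) $ j $ i) * 1 ^ (i + j) \<le> (1::real)" for i j
    by (simp add: fps_X_def fps_one_nth)
  then show ?thesis unfolding convergent2_iff_bounded using zero_less_one by blast
qed

lemma convergent2_const:
  assumes "fps_conv_radius a > 0" shows "convergent2 (fps_const a)"
proof -
  obtain r M where "r > 0" and M: "\<And>i. norm (a $ i) * r ^ i \<le> M"
    using bounded_nth_of_conv_radius_pos[OF assms] by blast
  have "norm (fps_const a $ j $ i) * r ^ (i + j) \<le> max M 0" for i j
    using M[of i] by (simp add: max.coboundedI1)
  with \<open>r > 0\<close> show ?thesis unfolding convergent2_iff_bounded by blast
qed

lemma convergent2_prod: "(\<And>i. i \<in> A \<Longrightarrow> convergent2 (F i)) \<Longrightarrow> convergent2 (\<Prod>i\<in>A. F i)"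
  by (induction A rule: infinite_finite_induct)
     (simp_all add: convergent2_mult convergent2_one)

lemma convergent2_linear_prod:
  "(\<And>i. i \<in> A \<Longrightarrow> fps_conv_radius (\<alpha> i) > 0) \<Longrightarrow> convergent2 (\<Prod>i\<in>A. fps_X - fps_const (\<alpha> i))"
  by (intro convergent2_prod convergent2_diff convergent2_X convergent2_const)

text \<open>Invariance gives \<open>\<xi> ^ i * c = c\<close> for every coefficient c of t^i, so
  only exponents divisible by \<open>N\<close> survive. Convergence has to descend as well, because
  irreducibility refers to convergent series.\<close>

lemma unramify:
  assumes N: "N > 0" and \<xi>: "\<And>m. \<xi> ^ m = 1 \<longleftrightarrow> N dvd m"
    and inv: "rotY \<xi> P = P" and conv: "convergent2 P"
  obtains g where "P = ramify N (fps_of_cps2 g)"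
proof -
  define P0 where "P0 = Abs_fps (\<lambda>j. Abs_fps (\<lambda>i. P $ j $ (N * i)))"
  have zero: "P $ j $ i = 0" if "\<not> N dvd i" for i j
  proof -
    have "\<xi> ^ i * P $ j $ i = P $ j $ i"
      using arg_cong[OF inv, of "\<lambda>P. P $ j $ i"] by simp
    then show ?thesis using \<xi>[of i] that by auto
  qed
  have P: "P = ramify N P0"
    using N zero by (intro fps_ext) (auto simp: ramify_nth P0_def)
  obtain r M where r: "r > 0" and M: "\<And>i j. norm (P $ j $ i) * r ^ (i + j) \<le> M"
    using conv unfolding convergent2_iff_bounded by blast
  \<comment> \<open>The cap at 1 lets the radius \<open>s ^ N\<close> work in both variables: N(i +
    j) is at least N i + j, so it gives the smaller power.\<close>
  define s where "s = min r 1"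
  have s: "0 < s" "s \<le> 1" "s \<le> r" using r by (auto simp: s_def)
  have "norm (P0 $ j $ i) * (s ^ N) ^ (i + j) \<le> M" for i j
  proof -
    have "(s ^ N) ^ (i + j) \<le> s ^ (N * i + j)"
      unfolding power_mult[symmetric] using s N
      by (intro power_decreasing) (auto simp: algebra_simps)
    also have "\<dots> \<le> r ^ (N * i + j)" using s by (intro power_mono) auto
    finally have "norm (P $ j $ (N * i)) * (s ^ N) ^ (i + j) \<le> norm (P $ j $ (N * i)) * r ^ (N * i + j)"
      by (intro mult_left_mono) auto
    with M[of j "N * i"] show ?thesis by (simp add: P0_def)
  qed
  moreover have "s ^ N > 0" using s by simp
  ultimately have "convergent2 P0" unfolding convergent2_iff_bounded by blast
  then have "P = ramify N (fps_of_cps2 (Abs_cps2 P0))" using P by (simp add: Abs_cps2_inverse)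
  then show ?thesis by (rule that)
qed

text \<open>Takes the place of unique factorization: at y = \<open>\<alpha> i\<close> the left side
  vanishes while V keeps its nonzero constant term, so a linear factor on the right must
  vanish.\<close>

lemma linear_prod_roots_subset:
  fixes U V :: "complex fps fps"
  assumes "finite A" "finite B" and eq: "U * (\<Prod>i\<in>A. fps_X - fps_const (\<alpha> i)) = V * (\<Prod>i\<in>B. fps_X - fps_const (\<beta> i))"
    and V: "V $ 0 $ 0 \<noteq> 0" and \<alpha>: "\<And>i. i \<in> A \<Longrightarrow> \<alpha> i $ 0 = 0"
  shows "\<alpha> ` A \<subseteq> \<beta> ` B"
proof clarify
  fix i assume i: "i \<in> A"
  have "eval_y V (\<alpha> i) * (\<Prod>k\<in>B. \<alpha> i - \<beta> k) = eval_y U (\<alpha> i) * (\<Prod>k\<in>A. \<alpha> i - \<alpha> k)"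
    using arg_cong[OF eq, of "\<lambda>F. eval_y F (\<alpha> i)"] \<alpha>[OF i]
    by (simp add: eval_y_mult eval_y_linear_prod)
  also have "(\<Prod>k\<in>A. \<alpha> i - \<alpha> k) = 0" using i assms(1) by (auto intro: prod_zero)
  finally have "eval_y V (\<alpha> i) = 0 \<or> (\<Prod>k\<in>B. \<alpha> i - \<beta> k) = 0" by simp
  moreover have "eval_y V (\<alpha> i) $ 0 \<noteq> 0" using V by (simp add: eval_y_nth_0)
  ultimately have "(\<Prod>k\<in>B. \<alpha> i - \<beta> k) = 0" by auto
  then show "\<alpha> i \<in> \<beta> ` B" using assms(2) by auto
qed

lemma linear_factor_nonzero: "fps_X - fps_const \<beta> \<noteq> (0 :: 'a::idom fps)"
proof
  assume "fps_X - fps_const \<beta> = 0"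
  then have "(fps_X - fps_const \<beta>) $ 1 = 0" by simp
  then show False by simp
qed

lemma linear_prod_nth_00:
  assumes "finite A" "i \<in> A" "\<alpha> i $ 0 = (0::'a::idom)"
  shows "(\<Prod>i\<in>A. fps_X - fps_const (\<alpha> i)) $ 0 $ 0 = 0"
  using assms by (subst prod.remove[of A i]) simp_all

lemma ramify_nth_00: "N > 0 \<Longrightarrow> ramify N F $ 0 $ 0 = F $ 0 $ 0"
  by (simp add: ramify_nth)

text \<open>Rotating the factorization yields a second factorization of the same series. Serves for
  the roots of f and for those of its y-derivative.\<close>

lemma linear_prod_rot_closed:
  fixes G W :: "complex fps fps" and p :: nat
  assumes inv: "rotY \<xi> G = G" and G: "G = W * (\<Prod>i<p. fps_X - fps_const (\<alpha> i))"
    and W: "W $ 0 $ 0 \<noteq> 0" and \<alpha>: "\<And>i. i < p \<Longrightarrow> \<alpha> i $ 0 = 0" and i: "i < p"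
  shows "rot \<xi> (\<alpha> i) \<in> \<alpha> ` {..<p}"
proof -
  have "rotY \<xi> W * (\<Prod>i<p. fps_X - fps_const (rot \<xi> (\<alpha> i))) = W * (\<Prod>i<p. fps_X - fps_const (\<alpha> i))"
    using inv unfolding G by (simp add: rotY_mult rotY_linear_prod)
  then have "(\<lambda>i. rot \<xi> (\<alpha> i)) ` {..<p} \<subseteq> \<alpha> ` {..<p}"
    using W \<alpha> by (intro linear_prod_roots_subset[where V = W]) auto
  then show ?thesis using i by auto
qed

text \<open>The product P over one orbit and the complementary product Q are both invariant and
  descend to convergent series in x and y. P vanishes at the origin, so irreducibility makes the
  descent of Q a unit, which leaves Q without factors.\<close>

lemma puiseux_roots_orbit:
  assumes irr: "irreducible f" and fac: "puiseux_factorization (fps_of_cps2 f) N p \<alpha>" and p: "p > 0"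
    and \<xi>: "\<And>m. \<xi> ^ m = 1 \<longleftrightarrow> N dvd m"
  shows "inj_on \<alpha> {..<p}" "\<alpha> ` {..<p} = range (\<lambda>k. rot (\<xi> ^ k) (\<alpha> 0))"
proof -
  from fac obtain w where N: "N > 0" and \<alpha>0: "\<And>i. i < p \<Longrightarrow> \<alpha> i $ 0 = 0"
    and conv: "\<And>i. i < p \<Longrightarrow> fps_conv_radius (\<alpha> i) > 0" and w: "w dvd 1"
    and f: "ramify N (fps_of_cps2 f) = ramify N (fps_of_cps2 w) * (\<Prod>i<p. fps_X - fps_const (\<alpha> i))"
    by (auto simp: puiseux_factorization_def)
  have \<xi>N: "\<xi> ^ N = 1" using \<xi> by simp
  then have \<xi>0: "\<xi> \<noteq> 0" using N by (metis neq0_conv power_0_left zero_neq_one)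
  have w00: "ramify N (fps_of_cps2 w) $ 0 $ 0 \<noteq> 0"
    using unit_nth_00[OF w] N by (simp add: ramify_nth_00)
  let ?W = "ramify N (fps_of_cps2 w)"
  define O' where "O' = range (\<lambda>k. rot (\<xi> ^ k) (\<alpha> 0))"
  have closed: "rot \<xi> (\<alpha> i) \<in> \<alpha> ` {..<p}" if "i < p" for i
    by (rule linear_prod_rot_closed[OF _ f w00 \<alpha>0 that]) (auto simp: rotY_ramify N \<xi>N)
  have "rot (\<xi> ^ k) (\<alpha> 0) \<in> \<alpha> ` {..<p}" for k
  proof (induction k)
    case 0 then show ?case using p by simp
  next
    case (Suc k)
    then obtain i where "i < p" "rot (\<xi> ^ k) (\<alpha> 0) = \<alpha> i" by auto
    moreover have "rot (\<xi> ^ Suc k) (\<alpha> 0) = rot \<xi> (rot (\<xi> ^ k) (\<alpha> 0))" by (simp add: rot_rot)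
    ultimately show ?case using closed[of i] by simp
  qed
  then have sub: "O' \<subseteq> \<alpha> ` {..<p}" by (auto simp: O'_def)
  then have fin: "finite O'" by (rule finite_subset) simp
  have injrot: "inj_on (rot \<xi>) O'" using \<xi>0 by (auto simp: inj_on_def rot_inject)
  have "rot \<xi> ` O' \<subseteq> O'"
    by (auto simp: O'_def rot_rot power_Suc[symmetric] simp del: power_Suc)
  then have rotO: "rot \<xi> ` O' = O'" using fin injrot endo_inj_surj by blast
  \<comment> \<open>\<open>I\<close> picks one index for each conjugate. Repeated roots would remain
    in \<open>Q\<close>, so \<open>I = {..<p}\<close> also yields that the roots are
    distinct.\<close>
  obtain I where I: "I \<subseteq> {..<p}" "inj_on \<alpha> I" "O' = \<alpha> ` I"
    using sub unfolding subset_image_inj by blast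
  define P where "P = (\<Prod>\<beta>\<in>O'. fps_X - fps_const \<beta>)"
  define Q where "Q = (\<Prod>i\<in>{..<p} - I. fps_X - fps_const (\<alpha> i))"
  have PI: "P = (\<Prod>i\<in>I. fps_X - fps_const (\<alpha> i))"
    unfolding P_def I(3) using I(2) by (simp add: prod.reindex)
  have PQ: "(\<Prod>i<p. fps_X - fps_const (\<alpha> i)) = P * Q"
    unfolding PI Q_def using I(1) by (simp add: prod.subset_diff mult.commute)
  have "P = (\<Prod>\<beta>\<in>rot \<xi> ` O'. fps_X - fps_const \<beta>)" by (simp add: P_def rotO)
  also have "\<dots> = rotY \<xi> P" unfolding P_def rotY_linear_prod using injrot by (simp add: prod.reindex)
  finally have rotP: "rotY \<xi> P = P" ..
  have Pnz: "P \<noteq> 0"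
    unfolding P_def using fin by (simp add: linear_factor_nonzero)
  \<comment> \<open>Invariance of \<open>Q\<close> comes from that of the whole series by cancelling
    \<open>?W\<close> and \<open>P\<close>.\<close>
  have "?W * (P * rotY \<xi> Q) = rotY \<xi> (ramify N (fps_of_cps2 f))"
    unfolding f PQ by (simp add: rotY_mult rotP rotY_ramify N \<xi>N)
  also have "\<dots> = ?W * (P * Q)"
    using rotY_ramify[OF N \<xi>N, of "fps_of_cps2 f"] unfolding f PQ .
  finally have rotQ: "rotY \<xi> Q = Q" using Pnz w00 by auto
  have "convergent2 P" unfolding PI using I(1) conv by (intro convergent2_linear_prod) auto
  then obtain g where g: "P = ramify N (fps_of_cps2 g)" using unramify[OF N \<xi> rotP] by blast
  have "convergent2 Q" unfolding Q_def using conv by (intro convergent2_linear_prod) auto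
  then obtain h where h: "Q = ramify N (fps_of_cps2 h)" using unramify[OF N \<xi> rotQ] by blast
  have "ramify N (fps_of_cps2 f) = ramify N (fps_of_cps2 (w * g * h))"
    by (simp add: f PQ g h times_cps2.rep_eq ramify_mult N mult.assoc)
  then have "f = (w * g) * h" using N by (simp add: ramify_inject fps_of_cps2_inject)
  then have unit: "w * g dvd 1 \<or> h dvd 1" using irr by (rule irreducibleD[rotated])
  have "\<alpha> 0 \<in> O'" unfolding O'_def using rangeI[of "\<lambda>k. rot (\<xi> ^ k) (\<alpha> 0)" 0] by simp
  then have "P $ 0 $ 0 = 0"
    unfolding P_def by (rule linear_prod_nth_00[OF fin]) (rule \<alpha>0[OF p])
  then have "fps_of_cps2 (w * g) $ 0 $ 0 = 0"
    using N by (simp add: g times_cps2.rep_eq ramify_nth_00)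
  then have "h dvd 1" using unit unit_nth_00 by blast
  then have Q00: "Q $ 0 $ 0 \<noteq> 0" using unit_nth_00 N by (simp add: h ramify_nth_00)
  have "{..<p} - I = {}"
  proof (rule ccontr)
    assume "{..<p} - I \<noteq> {}"
    then obtain i where i: "i \<in> {..<p} - I" by blast
    then have "Q $ 0 $ 0 = 0"
      unfolding Q_def by (rule linear_prod_nth_00[rotated]) (use i \<alpha>0 in auto)
    then show False using Q00 by simp
  qed
  then have "I = {..<p}" using I by blast
  then show "inj_on \<alpha> {..<p}" "\<alpha> ` {..<p} = range (\<lambda>k. rot (\<xi> ^ k) (\<alpha> 0))"
    using I by (auto simp: O'_def)
qed

text \<open>The exponents fixing \<open>a\<close> are the multiples of the least positive one, and
  this generator equals the size of the orbit.\<close>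

lemma rot_orbit_period:
  assumes N: "N > 0" and \<xi>: "\<And>m. \<xi> ^ m = 1 \<longleftrightarrow> N dvd m" and p: "p > 0"
    and card: "card (range (\<lambda>k. rot (\<xi> ^ k) a)) = p"
  shows "rot (\<xi> ^ k) a = a \<longleftrightarrow> p dvd k"
    and "inj_on (\<lambda>k. rot (\<xi> ^ k) a) {..<p}"
    and "range (\<lambda>k. rot (\<xi> ^ k) a) = (\<lambda>k. rot (\<xi> ^ k) a) ` {..<p}"
proof -
  let ?r = "\<lambda>k. rot (\<xi> ^ k) a"
  have \<xi>N: "\<xi> ^ N = 1" using \<xi> by simp
  then have \<xi>0: "\<xi> \<noteq> 0" using N by (metis neq0_conv power_0_left zero_neq_one)
  define T where "T = (LEAST k. k > 0 \<and> ?r k = a)"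
  have ex: "N > 0 \<and> ?r N = a" using N \<xi>N by simp
  have T: "T > 0" "?r T = a" unfolding T_def using LeastI[of "\<lambda>k. k > 0 \<and> ?r k = a", OF ex] by auto
  have least: "T \<le> k" if "k > 0" "?r k = a" for k
    unfolding T_def using that by (intro Least_le) auto
  have add: "?r (k + l) = rot (\<xi> ^ k) (?r l)" for k l by (simp add: rot_rot power_add)
  have mult: "?r (T * q) = a" for q
    by (induction q) (simp_all add: add T(2))
  have mod: "?r k = ?r (k mod T)" for k
  proof -
    have "?r k = ?r (k mod T + T * (k div T))" by simp
    also have "\<dots> = ?r (k mod T)" by (simp only: add mult)
    finally show ?thesis .
  qed
  have iff: "?r k = a \<longleftrightarrow> T dvd k" for k
  proof
    assume "?r k = a"
    then have "?r (k mod T) = a" using mod by simp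
    then have "k mod T = 0" using least[of "k mod T"] T(1) by (meson gr0I leD mod_less_divisor)
    then show "T dvd k" by auto
  qed (use mult in auto)
  have inj: "inj_on ?r {..<T}"
  proof (rule linorder_inj_onI')
    fix k l assume kl: "k \<in> {..<T}" "l \<in> {..<T}" "k < l"
    show "?r k \<noteq> ?r l"
    proof
      assume "?r k = ?r l"
      also have "?r l = rot (\<xi> ^ k) (?r (l - k))" using add[of k "l - k"] kl by simp
      finally have "?r (l - k) = a" using \<xi>0 by (simp add: rot_inject)
      then show False using least[of "l - k"] kl by auto
    qed
  qed
  have range: "range ?r = ?r ` {..<T}"
  proof -
    have "?r k \<in> ?r ` {..<T}" for k using mod[of k] T(1) by auto
    then show ?thesis by auto
  qed
  have "T = p" using card card_image[OF inj] by (simp add: range)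
  then show "rot (\<xi> ^ k) a = a \<longleftrightarrow> p dvd k" "inj_on ?r {..<p}" "range ?r = ?r ` {..<p}"
    using iff inj range by auto
qed

section \<open>Leading terms and polar roots\<close>

text \<open>The coefficient \<open>c\<close> may be 0, and then the order exceeds \<open>e\<close>.
  This keeps sums and products free of case distinctions and covers the zero series.\<close>

definition leading_term :: "complex fps \<Rightarrow> nat \<Rightarrow> complex \<Rightarrow> bool" where
  "leading_term h e c \<longleftrightarrow> (\<forall>k<e. h $ k = 0) \<and> h $ e = c"

lemma leading_term_mult:
  assumes "leading_term h e c" "leading_term h' e' c'"
  shows "leading_term (h * h') (e + e') (c * c')"
  unfolding leading_term_def
proof (intro conjI allI impI)
  fix k assume "k < e + e'"
  then have "i < e \<or> k - i < e'" if "i \<le> k" for i using that by linarith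
  then have "h $ i * h' $ (k - i) = 0" if "i \<le> k" for i
    using that assms by (auto simp: leading_term_def)
  then show "(h * h') $ k = 0" unfolding fps_mult_nth by (intro sum.neutral) auto
next
  have "i < e \<or> e + e' - i < e'" if "i \<le> e + e'" "i \<noteq> e" for i using that by linarith
  then have "h $ i * h' $ (e + e' - i) = 0" if "i \<le> e + e'" "i \<noteq> e" for i
    using that assms by (auto simp: leading_term_def)
  then have "(\<Sum>i\<in>{0..e+e'}. h $ i * h' $ (e + e' - i)) = (\<Sum>i\<in>{e}. h $ i * h' $ (e + e' - i))"
    by (intro sum.mono_neutral_right) auto
  then show "(h * h') $ (e + e') = c * c'" using assms by (simp add: fps_mult_nth leading_term_def)
qed

lemma leading_term_prod:
  "(\<And>i. i \<in> A \<Longrightarrow> leading_term (h i) (e i) (c i)) \<Longrightarrow>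
     leading_term (\<Prod>i\<in>A. h i) (\<Sum>i\<in>A. e i) (\<Prod>i\<in>A. c i)"
proof (induction A rule: infinite_finite_induct)
  case (insert x A)
  then show ?case by (simp add: leading_term_mult)
qed (simp_all add: leading_term_def)

lemma leading_term_add:
  "leading_term h e c \<Longrightarrow> leading_term h' e c' \<Longrightarrow> leading_term (h + h') e (c + c')"
  by (simp add: leading_term_def)

lemma leading_term_sum:
  "(\<And>i. i \<in> A \<Longrightarrow> leading_term (h i) e (c i)) \<Longrightarrow>
     leading_term (\<Sum>i\<in>A. h i) e (\<Sum>i\<in>A. c i)"
  by (simp add: leading_term_def fps_sum_nth)

lemma leading_term_unique:
  "leading_term h e c \<Longrightarrow> leading_term h e' c' \<Longrightarrow> c \<noteq> 0 \<Longrightarrow> c' \<noteq> 0 \<Longrightarrow> e = e' \<and> c = c'"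
  by (metis leading_term_def linorder_neqE_nat)

lemma leading_term_less: "leading_term h e c \<Longrightarrow> e' < e \<Longrightarrow> leading_term h e' 0"
  by (simp add: leading_term_def)

lemma leading_term_0: "leading_term h 0 (h $ 0)"
  by (simp add: leading_term_def)

lemma leading_term_rot: "leading_term h e c \<Longrightarrow> leading_term (rot z h) e (z ^ e * c)"
  by (simp add: leading_term_def)

section \<open>Bars of the tree of roots\<close>

definition agree :: "nat \<Rightarrow> complex fps \<Rightarrow> complex fps \<Rightarrow> bool" where
  "agree d a b \<longleftrightarrow> (\<forall>m<d. a $ m = b $ m)"

text \<open>The minimum of \<open>d\<close> and \<open>ord (x - a)\<close>, also for \<open>x = a\<close>.\<close>

definition contact :: "nat \<Rightarrow> complex fps \<Rightarrow> complex fps \<Rightarrow> nat" where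
  "contact d a x = (if agree d x a then d else subdegree (x - a))"

lemma not_agree_subdegree:
  assumes "\<not> agree d x a" shows "x \<noteq> a" "subdegree (x - a) < d"
proof -
  obtain m where "m < d" "(x - a) $ m \<noteq> 0" using assms by (auto simp: agree_def)
  then show "x \<noteq> a" "subdegree (x - a) < d"
    using subdegree_leI[of "x - a" m] by auto
qed

text \<open>If x separates from \<open>a\<close> below height \<open>d\<close>, then y and
  \<open>a\<close> still agree at the separation, so \<open>a\<close> may replace y; otherwise
  \<open>d\<close> is the first place where y and x can differ.\<close>

lemma leading_term_contact:
  assumes "agree d y a"
  shows "leading_term (y - x) (contact d a x)
    (if agree d x a then y $ d - x $ d else (a - x) $ contact d a x)"
proof (cases "agree d x a")
  case True
  then show ?thesis using assms by (auto simp: leading_term_def contact_def agree_def)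
next
  case False
  have *: "(a - x) $ k = 0" if "k < subdegree (x - a)" for k
    using nth_less_subdegree_zero[OF that] by simp
  have "(y - x) $ k = (a - x) $ k" if "k \<le> subdegree (x - a)" for k
    using that not_agree_subdegree[OF False] assms by (simp add: agree_def)
  then have "leading_term (y - x) (subdegree (x - a)) ((a - x) $ subdegree (x - a))"
    unfolding leading_term_def using * by (metis less_imp_le order_refl)
  then show ?thesis using False by (simp only: contact_def if_False)
qed

lemma not_agree_contact_nz:
  assumes "\<not> agree d x a" shows "(a - x) $ contact d a x \<noteq> 0" "contact d a x < d"
proof -
  have "x - a \<noteq> 0" using not_agree_subdegree[OF assms] by simp
  then have "(x - a) $ subdegree (x - a) \<noteq> 0" by (rule nth_subdegree_nonzero)
  then show "(a - x) $ contact d a x \<noteq> 0" using assms by (simp add: contact_def)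
  show "contact d a x < d" using assms not_agree_subdegree[OF assms] by (simp add: contact_def)
qed

lemma contact_le: "contact d a x \<le> d"
  using not_agree_contact_nz[of d x a] by (cases "agree d x a") (auto simp: contact_def)

lemma fps_deriv_prod:
  fixes F :: "'b \<Rightarrow> 'a::comm_ring_1 fps"
  assumes "finite A"
  shows "fps_deriv (\<Prod>i\<in>A. F i) = (\<Sum>i\<in>A. fps_deriv (F i) * (\<Prod>k\<in>A - {i}. F k))"
  using assms
proof (induction A)
  case (insert x A)
  have "(\<Sum>i\<in>A. fps_deriv (F i) * (\<Prod>k\<in>insert x A - {i}. F k)) =
        (\<Sum>i\<in>A. F x * (fps_deriv (F i) * (\<Prod>k\<in>A - {i}. F k)))"
  proof (intro sum.cong refl)
    fix i assume i: "i \<in> A"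
    then have "insert x A - {i} = insert x (A - {i})" using insert by auto
    then show "fps_deriv (F i) * (\<Prod>k\<in>insert x A - {i}. F k) = F x * (fps_deriv (F i) * (\<Prod>k\<in>A - {i}. F k))"
      using insert by (simp add: mult_ac)
  qed
  moreover have "insert x A - {x} = A" using insert by auto
  ultimately show ?case using insert by (simp add: sum_distrib_left algebra_simps)
qed simp

definition bar_poly :: "nat \<Rightarrow> ('b \<Rightarrow> complex fps) \<Rightarrow> 'b set \<Rightarrow> complex poly" where
  "bar_poly d r B = (\<Prod>i\<in>B. [:- (r i $ d), 1:])"

lemma poly_bar_poly: "poly (bar_poly d r B) z = (\<Prod>i\<in>B. z - r i $ d)"
  by (simp add: bar_poly_def poly_prod)

lemma bar_poly_nz: "finite B \<Longrightarrow> bar_poly d r B \<noteq> 0"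
  by (simp add: bar_poly_def)

definition off_coeff :: "nat \<Rightarrow> complex fps \<Rightarrow> ('b \<Rightarrow> complex fps) \<Rightarrow> 'b set \<Rightarrow> complex" where
  "off_coeff d a r I = (\<Prod>i\<in>{i\<in>I. \<not> agree d (r i) a}. (a - r i) $ contact d a (r i))"

lemma off_coeff_nz: "off_coeff d a r I \<noteq> 0"
proof (cases "finite {i\<in>I. \<not> agree d (r i) a}")
  case True
  then show ?thesis unfolding off_coeff_def
    using not_agree_contact_nz(1) by (subst prod_zero_iff) blast+
qed (simp add: off_coeff_def)

lemma leading_term_linear_prod:
  assumes "agree d y a" and I: "finite I"
  shows "leading_term (\<Prod>i\<in>I. y - r i) (\<Sum>i\<in>I. contact d a (r i))
    (off_coeff d a r I * poly (bar_poly d r {i\<in>I. agree d (r i) a}) (y $ d))"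
proof -
  let ?c = "\<lambda>i. if agree d (r i) a then y $ d - r i $ d else (a - r i) $ contact d a (r i)"
  have "leading_term (\<Prod>i\<in>I. y - r i) (\<Sum>i\<in>I. contact d a (r i)) (\<Prod>i\<in>I. ?c i)"
    by (intro leading_term_prod leading_term_contact assms)
  moreover have "(\<Prod>i\<in>I. ?c i) = off_coeff d a r I * poly (bar_poly d r {i\<in>I. agree d (r i) a}) (y $ d)"
    using I by (subst prod.If_cases)
      (auto simp: off_coeff_def poly_bar_poly mult.commute Int_def Collect_conj_eq[symmetric] intro!: arg_cong2[where f = "(*)"] prod.cong)
  ultimately show ?thesis by simp
qed

lemma ex_nonroot:
  fixes q :: "complex poly" assumes "q \<noteq> 0" shows "\<exists>z. poly q z \<noteq> 0"
  using assms poly_all_0_iff_0 by blast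

text \<open>
  On the bar \<open>y = a + O(t\<^sup>d)\<close> with free coefficient \<open>z\<close> of \<open>t\<^sup>d\<close>, the leading coefficient of
  \<open>\<partial>G/\<partial>y\<close> is up to a constant \<open>P'(z)\<close>, where \<open>P\<close> has the \<open>t\<^sup>d\<close>-coefficients of the roots of \<open>G\<close>
  on the bar as its zeros; by the factorization of \<open>\<partial>G/\<partial>y\<close> it is also \<open>\<Prod>(z - g\<^sub>j)\<close> over the \<open>\<gamma>\<^sub>j\<close> on the
  bar. Invariance of \<open>P\<close> under a rotation of order at least \<open>n\<close> makes \<open>P'\<close> divisible by \<open>z\<^bsup>n-1\<^esup>\<close>.
\<close>

lemma critical_points_on_bar:
  fixes R :: "complex fps set" and \<gamma> :: "nat \<Rightarrow> complex fps"
  assumes G: "G = W * (\<Prod>x\<in>R. fps_X - fps_const x)" and W: "W $ 0 $ 0 \<noteq> 0"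
    and R: "finite R" "\<And>x. x \<in> R \<Longrightarrow> x $ 0 = 0" "a \<in> R"
    and G': "fps_deriv G = V * (\<Prod>j<q. fps_X - fps_const (\<gamma> j))" and V: "V $ 0 $ 0 \<noteq> 0"
    and \<gamma>: "\<And>j. j < q \<Longrightarrow> \<gamma> j $ 0 = 0"
    and d: "d > 0" "\<And>x. x \<in> R \<Longrightarrow> x $ d \<noteq> 0"
    and z: "z \<noteq> 0" "rot z ` R \<subseteq> R" "agree d (rot z a) a"
    and n: "\<And>k. 0 < k \<Longrightarrow> k < n \<Longrightarrow> (z ^ d) ^ k \<noteq> 1"
  shows "n - 1 \<le> card {j. j < q \<and> agree d (\<gamma> j) a \<and> \<gamma> j $ d = 0}"
proof -
  define B where "B = {x\<in>R. agree d x a}"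
  define E where "E = (\<Sum>x\<in>R. contact d a x)"
  define C where "C = off_coeff d a (\<lambda>x. x) R"
  define P where "P = bar_poly d (\<lambda>x. x) B"
  have Cnz: "C \<noteq> 0" by (simp add: C_def off_coeff_nz)
  have finB: "finite B" using R by (simp add: B_def)
  have aB: "a \<in> B" using R by (simp add: B_def agree_def)
  have ltF: "leading_term (\<Prod>x\<in>R. y - x) E (C * poly P (y $ d))" if "agree d y a" for y
    using leading_term_linear_prod[OF that R(1), of "\<lambda>x. x"] by (simp add: E_def C_def P_def B_def)
  have contact_a: "contact d a a = d" by (simp add: contact_def agree_def)
  have Esplit: "E = contact d a x + (\<Sum>u\<in>R - {x}. contact d a u)" if "x \<in> R" for x
    unfolding E_def using R(1) that by (rule sum.remove)
  have Ed: "d \<le> E" using Esplit[OF R(3)] contact_a by simp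
  have ltF': "leading_term (\<Sum>x\<in>R. \<Prod>u\<in>R - {x}. y - u) (E - d) (C * poly (pderiv P) (y $ d))"
    if y: "agree d y a" for y
  proof -
    have "leading_term (\<Prod>u\<in>R - {x}. y - u) (E - d)
        (if agree d x a then C * (\<Prod>u\<in>B - {x}. y $ d - u $ d) else 0)" if x: "x \<in> R" for x
    proof -
      have lt: "leading_term (\<Prod>u\<in>R - {x}. y - u) (E - contact d a x)
         (off_coeff d a (\<lambda>x. x) (R - {x}) * poly (bar_poly d (\<lambda>x. x) {i\<in>R - {x}. agree d i a}) (y $ d))"
        using leading_term_linear_prod[OF y, of "R - {x}" "\<lambda>x. x"] R(1) Esplit[OF x] by simp
      show ?thesis
      proof (cases "agree d x a")
        case True
        then have "{i\<in>R - {x}. agree d i a} = B - {x}"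
            "{i\<in>R - {x}. \<not> agree d i a} = {i\<in>R. \<not> agree d i a}" by (auto simp: B_def)
        then show ?thesis using lt True by (simp add: C_def off_coeff_def poly_bar_poly contact_def)
      next
        case False
        \<comment> \<open>Omitting a root off the bar lowers the order by less than
          \<open>d\<close>, so this summand vanishes at order \<open>E - d\<close>.\<close>
        have "E - d < E - contact d a x"
          using not_agree_contact_nz(2)[OF False] Ed by linarith
        then show ?thesis using leading_term_less[OF lt] False by simp
      qed
    qed
    then have "leading_term (\<Sum>x\<in>R. \<Prod>u\<in>R - {x}. y - u) (E - d)
       (\<Sum>x\<in>R. if agree d x a then C * (\<Prod>u\<in>B - {x}. y $ d - u $ d) else 0)"
      by (rule leading_term_sum)
    also have "(\<Sum>x\<in>R. if agree d x a then C * (\<Prod>u\<in>B - {x}. y $ d - u $ d) else 0) =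
       (\<Sum>x\<in>B. C * (\<Prod>u\<in>B - {x}. y $ d - u $ d))"
      unfolding B_def by (rule sum.inter_filter[symmetric]) (rule R(1))
    also have "\<dots> = C * poly (pderiv P) (y $ d)"
      by (simp add: P_def bar_poly_def pderiv_prod poly_sum poly_prod pderiv_pCons sum_distrib_left)
    finally show ?thesis .
  qed
  have deriv: "fps_deriv G = fps_deriv W * (\<Prod>x\<in>R. fps_X - fps_const x) +
      W * (\<Sum>x\<in>R. \<Prod>u\<in>R - {x}. fps_X - fps_const u)"
    unfolding G by (simp add: fps_deriv_prod R(1) algebra_simps)
  have y0: "y $ 0 = 0" if "agree d y a" for y using that d(1) R by (auto simp: agree_def)
  have lt1: "leading_term (eval_y (fps_deriv G) y) (E - d) (W $ 0 $ 0 * C * poly (pderiv P) (y $ d))"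
    if y: "agree d y a" for y
  proof -
    have "eval_y (fps_deriv G) y = eval_y (fps_deriv W) y * (\<Prod>x\<in>R. y - x) +
        eval_y W y * (\<Sum>x\<in>R. \<Prod>u\<in>R - {x}. y - u)"
      unfolding deriv by (simp add: y0[OF y] eval_y_add eval_y_mult eval_y_linear_prod eval_y_sum)
    \<comment> \<open>The derivative of the unit comes with the full product, of order at least
      \<open>E\<close>, which is above \<open>E - d\<close>.\<close>
    moreover have "leading_term (eval_y (fps_deriv W) y * (\<Prod>x\<in>R. y - x)) (E - d) 0"
      by (rule leading_term_less[OF leading_term_mult[OF leading_term_0 ltF[OF y]]])
         (use Ed d in auto)
    moreover have "leading_term (eval_y W y * (\<Sum>x\<in>R. \<Prod>u\<in>R - {x}. y - u)) (0 + (E - d))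
        (eval_y W y $ 0 * (C * poly (pderiv P) (y $ d)))"
      by (rule leading_term_mult[OF leading_term_0 ltF'[OF y]])
    ultimately show ?thesis
      using leading_term_add by (fastforce simp: eval_y_nth_0 mult.assoc)
  qed
  define B' where "B' = {j\<in>{..<q}. agree d (\<gamma> j) a}"
  define E' where "E' = (\<Sum>j<q. contact d a (\<gamma> j))"
  define C' where "C' = off_coeff d a \<gamma> {..<q}"
  define Q where "Q = bar_poly d \<gamma> B'"
  have C'nz: "C' \<noteq> 0" by (simp add: C'_def off_coeff_nz)
  have lt2: "leading_term (eval_y (fps_deriv G) y) E' (V $ 0 $ 0 * C' * poly Q (y $ d))"
    if y: "agree d y a" for y
  proof -
    have "eval_y (fps_deriv G) y = eval_y V y * (\<Prod>j<q. y - \<gamma> j)"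
      unfolding G' by (simp add: y0[OF y] eval_y_mult eval_y_linear_prod)
    moreover have "leading_term (\<Prod>j<q. y - \<gamma> j) E' (C' * poly Q (y $ d))"
      using leading_term_linear_prod[OF y, of "{..<q}" \<gamma>] by (simp add: E'_def C'_def Q_def B'_def)
    ultimately show ?thesis
      using leading_term_mult[OF leading_term_0[of "eval_y V y"]] by (fastforce simp: eval_y_nth_0 mult.assoc)
  qed
  define yy where "yy = (\<lambda>w. Abs_fps (\<lambda>m. if m < d then a $ m else if m = d then w else 0))"
  have yy: "agree d (yy w) a" "yy w $ d = w" for w by (auto simp: agree_def yy_def)
  have "degree P = card B"
    unfolding P_def bar_poly_def by (subst degree_prod_eq_sum_degree) auto
  then have "degree P \<noteq> 0" using finB aB by auto
  then have P'nz: "pderiv P \<noteq> 0" by (simp add: pderiv_eq_0_iff)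
  have Qnz: "Q \<noteq> 0" unfolding Q_def by (rule bar_poly_nz) (simp add: B'_def)
  \<comment> \<open>Where neither polynomial vanishes, both descriptions give true leading terms,
    which identifies the orders; the coefficients then agree for every w.\<close>
  have "pderiv P * Q \<noteq> 0" using P'nz Qnz by simp
  then obtain w where "poly (pderiv P * Q) w \<noteq> 0" using ex_nonroot by blast
  then have "poly (pderiv P) w \<noteq> 0" "poly Q w \<noteq> 0" by auto
  then have EE': "E - d = E'"
    using leading_term_unique[OF lt1[OF yy(1)] lt2[OF yy(1)], of w] W V Cnz C'nz by (simp add: yy)
  have "W $ 0 $ 0 * C * poly (pderiv P) w = V $ 0 $ 0 * C' * poly Q w" for w
    using lt1[OF yy(1), of w] lt2[OF yy(1), of w] EE' by (auto simp: yy leading_term_def)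
  then have "poly (smult (W $ 0 $ 0 * C) (pderiv P)) = poly (smult (V $ 0 $ 0 * C') Q)"
    by (intro ext) simp
  then have PQ: "smult (W $ 0 $ 0 * C) (pderiv P) = smult (V $ 0 $ 0 * C') Q"
    by (simp only: poly_eq_poly_eq_iff)
  have rotB: "rot z ` B = B"
  proof (rule endo_inj_surj[OF finB])
    show "rot z ` B \<subseteq> B" using z by (auto simp: B_def agree_def)
    show "inj_on (rot z) B" using z by (auto simp: inj_on_def rot_inject)
  qed
  have Peta: "poly P (z ^ d * w) = (z ^ d) ^ card B * poly P w" for w
  proof -
    have "poly P (z ^ d * w) = (\<Prod>x\<in>rot z ` B. z ^ d * w - x $ d)"
      by (simp add: P_def poly_bar_poly rotB)
    also have "\<dots> = (\<Prod>x\<in>B. z ^ d * w - z ^ d * x $ d)"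
      using z(1) by (subst prod.reindex) (auto simp: inj_on_def rot_inject)
    also have "\<dots> = (\<Prod>x\<in>B. z ^ d * (w - x $ d))" by (simp add: algebra_simps)
    finally show ?thesis by (simp add: prod.distrib P_def poly_bar_poly)
  qed
  \<comment> \<open>P(0) is up to sign a product of nonzero coefficients, so taking w = 0 forces the
    root-of-unity factor to be 1.\<close>
  have "poly P 0 \<noteq> 0" using d finB by (auto simp: P_def poly_bar_poly B_def)
  then have "(z ^ d) ^ card B = 1" using Peta[of 0] by simp
  then have "poly (pcompose P [:0, z ^ d:]) = poly P"
    using Peta by (intro ext) (simp add: poly_pcompose mult.commute)
  then have "pcompose P [:0, z ^ d:] = P" by (simp only: poly_eq_poly_eq_iff)
  then have invP: "(z ^ d) ^ k * coeff P k = coeff P k" for k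
    by (metis coeff_pcompose_linear)
  then have coP: "coeff (pderiv P) k = 0" if "k < n - 1" for k
  proof -
    have "(z ^ d) ^ Suc k \<noteq> 1" using n[of "Suc k"] that by auto
    then have "coeff P (Suc k) = 0"
      using invP[of "Suc k"] by auto
    then show ?thesis by (simp add: coeff_pderiv)
  qed
  define J where "J = {j. j < q \<and> agree d (\<gamma> j) a \<and> \<gamma> j $ d = 0}"
  have J: "J \<subseteq> B'" "finite B'" by (auto simp: J_def B'_def)
  \<comment> \<open>Splitting off the zeros at 0 shows that \<open>Q\<close> vanishes there to order
    exactly \<open>card J\<close>. Its multiple \<open>pderiv P\<close> has no coefficients below
    \<open>n - 1\<close>, whence the bound.\<close>
  have "Q = bar_poly d \<gamma> (B' - J) * bar_poly d \<gamma> J"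
    unfolding Q_def bar_poly_def by (rule prod.subset_diff) (use J in auto)
  also have "bar_poly d \<gamma> J = monom 1 (card J)"
    by (simp add: bar_poly_def J_def monom_altdef)
  finally have "coeff Q (card J) = poly (bar_poly d \<gamma> (B' - J)) 0"
    by (simp add: mult.commute[of _ "monom _ _"] coeff_monom_mult poly_0_coeff_0)
  also have "\<dots> \<noteq> 0" using J by (auto simp: poly_bar_poly J_def B'_def)
  finally have "coeff (smult (V $ 0 $ 0 * C') Q) (card J) \<noteq> 0" using V C'nz by simp
  then have "coeff (pderiv P) (card J) \<noteq> 0" unfolding PQ[symmetric] by auto
  then have "n - 1 \<le> card J" using coP by (meson not_less)
  then show ?thesis by (simp add: J_def)
qed

text \<open>At the center each root on the bar contributes the negative of its own nonzero
  coefficient, so \<open>K\<close> depends on the bar alone.\<close>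

lemma leading_term_at_bar_center:
  fixes R :: "complex fps set"
  assumes G: "G = W * (\<Prod>x\<in>R. fps_X - fps_const x)" and W: "W $ 0 $ 0 \<noteq> 0"
    and R: "finite R" "a $ 0 = 0" and d: "d > 0" "\<And>x. x \<in> R \<Longrightarrow> x $ d \<noteq> 0"
  shows "\<exists>K. K \<noteq> 0 \<and> (\<forall>y. agree d y a \<and> y $ d = 0 \<longrightarrow>
     leading_term (eval_y G y) (\<Sum>x\<in>R. contact d a x) K)"
proof -
  define K where "K = W $ 0 $ 0 * (off_coeff d a (\<lambda>x. x) R * poly (bar_poly d (\<lambda>x. x) {i\<in>R. agree d i a}) 0)"
  have "K \<noteq> 0" using W R d by (simp add: K_def off_coeff_nz poly_bar_poly)
  moreover have "leading_term (eval_y G y) (\<Sum>x\<in>R. contact d a x) K" if y: "agree d y a" "y $ d = 0" for y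
  proof -
    have "y $ 0 = 0" using y d R by (auto simp: agree_def)
    then have "eval_y G y = eval_y W y * (\<Prod>x\<in>R. y - x)"
      unfolding G by (simp add: eval_y_mult eval_y_linear_prod)
    moreover have "leading_term (eval_y W y * (\<Prod>x\<in>R. y - x)) (0 + (\<Sum>x\<in>R. contact d a x)) K"
      using leading_term_mult[OF leading_term_0[of "eval_y W y"] leading_term_linear_prod[OF y(1) R(1), of "\<lambda>x. x"]] y
      by (simp add: K_def eval_y_nth_0)
    ultimately show ?thesis by simp
  qed
  ultimately show ?thesis by blast
qed

section \<open>Initial forms and edges of the Newton diagram\<close>

definition weight_ge :: "real \<Rightarrow> real \<Rightarrow> real \<Rightarrow> complex fps fps \<Rightarrow> bool" where
  "weight_ge \<mu> \<nu> m g \<longleftrightarrow> (\<forall>i j. g $ j $ i \<noteq> 0 \<longrightarrow> m \<le> \<mu> * real i + \<nu> * real j)"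

text \<open>Under \<open>weight_ge \<mu> \<nu> m g\<close> this is the initial form of g, or 0 if
  \<open>m\<close> is below the minimal weight. Weights are real since they come from supporting
  lines.\<close>

definition weight_part :: "real \<Rightarrow> real \<Rightarrow> real \<Rightarrow> complex fps fps \<Rightarrow> complex fps fps" where
  "weight_part \<mu> \<nu> m g =
     Abs_fps (\<lambda>j. Abs_fps (\<lambda>i. if \<mu> * real i + \<nu> * real j = m then g $ j $ i else 0))"

lemma weight_part_nth [simp]:
  "weight_part \<mu> \<nu> m g $ j $ i = (if \<mu> * real i + \<nu> * real j = m then g $ j $ i else 0)"
  by (simp add: weight_part_def)

lemma fps2_mult_nth:
  "(g * h) $ j $ i = (\<Sum>b=0..j. \<Sum>a=0..i. g $ b $ a * h $ (j - b) $ (i - a) :: complex)"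
  by (simp add: fps_mult_nth fps_sum_nth)

lemma weight_split:
  "a \<le> i \<Longrightarrow> b \<le> j \<Longrightarrow> \<mu> * real i + \<nu> * real j =
     (\<mu> * real a + \<nu> * real b) + (\<mu> * real (i - a) + \<nu> * real (j - b))"
  by (simp add: of_nat_diff algebra_simps)

lemma weight_ge_mult:
  assumes "weight_ge \<mu> \<nu> m g" "weight_ge \<mu> \<nu> m' h"
  shows "weight_ge \<mu> \<nu> (m + m') (g * h)"
  unfolding weight_ge_def
proof (intro allI impI)
  fix i j assume "(g * h) $ j $ i \<noteq> 0"
  then obtain b where b: "b \<le> j" "(\<Sum>a=0..i. g $ b $ a * h $ (j - b) $ (i - a)) \<noteq> 0"
    unfolding fps2_mult_nth by (metis (no_types, lifting) atLeastAtMost_iff sum.neutral)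
  then obtain a where a: "a \<le> i" "g $ b $ a * h $ (j - b) $ (i - a) \<noteq> 0"
    by (metis (no_types, lifting) atLeastAtMost_iff sum.neutral)
  then have "m \<le> \<mu> * real a + \<nu> * real b" "m' \<le> \<mu> * real (i - a) + \<nu> * real (j - b)"
    using assms unfolding weight_ge_def by (metis mult_eq_0_iff)+
  then show "m + m' \<le> \<mu> * real i + \<nu> * real j"
    using weight_split[OF a(1) b(1), of \<mu> \<nu>] by linarith
qed

text \<open>Terms of weight above \<open>m\<close> or \<open>m'\<close> only produce products above
  \<open>m + m'\<close>.\<close>

lemma weight_part_mult:
  assumes "weight_ge \<mu> \<nu> m g" "weight_ge \<mu> \<nu> m' h"
  shows "weight_part \<mu> \<nu> (m + m') (g * h) = weight_part \<mu> \<nu> m g * weight_part \<mu> \<nu> m' h"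
proof (rule fps_ext, rule fps_ext)
  fix j i
  let ?w = "\<lambda>i j. \<mu> * real i + \<nu> * real j"
  have "(weight_part \<mu> \<nu> m g * weight_part \<mu> \<nu> m' h) $ j $ i =
      (\<Sum>b=0..j. \<Sum>a=0..i. if ?w i j = m + m' then g $ b $ a * h $ (j - b) $ (i - a) else 0)"
    unfolding fps2_mult_nth weight_part_nth
  proof (intro sum.cong refl)
    fix b a assume ba: "b \<in> {0..j}" "a \<in> {0..i}"
    have w: "?w i j = ?w a b + ?w (i - a) (j - b)" using ba by (intro weight_split) auto
    show "(if ?w a b = m then g $ b $ a else 0) * (if ?w (i - a) (j - b) = m' then h $ (j - b) $ (i - a) else 0)
       = (if ?w i j = m + m' then g $ b $ a * h $ (j - b) $ (i - a) else 0)"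
    proof (cases "g $ b $ a * h $ (j - b) $ (i - a) = 0")
      case False
      then have "m \<le> ?w a b" "m' \<le> ?w (i - a) (j - b)" using assms unfolding weight_ge_def by auto
      then show ?thesis using w by auto
    qed auto
  qed
  then show "weight_part \<mu> \<nu> (m + m') (g * h) $ j $ i =
      (weight_part \<mu> \<nu> m g * weight_part \<mu> \<nu> m' h) $ j $ i"
    by (simp add: fps2_mult_nth)
qed

lemma weight_const:
  assumes "\<mu> > 0" "\<nu> > 0"
  shows "weight_ge \<mu> \<nu> 0 w" "weight_part \<mu> \<nu> 0 w = fps_const (fps_const (w $ 0 $ 0))"
proof -
  show "weight_ge \<mu> \<nu> 0 w" using assms by (auto simp: weight_ge_def)
  have "\<mu> * real i + \<nu> * real j = 0 \<longleftrightarrow> i = 0 \<and> j = 0" for i j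
    using assms by (simp add: add_nonneg_eq_0_iff)
  then show "weight_part \<mu> \<nu> 0 w = fps_const (fps_const (w $ 0 $ 0))"
    by (intro fps_ext) auto
qed

lemma weight_prod:
  assumes "\<mu> > 0" "\<nu> > 0" "\<And>i. i \<in> A \<Longrightarrow> weight_ge \<mu> \<nu> (m i) (g i)"
  shows "weight_ge \<mu> \<nu> (\<Sum>i\<in>A. m i) (\<Prod>i\<in>A. g i) \<and>
    weight_part \<mu> \<nu> (\<Sum>i\<in>A. m i) (\<Prod>i\<in>A. g i) = (\<Prod>i\<in>A. weight_part \<mu> \<nu> (m i) (g i))"
  using assms(3)
  by (induction A rule: infinite_finite_induct)
     (simp_all add: weight_const[OF assms(1,2)] weight_ge_mult weight_part_mult)

lemma weight_min_unique:
  assumes "weight_ge \<mu> \<nu> m g" "weight_part \<mu> \<nu> m g \<noteq> 0" "weight_ge \<mu> \<nu> m' g" "weight_part \<mu> \<nu> m' g \<noteq> 0"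
  shows "m = m'"
proof -
  have *: "m' \<le> m" if "weight_part \<mu> \<nu> m g \<noteq> 0" "weight_ge \<mu> \<nu> m' g" for m m'
  proof -
    from that(1) obtain i j where "weight_part \<mu> \<nu> m g $ j $ i \<noteq> 0"
      by (metis fps_ext fps_zero_nth)
    then show ?thesis using that(2) by (auto simp: weight_ge_def split: if_splits)
  qed
  show ?thesis using *[of m m'] *[of m' m] assms by simp
qed

text \<open>As u = t^N, weight \<open>\<mu>\<close> for t means weight N \<open>\<mu>\<close> for
  u.\<close>

lemma weight_part_ramify:
  assumes N: "N > 0"
  shows "weight_part \<mu> \<nu> m (ramify N g) = ramify N (weight_part (real N * \<mu>) \<nu> m g)"
  using N by (intro fps_ext) (auto simp: ramify_nth mult_ac)

lemma weight_ge_ramify: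
  assumes N: "N > 0"
  shows "weight_ge \<mu> \<nu> m (ramify N g) \<longleftrightarrow> weight_ge (real N * \<mu>) \<nu> m g"
proof
  assume *: "weight_ge \<mu> \<nu> m (ramify N g)"
  show "weight_ge (real N * \<mu>) \<nu> m g"
    unfolding weight_ge_def
  proof (intro allI impI)
    fix i j assume "g $ j $ i \<noteq> 0"
    then have "ramify N g $ j $ (N * i) \<noteq> 0" using N by (simp add: ramify_nth_mult)
    then show "m \<le> real N * \<mu> * real i + \<nu> * real j"
      using * unfolding weight_ge_def by (fastforce simp: mult_ac)
  qed
next
  assume *: "weight_ge (real N * \<mu>) \<nu> m g"
  show "weight_ge \<mu> \<nu> m (ramify N g)"
    unfolding weight_ge_def
  proof (intro allI impI)
    fix i j assume nz: "ramify N g $ j $ i \<noteq> 0"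
    then have "N dvd i" using N by (simp add: ramify_nth split: if_splits)
    then obtain i' where i: "i = N * i'" ..
    then have "g $ j $ i' \<noteq> 0" using nz N by (simp add: ramify_nth_mult)
    then show "m \<le> \<mu> * real i + \<nu> * real j" using *[unfolded weight_ge_def, rule_format, of j i'] i by (simp add: mult_ac)
  qed
qed

abbreviation u_monom :: "complex \<Rightarrow> nat \<Rightarrow> complex fps" where
  "u_monom c e \<equiv> fps_const c * fps_X ^ e"

lemma u_monom_nth: "u_monom c e $ n = (if n = e then c else 0)"
  by (simp add: fps_X_power_nth)

lemma linear_factor_nth:
  "(fps_X - fps_const \<phi>) $ j $ i = (if j = 0 then - \<phi> $ i else if j = 1 \<and> i = 0 then 1 else (0::complex))"
  by (auto simp: fps_X_def fps_one_nth)

text \<open>The initial form of v - \<open>\<phi>\<close>(t) is v, a monomial in t, or both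
  together, depending on how \<open>\<nu>\<close> compares with \<open>\<mu>\<close> times the order
  of \<open>\<phi>\<close>. This lemma and the next two treat these cases.\<close>

lemma weight_linear_factor_v:
  assumes "\<mu> > 0" "\<nu> > 0" and e: "\<And>k. \<phi> $ k \<noteq> 0 \<Longrightarrow> \<nu> < \<mu> * real k"
  shows "weight_ge \<mu> \<nu> \<nu> (fps_X - fps_const \<phi>)"
    "weight_part \<mu> \<nu> \<nu> (fps_X - fps_const \<phi>) = fps_X"
proof -
  show "weight_ge \<mu> \<nu> \<nu> (fps_X - fps_const \<phi>)"
    using assms by (auto simp: weight_ge_def linear_factor_nth less_imp_le)
  have "fps_X $ j $ i = (if j = 1 \<and> i = 0 then 1 else (0::complex))" for i j
    by (auto simp: fps_X_def fps_one_nth)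
  then show "weight_part \<mu> \<nu> \<nu> (fps_X - fps_const \<phi>) = fps_X"
    using assms by (intro fps_ext) (auto simp: linear_factor_nth dest: e)
qed

lemma weight_linear_factor_u:
  assumes "\<mu> > 0" "\<nu> > 0" and e: "leading_term \<phi> e c" and lt: "\<mu> * real e < \<nu>"
  shows "weight_ge \<mu> \<nu> (\<mu> * real e) (fps_X - fps_const \<phi>)"
    "weight_part \<mu> \<nu> (\<mu> * real e) (fps_X - fps_const \<phi>) = - fps_const (u_monom c e)"
proof -
  have ge: "e \<le> k" if "\<phi> $ k \<noteq> 0" for k
    using e that by (meson leading_term_def not_le)
  show "weight_ge \<mu> \<nu> (\<mu> * real e) (fps_X - fps_const \<phi>)"
    using assms ge by (auto simp: weight_ge_def linear_factor_nth)
  show "weight_part \<mu> \<nu> (\<mu> * real e) (fps_X - fps_const \<phi>) = - fps_const (u_monom c e)"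
    using assms by (intro fps_ext) (auto simp: linear_factor_nth u_monom_nth leading_term_def)
qed

lemma weight_linear_factor_eq:
  assumes "\<mu> > 0" "\<nu> > 0" and e: "leading_term \<phi> e c" and eq: "\<nu> = \<mu> * real e"
  shows "weight_ge \<mu> \<nu> \<nu> (fps_X - fps_const \<phi>)"
    "weight_part \<mu> \<nu> \<nu> (fps_X - fps_const \<phi>) = fps_X - fps_const (u_monom c e)"
proof -
  have ge: "e \<le> k" if "\<phi> $ k \<noteq> 0" for k
    using e that by (meson leading_term_def not_le)
  show "weight_ge \<mu> \<nu> \<nu> (fps_X - fps_const \<phi>)"
    using assms ge by (auto simp: weight_ge_def linear_factor_nth)
  show "weight_part \<mu> \<nu> \<nu> (fps_X - fps_const \<phi>) = fps_X - fps_const (u_monom c e)"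
    using assms by (intro fps_ext) (auto simp: linear_factor_nth u_monom_nth leading_term_def)
qed

section \<open>Supporting weights of the Newton diagram\<close>

definition newton_points :: "cps2 \<Rightarrow> (real \<times> real) set" where
  "newton_points g = {(real i + s, real j + t) | i j s t. coeff2 g i j \<noteq> 0 \<and> s \<ge> 0 \<and> t \<ge> 0}"

lemma newton_diagram_eq: "newton_diagram g = convex hull (newton_points g)"
  by (simp add: newton_diagram_def newton_points_def)

lemma newton_points_shift:
  assumes "x \<in> newton_points g" "s \<ge> 0" "t \<ge> 0" shows "x + (s, t) \<in> newton_points g"
proof -
  obtain i j s' t' where "x = (real i + s', real j + t')" "coeff2 g i j \<noteq> 0" "s' \<ge> 0" "t' \<ge> 0"
    using assms(1) by (auto simp: newton_points_def)
  then have "x + (s, t) = (real i + (s' + s), real j + (t' + t)) \<and> coeff2 g i j \<noteq> 0 \<and> s' + s \<ge> 0 \<and> t' + t \<ge> 0"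
    using assms by simp
  then show ?thesis unfolding newton_points_def by blast
qed

lemma newton_diagram_shift:
  assumes "x \<in> newton_diagram g" "s \<ge> 0" "t \<ge> 0" shows "x + (s, t) \<in> newton_diagram g"
proof -
  have "(+) (s, t) ` newton_points g \<subseteq> newton_points g"
    using newton_points_shift[OF _ assms(2,3)] by (auto simp: add.commute)
  then have "convex hull ((+) (s, t) ` newton_points g) \<subseteq> newton_diagram g"
    unfolding newton_diagram_eq by (rule hull_mono)
  then show ?thesis using assms(1) unfolding convex_hull_translation newton_diagram_eq
    by (auto simp: add.commute)
qed

lemma support_in_newton_diagram: "coeff2 g i j \<noteq> 0 \<Longrightarrow> (real i, real j) \<in> newton_diagram g"
  unfolding newton_diagram_eq by (rule hull_inc) (force simp: newton_points_def)

lemma newton_diagram_weight_ge: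
  assumes "\<mu> > 0" "\<nu> > 0" "weight_ge \<mu> \<nu> m (fps_of_cps2 g)" "x \<in> newton_diagram g"
  shows "m \<le> (\<mu>, \<nu>) \<bullet> x"
proof -
  have "newton_points g \<subseteq> {x. (\<mu>, \<nu>) \<bullet> x \<ge> m}"
  proof
    fix x assume "x \<in> newton_points g"
    then obtain i j s t where *: "x = (real i + s, real j + t)" "coeff2 g i j \<noteq> 0" "s \<ge> 0" "t \<ge> 0"
      by (auto simp: newton_points_def)
    then have "m \<le> \<mu> * real i + \<nu> * real j" using assms(3) by (auto simp: weight_ge_def coeff2_def)
    moreover have "\<mu> * s \<ge> 0" "\<nu> * t \<ge> 0" using assms * by simp_all
    ultimately show "x \<in> {x. (\<mu>, \<nu>) \<bullet> x \<ge> m}" using * by (simp add: algebra_simps)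
  qed
  then have "newton_diagram g \<subseteq> {x. (\<mu>, \<nu>) \<bullet> x \<ge> m}"
    unfolding newton_diagram_eq by (rule hull_minimal) (rule convex_halfspace_ge)
  then show ?thesis using assms(4) by auto
qed

text \<open>A functional supporting the diagram at a relative interior point of the edge supplies
  the weights; compactness of the edge makes both positive.\<close>

lemma compact_edge_weight_part:
  assumes "compact_edge S g"
  obtains \<mu> \<nu> m where "\<mu> > 0" "\<nu> > 0" "weight_ge \<mu> \<nu> m (fps_of_cps2 g)"
    "edge_part g S = weight_part \<mu> \<nu> m (fps_of_cps2 g)" "weight_part \<mu> \<nu> m (fps_of_cps2 g) \<noteq> 0"
proof -
  let ?C = "newton_diagram g"
  have S: "S face_of ?C" "aff_dim S = 1" "compact S"
    using assms by (auto simp: compact_edge_def edge_of_def)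
  have convC: "convex ?C" unfolding newton_diagram_eq by (rule convex_convex_hull)
  have SC: "S \<subseteq> ?C" using S(1) by (rule face_of_imp_subset)
  have convS: "convex S" using S(1) by (rule face_of_imp_convex)
  have ray: "v \<in> {(1,0), (0,1)} \<Longrightarrow> \<not> (\<forall>s\<ge>0. z + s *\<^sub>R v \<in> S)" for z v :: "real \<times> real"
  proof
    assume v: "v \<in> {(1,0), (0,1)}" and *: "\<forall>s\<ge>0. z + s *\<^sub>R v \<in> S"
    obtain B where B: "\<And>x. x \<in> S \<Longrightarrow> norm x \<le> B"
      using compact_imp_bounded[OF S(3)] bounded_iff by blast
    have nv: "norm v = 1" using v by auto
    have "norm z \<le> B" using B[of "z + 0 *\<^sub>R v"] * by auto
    then have B0: "B \<ge> 0" using norm_ge_zero order_trans by blast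
    have "norm (z + (2 * B + 1) *\<^sub>R v) \<le> B" using B0 * by (intro B) auto
    moreover have "norm ((2 * B + 1) *\<^sub>R v) \<le> norm (z + (2 * B + 1) *\<^sub>R v) + norm z"
      by (metis add_diff_cancel_left' norm_triangle_ineq4 )
    ultimately show False using \<open>norm z \<le> B\<close> nv B0 by simp
  qed
  have "S \<noteq> {}" using S(2) by auto
  then obtain z where z: "z \<in> rel_interior S" using convS rel_interior_eq_empty by blast
  then have zS: "z \<in> S" using rel_interior_subset by blast
  then have zC: "z \<in> ?C" using SC by blast
  have shift: "z + s *\<^sub>R v \<in> ?C" if "s \<ge> 0" "v \<in> {(1,0), (0,1)}" for s v
    using newton_diagram_shift[OF zC, of s 0] newton_diagram_shift[OF zC, of 0 s] that by auto
  have "S \<noteq> ?C"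
  proof
    assume "S = ?C"
    then have "\<forall>s\<ge>0. z + s *\<^sub>R (1, 0) \<in> S" using shift[of _ "(1,0)"] by blast
    then show False using ray[of "(1,0)" z] by blast
  qed
  then have "z \<notin> rel_interior ?C"
    using face_of_disjoint_rel_interior[OF S(1)] zS by blast
  then obtain w where w: "w \<noteq> 0" "\<And>y. y \<in> ?C \<Longrightarrow> w \<bullet> z \<le> w \<bullet> y"
    using supporting_hyperplane_rel_boundary[OF convC zC] by metis
  define F where "F = ?C \<inter> {x. w \<bullet> x = w \<bullet> z}"
  have Fface: "F face_of ?C" unfolding F_def
    using convC w(2) by (rule face_of_Int_supporting_hyperplane_ge)
  have "S \<subseteq> F" using subset_of_face_of[OF Fface SC] z zC by (auto simp: F_def)
  \<comment> \<open>If \<open>S\<close> were a proper face of \<open>F\<close>, then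
    \<open>F\<close> would have dimension at least 2, but it lies on a line.\<close>
  have SF: "S = F"
  proof (rule ccontr)
    assume "S \<noteq> F"
    have "S face_of F" using S(1) \<open>S \<subseteq> F\<close> face_of_imp_subset[OF Fface] by (rule face_of_subset)
    then have "aff_dim S < aff_dim F"
      using face_of_aff_dim_lt face_of_imp_convex[OF Fface] \<open>S \<noteq> F\<close> by blast
    also have "aff_dim F \<le> aff_dim {x. w \<bullet> x = w \<bullet> z}"
      by (rule aff_dim_subset) (auto simp: F_def)
    also have "\<dots> = 1" using w(1) by (simp add: aff_dim_hyperplane)
    finally show False using S(2) by simp
  qed
  obtain \<mu> \<nu> where w_eq: "w = (\<mu>, \<nu>)" by (cases w)
  \<comment> \<open>A vanishing weight would put a coordinate half-line starting at \<open>z\<close>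
    into the compact edge.\<close>
  have pos: "w \<bullet> v > 0" if v: "v \<in> {(1,0), (0,1)}" for v
  proof (rule ccontr)
    assume "\<not> w \<bullet> v > 0"
    moreover have "w \<bullet> v \<ge> 0" using w(2)[OF shift[of 1, OF _ v]] by (simp add: inner_right_distrib)
    ultimately have "w \<bullet> v = 0" by simp
    then have "z + s *\<^sub>R v \<in> S" if "s \<ge> 0" for s
      unfolding SF F_def using shift[OF that v] by (simp add: inner_right_distrib)
    then show False using ray[OF v] by blast
  qed
  have \<mu>: "\<mu> > 0" using pos[of "(1,0)"] by (simp add: w_eq)
  have \<nu>: "\<nu> > 0" using pos[of "(0,1)"] by (simp add: w_eq)
  define m where "m = w \<bullet> z"
  have ge: "weight_ge \<mu> \<nu> m (fps_of_cps2 g)"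
    unfolding weight_ge_def
  proof (intro allI impI)
    fix i j assume "fps_of_cps2 g $ j $ i \<noteq> 0"
    then have "(real i, real j) \<in> ?C" by (intro support_in_newton_diagram) (simp add: coeff2_def)
    then show "m \<le> \<mu> * real i + \<nu> * real j" using w(2) by (auto simp: m_def w_eq)
  qed
  have edge: "edge_part g S = weight_part \<mu> \<nu> m (fps_of_cps2 g)"
  proof (rule fps_ext, rule fps_ext)
    fix j i
    have "(real i, real j) \<in> S \<longleftrightarrow> \<mu> * real i + \<nu> * real j = m" if "coeff2 g i j \<noteq> 0"
      unfolding SF F_def m_def using support_in_newton_diagram[OF that] by (simp add: w_eq)
    then show "edge_part g S $ j $ i = weight_part \<mu> \<nu> m (fps_of_cps2 g) $ j $ i"
      by (auto simp: edge_part_def coeff2_def)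
  qed
  have "weight_part \<mu> \<nu> m (fps_of_cps2 g) \<noteq> 0"
  proof
    assume *: "weight_part \<mu> \<nu> m (fps_of_cps2 g) = 0"
    have gt: "m < \<mu> * real i + \<nu> * real j" if "coeff2 g i j \<noteq> 0" for i j
    proof -
      have "weight_part \<mu> \<nu> m (fps_of_cps2 g) $ j $ i = 0" using * by simp
      then have "\<mu> * real i + \<nu> * real j \<noteq> m" using that by (auto simp: coeff2_def)
      moreover have "m \<le> \<mu> * real i + \<nu> * real j" using ge that by (auto simp: weight_ge_def coeff2_def)
      ultimately show ?thesis by linarith
    qed
    have "newton_points g \<subseteq> {x. w \<bullet> x > m}"
    proof
      fix x assume "x \<in> newton_points g"
      then obtain i j s t where *: "x = (real i + s, real j + t)" "coeff2 g i j \<noteq> 0" "s \<ge> 0" "t \<ge> 0"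
        by (auto simp: newton_points_def)
      then have "m < \<mu> * real i + \<nu> * real j" using gt by auto
      moreover have "\<mu> * s \<ge> 0" "\<nu> * t \<ge> 0" using \<mu> \<nu> * by simp_all
      ultimately show "x \<in> {x. w \<bullet> x > m}" using * by (simp add: algebra_simps w_eq)
    qed
    then have "?C \<subseteq> {x. w \<bullet> x > m}"
      unfolding newton_diagram_eq by (rule hull_minimal) (rule convex_halfspace_gt)
    then show False using zC by (auto simp: m_def)
  qed
  with \<mu> \<nu> ge edge show ?thesis by (rule that)
qed

text \<open>The open half-space together with the hull of the slice is already convex and contains
  \<open>A\<close>. In this way a face of the unbounded diagram becomes the hull of the minimal
  points.\<close>

lemma convex_hull_min_slice:
  fixes A :: "'a::euclidean_space set"
  assumes "\<And>x. x \<in> A \<Longrightarrow> m \<le> w \<bullet> x"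
  shows "convex hull A \<inter> {x. w \<bullet> x = m} = convex hull (A \<inter> {x. w \<bullet> x = m})"
proof
  let ?H = "convex hull (A \<inter> {x. w \<bullet> x = m})"
  let ?K = "{x. w \<bullet> x > m} \<union> ?H"
  have sub: "?H \<subseteq> {x. w \<bullet> x = m}"
    by (rule hull_minimal) (auto intro: convex_hyperplane)
  have "convex ?K"
  proof (rule convexI)
    fix x y and u v :: real assume xy: "x \<in> ?K" "y \<in> ?K" and uv: "0 \<le> u" "0 \<le> v" "u + v = 1"
    have ge: "m \<le> w \<bullet> x" "m \<le> w \<bullet> y" using xy sub by auto
    show "u *\<^sub>R x + v *\<^sub>R y \<in> ?K"
    proof (cases "u = 0 \<or> v = 0")
      case True then show ?thesis using xy uv by auto
    next
      case False
      then have uv0: "u > 0" "v > 0" using uv by auto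
      show ?thesis
      proof (cases "x \<in> ?H \<and> y \<in> ?H")
        case True
        then show ?thesis using convexD[OF convex_convex_hull] uv by blast
      next
        case False
        then have "w \<bullet> x > m \<or> w \<bullet> y > m" using xy by auto
        moreover have "w \<bullet> (u *\<^sub>R x + v *\<^sub>R y) - m = u * (w \<bullet> x - m) + v * (w \<bullet> y - m)"
        proof -
          have "u * m + v * m = m" using uv(3) by (simp flip: distrib_right)
          then show ?thesis by (simp add: inner_right_distrib right_diff_distrib)
        qed
        moreover have "u * (w \<bullet> x - m) \<ge> 0" "v * (w \<bullet> y - m) \<ge> 0" using ge uv by auto
        moreover have "w \<bullet> x > m \<Longrightarrow> u * (w \<bullet> x - m) > 0" "w \<bullet> y > m \<Longrightarrow> v * (w \<bullet> y - m) > 0" using uv0 by auto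
        ultimately have "w \<bullet> (u *\<^sub>R x + v *\<^sub>R y) > m" by linarith
        then show ?thesis by blast
      qed
    qed
  qed
  moreover have "A \<subseteq> ?K"
  proof
    fix x assume "x \<in> A"
    then show "x \<in> ?K" using assms[of x] by (cases "w \<bullet> x = m") (auto intro: hull_inc)
  qed
  ultimately have "convex hull A \<subseteq> ?K" by (rule hull_minimal[rotated])
  then show "convex hull A \<inter> {x. w \<bullet> x = m} \<subseteq> ?H" by auto
  show "?H \<subseteq> convex hull A \<inter> {x. w \<bullet> x = m}"
    using sub hull_mono[of "A \<inter> {x. w \<bullet> x = m}" A convex] by auto
qed

text \<open>Positive weights leave only finitely many support points on the minimal line, so the
  slice is compact; two distinct points make it one-dimensional.\<close>

lemma weight_part_compact_edge:
  assumes pos: "\<mu> > 0" "\<nu> > 0" and ge: "weight_ge \<mu> \<nu> m (fps_of_cps2 g)"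
    and two: "weight_part \<mu> \<nu> m (fps_of_cps2 g) $ j $ i \<noteq> 0"
      "weight_part \<mu> \<nu> m (fps_of_cps2 g) $ j' $ i' \<noteq> 0" "(i, j) \<noteq> (i', j')"
  obtains S where "compact_edge S g" "edge_part g S = weight_part \<mu> \<nu> m (fps_of_cps2 g)"
proof -
  let ?C = "newton_diagram g"
  define w where "w = (\<mu>, \<nu>)"
  define S where "S = ?C \<inter> {x. w \<bullet> x = m}"
  define M where "M = {(real i, real j) | i j. coeff2 g i j \<noteq> 0 \<and> \<mu> * real i + \<nu> * real j = m}"
  have convC: "convex ?C" unfolding newton_diagram_eq by (rule convex_convex_hull)
  have geC: "m \<le> w \<bullet> x" if "x \<in> ?C" for x
    unfolding w_def by (rule newton_diagram_weight_ge[OF pos ge that])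
  have face: "S face_of ?C" unfolding S_def using convC geC by (rule face_of_Int_supporting_hyperplane_ge)
  have "newton_points g \<inter> {x. w \<bullet> x = m} = M"
  proof
    show "M \<subseteq> newton_points g \<inter> {x. w \<bullet> x = m}"
      by (auto simp: M_def newton_points_def w_def) (metis add.right_neutral order_refl)
    show "newton_points g \<inter> {x. w \<bullet> x = m} \<subseteq> M"
    proof
      fix x assume x: "x \<in> newton_points g \<inter> {x. w \<bullet> x = m}"
      then obtain i j s t where *: "x = (real i + s, real j + t)" "coeff2 g i j \<noteq> 0" "s \<ge> 0" "t \<ge> 0"
        by (auto simp: newton_points_def)
      then have "m \<le> \<mu> * real i + \<nu> * real j" using ge by (auto simp: weight_ge_def coeff2_def)
      moreover have "\<mu> * s \<ge> 0" "\<nu> * t \<ge> 0" using pos * by simp_all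
      moreover have "\<mu> * real i + \<nu> * real j + \<mu> * s + \<nu> * t = m"
        using x * by (simp add: w_def algebra_simps)
      ultimately have "\<mu> * s = 0" "\<nu> * t = 0" "\<mu> * real i + \<nu> * real j = m" by linarith+
      then show "x \<in> M" using * pos by (auto simp: M_def)
    qed
  qed
  then have SM: "S = convex hull M"
    unfolding S_def newton_diagram_eq
    using convex_hull_min_slice[of "newton_points g" m w] geC hull_inc newton_diagram_eq by metis
  have "finite M"
  proof (rule finite_subset)
    show "M \<subseteq> (\<lambda>(i, j). (real i, real j)) ` ({..nat \<lceil>m / \<mu>\<rceil>} \<times> {..nat \<lceil>m / \<nu>\<rceil>})"
    proof
      fix x assume "x \<in> M"
      then obtain i j where x: "x = (real i, real j)" "\<mu> * real i + \<nu> * real j = m" by (auto simp: M_def)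
      have "\<mu> * real i \<le> m" "\<nu> * real j \<le> m" using x(2) pos by (smt (verit) mult_nonneg_nonneg of_nat_0_le_iff)+
      then have "real i \<le> m / \<mu>" "real j \<le> m / \<nu>" using pos by (simp_all add: field_simps)
      then have "i \<le> nat \<lceil>m / \<mu>\<rceil>" "j \<le> nat \<lceil>m / \<nu>\<rceil>" by linarith+
      then show "x \<in> (\<lambda>(i, j). (real i, real j)) ` ({..nat \<lceil>m / \<mu>\<rceil>} \<times> {..nat \<lceil>m / \<nu>\<rceil>})" using x by auto
    qed
  qed simp
  then have comp: "compact S" unfolding SM by (rule finite_imp_compact_convex_hull)
  have pts: "(real i, real j) \<in> M" "(real i', real j') \<in> M"
    using two by (auto simp: M_def coeff2_def split: if_splits)
  have "aff_dim {(real i, real j), (real i', real j')} \<le> aff_dim S"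
    unfolding SM using pts by (intro aff_dim_subset) (auto intro: hull_inc)
  moreover have "aff_dim {(real i, real j), (real i', real j')} = 1"
    using two(3) by (simp add: aff_dim_2)
  moreover have "aff_dim S \<le> aff_dim {x. w \<bullet> x = m}" by (rule aff_dim_subset) (auto simp: S_def)
  moreover have "aff_dim {x. w \<bullet> x = m} = 1"
    using pos by (simp add: aff_dim_hyperplane w_def zero_prod_def)
  ultimately have "aff_dim S = 1" by linarith
  then have "compact_edge S g" using face comp by (simp add: compact_edge_def edge_of_def)
  moreover have "edge_part g S = weight_part \<mu> \<nu> m (fps_of_cps2 g)"
  proof (rule fps_ext, rule fps_ext)
    fix j i
    have "(real i, real j) \<in> S \<longleftrightarrow> \<mu> * real i + \<nu> * real j = m" if "coeff2 g i j \<noteq> 0"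
      unfolding S_def using support_in_newton_diagram[OF that] by (simp add: w_def)
    then show "edge_part g S $ j $ i = weight_part \<mu> \<nu> m (fps_of_cps2 g) $ j $ i"
      by (auto simp: edge_part_def coeff2_def)
  qed
  ultimately show ?thesis by (rule that)
qed

section \<open>Non-degeneracy of products of linear factors\<close>

lemma leading_term_subdegree: "leading_term \<phi> (subdegree \<phi>) (\<phi> $ subdegree \<phi>)"
  unfolding leading_term_def using nth_less_subdegree_zero by blast

lemma ramify_u_monom: "N > 0 \<Longrightarrow> ramify N (fps_const (u_monom c e)) = fps_const (u_monom c (N * e))"
  by (intro fps_ext) (auto simp: ramify_nth fps_X_power_nth)

lemma ramify_X: "ramify N fps_X = fps_X"
  by (simp add: ramify_eq_comp_coeffs)

lemma ramify_power: "N > 0 \<Longrightarrow> ramify N (F ^ k) = ramify N F ^ k"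
  by (simp add: ramify_eq_comp_coeffs comp_coeffs_power X_power_nth_0)

lemma ramify_prod: "N > 0 \<Longrightarrow> ramify N (\<Prod>i\<in>A. F i) = (\<Prod>i\<in>A. ramify N (F i))"
  by (simp add: ramify_eq_comp_coeffs comp_coeffs_prod X_power_nth_0)

lemma ramify_diff: "ramify N (F - G) = ramify N F - ramify N G"
  by (simp add: ramify_eq_comp_coeffs comp_coeffs_diff)

lemma linear_factor_weight_ex:
  assumes "\<mu> > 0" "\<nu> > 0"
  obtains m where "weight_ge \<mu> \<nu> m (fps_X - fps_const \<phi>)"
    "weight_part \<mu> \<nu> m (fps_X - fps_const \<phi>) \<noteq> 0"
proof (cases "\<phi> = 0")
  case True
  then show ?thesis using that[of \<nu>] weight_linear_factor_v[OF assms, of \<phi>] by simp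
next
  case False
  define e where "e = subdegree \<phi>"
  define c where "c = \<phi> $ e"
  have c: "c \<noteq> 0" using False by (simp add: c_def e_def)
  have lt: "leading_term \<phi> e c" unfolding c_def e_def by (rule leading_term_subdegree)
  consider "\<nu> < \<mu> * real e" | "\<nu> = \<mu> * real e" | "\<mu> * real e < \<nu>" by linarith
  then show ?thesis
  proof cases
    case 1
    have "\<nu> < \<mu> * real k" if "\<phi> $ k \<noteq> 0" for k
    proof -
      have "e \<le> k" using that by (simp add: e_def subdegree_leI)
      then have "\<mu> * real e \<le> \<mu> * real k" using assms by simp
      then show ?thesis using 1 by linarith
    qed
    then show ?thesis using that[of \<nu>] weight_linear_factor_v[OF assms, of \<phi>] by simp
  next
    case 2
    then show ?thesis
      using that[of \<nu>] weight_linear_factor_eq[OF assms lt] linear_factor_nonzero by metis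
  next
    case 3
    have "- fps_const (u_monom c e) \<noteq> (0 :: complex fps fps)" using c by simp
    then show ?thesis using that[of "\<mu> * real e"] weight_linear_factor_u[OF assms lt 3] by metis
  qed
qed

text \<open>A derivative test: as the \<open>a i\<close> differ, v = c t^e annihilates exactly one
  binomial, whose v-derivative q A^(q-1) is nonzero there with A = c t^e. A squared factor would
  make the derivative of the whole form vanish at A.\<close>

lemma simple_edge_no_double_root:
  fixes r :: nat
  assumes N: "N > 0" and e: "e > 0" and c: "c \<noteq> 0"
    and dbl: "ramify N X = (fps_X - fps_const (u_monom c e)) ^ 2 * Z"
    and X: "X = fps_const (u_monom b k) * fps_X ^ l * (\<Prod>i<r. fps_X ^ q - fps_const (u_monom (a i) p))"
    and b: "b \<noteq> 0" and q: "q > 0" and inj: "inj_on a {..<r}"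
  shows False
proof -
  define A where "A = u_monom c e"
  have A0: "A $ 0 = 0" "A \<noteq> 0" using e c by (simp_all add: A_def u_monom_nth)
  define fac where "fac = (\<lambda>i. fps_X ^ q - fps_const (u_monom (a i) (N * p)) :: complex fps fps)"
  define M where "M = fps_const (u_monom b (N * k)) * (fps_X ^ l :: complex fps fps)"
  have H: "ramify N X = M * (\<Prod>i<r. fac i)"
    unfolding X M_def fac_def using N
    by (simp only: ramify_mult ramify_power ramify_prod ramify_diff ramify_X ramify_u_monom)
  have evM: "eval_y M A \<noteq> 0" using A0 b by (simp add: M_def eval_y_mult eval_y_power)
  have evfac: "eval_y (fac i) A = A ^ q - u_monom (a i) (N * p)" for i
    using A0 by (simp add: fac_def eval_y_diff eval_y_power)
  have lin: "eval_y (fps_X - fps_const A) A = 0" using A0 by (simp add: eval_y_diff)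
  have "eval_y (ramify N X) A = 0"
    unfolding dbl using A0 lin by (simp add: A_def[symmetric] eval_y_mult power2_eq_square)
  then have "(\<Prod>i<r. eval_y (fac i) A) = 0" using evM A0 by (simp add: H eval_y_mult eval_y_prod)
  then obtain i0 where i0: "i0 < r" "eval_y (fac i0) A = 0" by auto
  define Y where "Y = M * (\<Prod>i\<in>{..<r} - {i0}. fac i)"
  have HY: "ramify N X = fac i0 * Y"
    unfolding H Y_def using i0(1) by (simp add: prod.remove[of "{..<r}" i0] mult_ac)
  have "eval_y (fac i) A \<noteq> 0" if "i \<in> {..<r} - {i0}" for i
  proof
    assume "eval_y (fac i) A = 0"
    then have "u_monom (a i) (N * p) = u_monom (a i0) (N * p)" using i0(2) by (simp add: evfac)
    then have "u_monom (a i) (N * p) $ (N * p) = u_monom (a i0) (N * p) $ (N * p)" by simp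
    then show False using inj that i0(1) unfolding u_monom_nth by (auto dest: inj_onD)
  qed
  then have evY: "eval_y Y A \<noteq> 0" using evM A0 by (auto simp: Y_def eval_y_mult eval_y_prod)
  have "fps_deriv (fac i0) = fps_const (of_nat q) * fps_X ^ (q - 1)"
    by (simp add: fac_def fps_deriv_power)
  then have "eval_y (fps_deriv (fac i0)) A = of_nat q * A ^ (q - 1)"
    using A0 by (simp add: eval_y_mult eval_y_power)
  then have "eval_y (fps_deriv (fac i0)) A \<noteq> 0" using A0 q by simp
  then have "eval_y (fps_deriv (fac i0 * Y)) A \<noteq> 0"
    using evY i0(2) A0 by (simp add: eval_y_add eval_y_mult)
  moreover have "eval_y (fps_deriv ((fps_X - fps_const A) ^ 2 * Z)) A = 0"
  proof -
    have "fps_deriv (L ^ 2 * Z) = L * (2 * fps_deriv L * Z + L * fps_deriv Z)" for L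
      by (simp add: power2_eq_square algebra_simps)
    then show ?thesis using lin A0 by (simp only: eval_y_mult mult_zero_left)
  qed
  moreover have "fac i0 * Y = (fps_X - fps_const A) ^ 2 * Z" using dbl HY by (simp add: A_def)
  ultimately show False by metis
qed

lemma degenerate_if_equal_leading_terms:
  fixes q :: nat
  assumes N: "N > 0" and w: "w dvd 1"
    and D: "ramify N (fps_of_cps2 D) = ramify N (fps_of_cps2 w) * (\<Prod>j<q. fps_X - fps_const (\<phi> j))"
    and j: "j1 < q" "j2 < q" "j1 \<noteq> j2"
    and lt: "leading_term (\<phi> j1) e c" "leading_term (\<phi> j2) e c" and c: "c \<noteq> 0" and e: "e > 0"
  shows "\<not> nondegenerate D"
proof
  assume nd: "nondegenerate D"
  \<comment> \<open>These weights tie v with t^e, so the two factors with leading term c t^e both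
    have initial form v - c t^e.\<close>
  define \<mu> :: real where "\<mu> = 1"
  define \<nu> where "\<nu> = real e"
  have pos: "\<mu> > 0" "\<nu> > 0" using e by (simp_all add: \<mu>_def \<nu>_def)
  have w0: "ramify N (fps_of_cps2 w) $ 0 $ 0 \<noteq> 0"
    using unit_nth_00[OF w] N by (simp add: ramify_nth_00)
  have "\<exists>m. weight_ge \<mu> \<nu> m (fps_X - fps_const (\<phi> j)) \<and>
      weight_part \<mu> \<nu> m (fps_X - fps_const (\<phi> j)) \<noteq> 0" for j
    using linear_factor_weight_ex[OF pos] by metis
  then obtain ms where ms: "\<And>j. weight_ge \<mu> \<nu> (ms j) (fps_X - fps_const (\<phi> j))"
      "\<And>j. weight_part \<mu> \<nu> (ms j) (fps_X - fps_const (\<phi> j)) \<noteq> 0" by metis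
  define M where "M = (\<Sum>j<q. ms j)"
  let ?P = "\<lambda>j. weight_part \<mu> \<nu> (ms j) (fps_X - fps_const (\<phi> j))"
  define X where "X = weight_part (real N * \<mu>) \<nu> M (fps_of_cps2 D)"
  have prod: "weight_ge \<mu> \<nu> M (\<Prod>j<q. fps_X - fps_const (\<phi> j))"
      "weight_part \<mu> \<nu> M (\<Prod>j<q. fps_X - fps_const (\<phi> j)) = (\<Prod>j<q. ?P j)"
    unfolding M_def using weight_prod[OF pos, of "{..<q}" ms "\<lambda>j. fps_X - fps_const (\<phi> j)"] ms(1) by auto
  have "weight_ge \<mu> \<nu> (0 + M) (ramify N (fps_of_cps2 D))"
    unfolding D using weight_ge_mult[OF weight_const(1)[OF pos] prod(1)] .
  then have ge: "weight_ge (real N * \<mu>) \<nu> M (fps_of_cps2 D)" using N by (simp add: weight_ge_ramify)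
  define W0 where "W0 = fps_const (fps_const (ramify N (fps_of_cps2 w) $ 0 $ 0))"
  have W0: "W0 \<noteq> 0" using w0 by (simp add: W0_def)
  have "weight_part \<mu> \<nu> (0 + M) (ramify N (fps_of_cps2 D)) = W0 * (\<Prod>j<q. ?P j)"
    unfolding D weight_part_mult[OF weight_const(1)[OF pos] prod(1)] weight_const(2)[OF pos] prod(2) W0_def ..
  then have RX: "ramify N X = W0 * (\<Prod>j<q. ?P j)" using N by (simp add: weight_part_ramify X_def)
  have P12: "?P j' = fps_X - fps_const (u_monom c e)" if "leading_term (\<phi> j') e c" for j'
  proof -
    note eq = weight_linear_factor_eq[OF pos that]
    have "\<nu> = \<mu> * real e" by (simp add: \<mu>_def \<nu>_def)
    moreover have "ms j' = \<nu>"
      using weight_min_unique[OF ms(1,2) eq(1)] eq(2) calculation linear_factor_nonzero by metis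
    ultimately show ?thesis using eq(2) by simp
  qed
  have "(\<Prod>j<q. ?P j) = ?P j1 * (?P j2 * (\<Prod>j\<in>{..<q} - {j1} - {j2}. ?P j))"
    using j by (simp add: prod.remove[of "{..<q}" j1] prod.remove[of "{..<q} - {j1}" j2])
  then have dbl: "ramify N X = (fps_X - fps_const (u_monom c e)) ^ 2 * (W0 * (\<Prod>j\<in>{..<q} - {j1} - {j2}. ?P j))"
    unfolding RX P12[OF lt(1)] P12[OF lt(2)] by (simp add: power2_eq_square mult_ac)
  have "ramify N X \<noteq> 0" unfolding RX using W0 ms(2) by simp
  then obtain j i where ij: "X $ j $ i \<noteq> 0"
    by (metis N fps_ext fps_zero_nth ramify_nth dvd_0_right)
  \<comment> \<open>A single monomial would mean a vertex instead of an edge; the derivative test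
    with no binomial factors (\<open>r = 0\<close>) excludes it.\<close>
  have "\<exists>i' j'. X $ j' $ i' \<noteq> 0 \<and> (i, j) \<noteq> (i', j')"
  proof (rule ccontr)
    assume "\<nexists>i' j'. X $ j' $ i' \<noteq> 0 \<and> (i, j) \<noteq> (i', j')"
    then have "X $ j' $ i' = 0" if "(i', j') \<noteq> (i, j)" for i' j' using that by auto
    then have "X = fps_const (u_monom (X $ j $ i) i) * fps_X ^ j"
      by (intro fps_ext) (auto simp: fps_X_power_mult_right_nth fps_X_power_nth u_monom_nth)
    then show False
      using simple_edge_no_double_root[OF N e c dbl, where b = "X $ j $ i" and k = i and l = j and r = 0 and q = 1] ij by simp
  qed
  then obtain i' j' where ij': "X $ j' $ i' \<noteq> 0" "(i, j) \<noteq> (i', j')" by blast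
  have posN: "real N * \<mu> > 0" using N pos by simp
  obtain S where S: "compact_edge S D" "edge_part D S = X"
    unfolding X_def by (rule weight_part_compact_edge[OF posN pos(2) ge])
      (use ij ij' in \<open>auto simp: X_def\<close>)
  obtain b k l p qq r a s where fac: "edge_factorization D S b k l p qq r a s" and s: "\<forall>i<r. s i = 1"
    using nd S(1) unfolding nondegenerate_def by blast
  have "(\<Prod>i<r. (fps_X ^ qq - fps_const (u_monom (a i) p)) ^ s i) =
      (\<Prod>i<r. fps_X ^ qq - fps_const (u_monom (a i) p))"
    using s by (intro prod.cong) auto
  then have "X = fps_const (u_monom b k) * fps_X ^ l * (\<Prod>i<r. fps_X ^ qq - fps_const (u_monom (a i) p))"
    using fac S(2) by (simp add: edge_factorization_def)
  then show False
    by (rule simple_edge_no_double_root[OF N e c dbl]) (use fac in \<open>auto simp: edge_factorization_def\<close>)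
qed

text \<open>The unit contributes only the constant \<open>b\<close>. The value \<open>m\<close>
  stays free so that slopes can be compared once the weights of the edge are known.\<close>

lemma compact_edge_initial_form:
  assumes N: "N > 0" and w: "w dvd 1"
    and D: "ramify N (fps_of_cps2 D) = ramify N (fps_of_cps2 w) * F" and S: "compact_edge S D"
  obtains \<mu> \<nu> b where "\<mu> > 0" "\<nu> > 0" "b \<noteq> 0"
    "\<And>m. weight_ge \<mu> \<nu> m F \<Longrightarrow> weight_part \<mu> \<nu> m F \<noteq> 0 \<Longrightarrow>
       ramify N (edge_part D S) = fps_const (fps_const b) * weight_part \<mu> \<nu> m F"
proof -
  obtain \<mu>' \<nu> m' where *: "\<mu>' > 0" "\<nu> > 0" "weight_ge \<mu>' \<nu> m' (fps_of_cps2 D)"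
    "edge_part D S = weight_part \<mu>' \<nu> m' (fps_of_cps2 D)" "weight_part \<mu>' \<nu> m' (fps_of_cps2 D) \<noteq> 0"
    using compact_edge_weight_part[OF S] by blast
  define \<mu> where "\<mu> = \<mu>' / real N"
  have \<mu>: "\<mu> > 0" "real N * \<mu> = \<mu>'" using * N by (simp_all add: \<mu>_def)
  define b where "b = ramify N (fps_of_cps2 w) $ 0 $ 0"
  have b: "b \<noteq> 0" using unit_nth_00[OF w] N by (simp add: ramify_nth_00 b_def)
  have R0: "ramify N 0 = 0" by (intro fps_ext) (simp add: ramify_nth N)
  have ge: "weight_ge \<mu> \<nu> m' (ramify N (fps_of_cps2 D))"
    and eq: "ramify N (edge_part D S) = weight_part \<mu> \<nu> m' (ramify N (fps_of_cps2 D))"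
    using * N \<mu> by (simp_all add: weight_ge_ramify weight_part_ramify)
  have nz: "weight_part \<mu> \<nu> m' (ramify N (fps_of_cps2 D)) \<noteq> 0"
    using *(4,5) eq N R0 ramify_inject by metis
  have "ramify N (edge_part D S) = fps_const (fps_const b) * weight_part \<mu> \<nu> m F"
    if m: "weight_ge \<mu> \<nu> m F" "weight_part \<mu> \<nu> m F \<noteq> 0" for m
  proof -
    have 1: "weight_ge \<mu> \<nu> (0 + m) (ramify N (fps_of_cps2 D))"
      unfolding D by (rule weight_ge_mult[OF weight_const(1)[OF \<mu>(1) *(2)] m(1)])
    have 2: "weight_part \<mu> \<nu> (0 + m) (ramify N (fps_of_cps2 D)) = fps_const (fps_const b) * weight_part \<mu> \<nu> m F"
      unfolding D weight_part_mult[OF weight_const(1)[OF \<mu>(1) *(2)] m(1)] weight_const(2)[OF \<mu>(1) *(2)] b_def ..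
    have "m' = 0 + m"
      using weight_min_unique[OF ge nz 1] 2 m(2) b by simp
    then show ?thesis using 2 eq by simp
  qed
  with \<mu>(1) *(2) b show ?thesis by (rule that)
qed

section \<open>Non-degeneracy for one or three linear factors\<close>

definition simple_edge :: "cps2 \<Rightarrow> (real \<times> real) set \<Rightarrow> bool" where
  "simple_edge g S \<longleftrightarrow> (\<exists>c k l p q r a s. edge_factorization g S c k l p q r a s \<and> (\<forall>i<r. s i = 1))"

text \<open>Monomials are settled by a factorization with r = 0, in place of an argument that an
  edge carries two terms. The t-exponent is a multiple of \<open>N\<close> because
  \<open>ramify\<close> creates no others.\<close>

lemma simple_edge_monomial:
  assumes N: "N > 0" and c: "c \<noteq> 0" and X: "ramify N (edge_part g S) = fps_const (u_monom c e) * fps_X ^ l"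
  shows "simple_edge g S"
proof -
  have "ramify N (edge_part g S) $ l $ e = c"
    unfolding X by (simp add: fps_X_power_mult_right_nth u_monom_nth fps_X_power_nth)
  then have "N dvd e" using c N by (auto simp: ramify_nth split: if_splits)
  then obtain k where k: "e = N * k" ..
  have "ramify N (edge_part g S) = ramify N (fps_const (u_monom c k) * fps_X ^ l)"
    unfolding X k using N by (simp only: ramify_mult ramify_power ramify_X ramify_u_monom)
  then have "edge_part g S = fps_const (u_monom c k) * fps_X ^ l" using N by (simp only: ramify_inject)
  then have "edge_factorization g S c k l 1 1 0 (\<lambda>_. 0) (\<lambda>_. 1)"
    using c by (simp add: edge_factorization_def)
  then show ?thesis unfolding simple_edge_def by blast
qed

text \<open>Both t-exponents are multiples of \<open>N\<close>, so the binomial descends to u. If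
  its exponents are not coprime, then s = 2 and a square root of b splits v^2 - b u^(2p') into two
  distinct linear factors.\<close>

lemma simple_edge_binomial:
  assumes N: "N > 0" and c: "c \<noteq> 0" and b: "b \<noteq> 0" and e': "e' > 0" and s: "s = 1 \<or> s = 2"
    and X: "ramify N (edge_part g S) = fps_const (u_monom c e) * fps_X ^ l * (fps_X ^ s - fps_const (u_monom b e'))"
  shows "simple_edge g S"
proof -
  have nth: "ramify N (edge_part g S) $ (l + j) = u_monom c e * (if j = s then 1 else if j = 0 then - u_monom b e' else 0)" for j
    unfolding X using s
    by (auto simp: mult.commute[of _ "fps_X ^ l"] mult.assoc fps_X_power_mult_nth fps_X_power_nth)
  have "ramify N (edge_part g S) $ (l + s) $ e = c"
    unfolding nth by (simp add: fps_X_power_nth)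
  then have "N dvd e" using c N by (auto simp: ramify_nth split: if_splits)
  then obtain k where k: "e = N * k" ..
  have "ramify N (edge_part g S) $ (l + 0) = - (fps_const (c * b) * fps_X ^ (e + e'))"
    unfolding nth using s by (auto simp: power_add mult_ac simp flip: fps_const_mult)
  then have "ramify N (edge_part g S) $ (l + 0) $ (e + e') = - (c * b)" by (simp add: fps_X_power_nth)
  then have "N dvd e + e'" using c b N by (auto simp: ramify_nth split: if_splits)
  then have "N dvd e'" using \<open>N dvd e\<close> by (simp add: dvd_add_right_iff)
  then obtain p where p: "e' = N * p" ..
  have p0: "p > 0" using p e' by (cases p) auto
  have "ramify N (edge_part g S) = ramify N (fps_const (u_monom c k) * fps_X ^ l * (fps_X ^ s - fps_const (u_monom b p)))"
    unfolding X k p using N by (simp only: ramify_mult ramify_power ramify_diff ramify_X ramify_u_monom)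
  then have E: "edge_part g S = fps_const (u_monom c k) * fps_X ^ l * (fps_X ^ s - fps_const (u_monom b p))"
    using N by (simp only: ramify_inject)
  show ?thesis
  proof (cases "coprime p s")
    case True
    have "edge_factorization g S c k l p s 1 (\<lambda>_. b) (\<lambda>_. 1)"
      using c b p0 s E True by (auto simp: edge_factorization_def inj_on_def)
    then show ?thesis unfolding simple_edge_def by blast
  next
    case False
    then have "s = 2" "even p" using s by auto
    then obtain p' where p': "p = 2 * p'" by blast
    define \<beta> where "\<beta> = csqrt b"
    have \<beta>: "\<beta> \<noteq> 0" "b = \<beta> * \<beta>" using b by (simp_all add: \<beta>_def flip: power2_eq_square)
    have "fps_X ^ 2 - fps_const (u_monom b p) =
        (fps_X - fps_const (u_monom \<beta> p')) * (fps_X - fps_const (u_monom (- \<beta>) p') :: complex fps fps)"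
    proof -
      have "u_monom b p = u_monom \<beta> p' * u_monom \<beta> p'"
        unfolding \<beta>(2) p' by (simp add: power_mult power2_eq_square mult_ac power_mult_distrib flip: fps_const_mult)
      moreover have "u_monom (- \<beta>) p' = - u_monom \<beta> p'" by (simp flip: fps_const_neg)
      ultimately show ?thesis
        by (simp add: power2_eq_square algebra_simps flip: fps_const_mult fps_const_neg)
    qed
    then have "edge_part g S = fps_const (u_monom c k) * fps_X ^ l *
       (\<Prod>i<2. (fps_X ^ 1 - fps_const (u_monom (if i = (0::nat) then \<beta> else - \<beta>) p')) ^ 1)"
      unfolding E \<open>s = 2\<close> by (simp add: numeral_2_eq_2)
    moreover have "inj_on (\<lambda>i. if i = (0::nat) then \<beta> else - \<beta>) {..<2}"
      using \<beta> by (auto simp: inj_on_def less_2_cases_iff)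
    ultimately have "edge_factorization g S c k l p' 1 2 (\<lambda>i. if i = 0 then \<beta> else - \<beta>) (\<lambda>_. 1)"
      using c \<beta> p0 p' unfolding edge_factorization_def by simp
    then show ?thesis unfolding simple_edge_def by blast
  qed
qed

lemma nondegenerate_linear:
  assumes N: "N > 0" and w: "w dvd 1" and \<phi>: "\<phi> $ 0 = 0"
    and D: "ramify N (fps_of_cps2 D) = ramify N (fps_of_cps2 w) * (fps_X - fps_const \<phi>)"
  shows "nondegenerate D"
  unfolding nondegenerate_def simple_edge_def[symmetric]
proof (intro allI impI)
  fix S assume S: "compact_edge S D"
  obtain \<mu> \<nu> b where pos: "\<mu> > 0" "\<nu> > 0" and b: "b \<noteq> 0" and
    edge: "\<And>m. weight_ge \<mu> \<nu> m (fps_X - fps_const \<phi>) \<Longrightarrow> weight_part \<mu> \<nu> m (fps_X - fps_const \<phi>) \<noteq> 0 \<Longrightarrow>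
       ramify N (edge_part D S) = fps_const (fps_const b) * weight_part \<mu> \<nu> m (fps_X - fps_const \<phi>)"
    using compact_edge_initial_form[OF N w D S] by blast
  show "simple_edge D S"
  proof (cases "\<forall>k. \<phi> $ k \<noteq> 0 \<longrightarrow> \<nu> < \<mu> * real k")
    case True
    then have "ramify N (edge_part D S) = fps_const (u_monom b 0) * fps_X ^ 1"
      using edge[of \<nu>] weight_linear_factor_v[OF pos, of \<phi>] by simp
    then show ?thesis by (rule simple_edge_monomial[OF N b])
  next
    case False
    then have nz: "\<phi> \<noteq> 0" by auto
    define e where "e = subdegree \<phi>"
    define c where "c = \<phi> $ e"
    have c: "c \<noteq> 0" using nz by (simp add: c_def e_def)
    then have e: "e > 0" using \<phi> by (metis c_def gr0I)
    have lt: "leading_term \<phi> e c" unfolding c_def e_def by (rule leading_term_subdegree)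
    obtain k where "\<phi> $ k \<noteq> 0" "\<mu> * real k \<le> \<nu>" using False by auto
    moreover from this have "e \<le> k" by (simp add: e_def subdegree_leI)
    then have "\<mu> * real e \<le> \<mu> * real k" using pos by simp
    ultimately consider "\<nu> = \<mu> * real e" | "\<mu> * real e < \<nu>" by linarith
    then show ?thesis
    proof cases
      case 1
      have "ramify N (edge_part D S) = fps_const (u_monom b 0) * fps_X ^ 0 * (fps_X ^ 1 - fps_const (u_monom c e))"
        using edge[of \<nu>] weight_linear_factor_eq[OF pos lt 1] linear_factor_nonzero by simp
      then show ?thesis by (rule simple_edge_binomial[OF N b c e, rotated]) simp
    next
      case 2
      have "ramify N (edge_part D S) = fps_const (fps_const b) * - fps_const (u_monom c e)"
        using edge[of "\<mu> * real e"] weight_linear_factor_u[OF pos lt 2] c by simp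
      also have "\<dots> = fps_const (u_monom (- b * c) e) * fps_X ^ 0"
        by (simp add: mult.assoc flip: fps_const_mult fps_const_neg)
      finally show ?thesis by (rule simple_edge_monomial[OF N, rotated]) (use b c in simp)
    qed
  qed
qed

text \<open>Opposite leading coefficients cancel the middle term, which leaves the binomial v^2 -
  c^2 t^(2e) when \<open>\<nu>\<close> equals \<open>\<mu> * e\<close>.\<close>

lemma weight_quadratic:
  assumes pos: "\<mu> > 0" "\<nu> > 0" and lt: "leading_term \<phi> e c" "leading_term \<psi> e (- c)"
  shows "\<nu> < \<mu> * real e \<Longrightarrow> weight_ge \<mu> \<nu> (\<nu> + \<nu>) ((fps_X - fps_const \<phi>) * (fps_X - fps_const \<psi>)) \<and>
      weight_part \<mu> \<nu> (\<nu> + \<nu>) ((fps_X - fps_const \<phi>) * (fps_X - fps_const \<psi>)) = fps_X ^ 2"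
    and "\<nu> = \<mu> * real e \<Longrightarrow> weight_ge \<mu> \<nu> (\<nu> + \<nu>) ((fps_X - fps_const \<phi>) * (fps_X - fps_const \<psi>)) \<and>
      weight_part \<mu> \<nu> (\<nu> + \<nu>) ((fps_X - fps_const \<phi>) * (fps_X - fps_const \<psi>)) =
        fps_X ^ 2 - fps_const (u_monom (c * c) (e + e))"
    and "\<mu> * real e < \<nu> \<Longrightarrow> weight_ge \<mu> \<nu> (\<mu> * real e + \<mu> * real e) ((fps_X - fps_const \<phi>) * (fps_X - fps_const \<psi>)) \<and>
      weight_part \<mu> \<nu> (\<mu> * real e + \<mu> * real e) ((fps_X - fps_const \<phi>) * (fps_X - fps_const \<psi>)) =
        - fps_const (u_monom (c * c) (e + e))"
proof -
  have sq: "u_monom c e * u_monom c e = u_monom (c * c) (e + e)"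
    by (simp add: power_add mult_ac flip: fps_const_mult)
  have neg: "u_monom (- c) e = - u_monom c e" by (simp flip: fps_const_neg)
  {
    assume less: "\<nu> < \<mu> * real e"
    have *: "\<nu> < \<mu> * real k" if "leading_term h e c'" "h $ k \<noteq> 0" for h c' k
    proof -
      have "e \<le> k" using that by (meson leading_term_def not_le)
      then have "\<mu> * real e \<le> \<mu> * real k" using pos by simp
      then show ?thesis using less by linarith
    qed
    note 1 = weight_linear_factor_v[OF pos, of \<phi>, OF *[OF lt(1)]]
    note 2 = weight_linear_factor_v[OF pos, of \<psi>, OF *[OF lt(2)]]
    show "weight_ge \<mu> \<nu> (\<nu> + \<nu>) ((fps_X - fps_const \<phi>) * (fps_X - fps_const \<psi>)) \<and>
      weight_part \<mu> \<nu> (\<nu> + \<nu>) ((fps_X - fps_const \<phi>) * (fps_X - fps_const \<psi>)) = fps_X ^ 2"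
      using weight_ge_mult[OF 1(1) 2(1)] weight_part_mult[OF 1(1) 2(1)] 1(2) 2(2)
      by (simp add: power2_eq_square)
  next
    assume eq: "\<nu> = \<mu> * real e"
    note 1 = weight_linear_factor_eq[OF pos lt(1) eq]
    note 2 = weight_linear_factor_eq[OF pos lt(2) eq]
    have "(fps_X - fps_const (u_monom c e)) * (fps_X - fps_const (u_monom (- c) e)) =
        fps_X ^ 2 - fps_const (u_monom c e * u_monom c e)"
      unfolding neg by (simp add: power2_eq_square algebra_simps flip: fps_const_mult fps_const_neg)
    then show "weight_ge \<mu> \<nu> (\<nu> + \<nu>) ((fps_X - fps_const \<phi>) * (fps_X - fps_const \<psi>)) \<and>
      weight_part \<mu> \<nu> (\<nu> + \<nu>) ((fps_X - fps_const \<phi>) * (fps_X - fps_const \<psi>)) =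
        fps_X ^ 2 - fps_const (u_monom (c * c) (e + e))"
      using weight_ge_mult[OF 1(1) 2(1)] weight_part_mult[OF 1(1) 2(1)] unfolding 1(2) 2(2) sq by simp
  next
    assume gr: "\<mu> * real e < \<nu>"
    note 1 = weight_linear_factor_u[OF pos lt(1) gr]
    note 2 = weight_linear_factor_u[OF pos lt(2) gr]
    have "- fps_const (u_monom c e) * - fps_const (u_monom (- c) e) = - fps_const (u_monom c e * u_monom c e)"
      unfolding neg by (simp flip: fps_const_mult fps_const_neg)
    then show "weight_ge \<mu> \<nu> (\<mu> * real e + \<mu> * real e) ((fps_X - fps_const \<phi>) * (fps_X - fps_const \<psi>)) \<and>
      weight_part \<mu> \<nu> (\<mu> * real e + \<mu> * real e) ((fps_X - fps_const \<phi>) * (fps_X - fps_const \<psi>)) =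
        - fps_const (u_monom (c * c) (e + e))"
      using weight_ge_mult[OF 1(1) 2(1)] weight_part_mult[OF 1(1) 2(1)] unfolding 1(2) 2(2) sq by simp
  }
qed

lemma quadratic_factor_nth_2: "(fps_X ^ 2 - fps_const B) $ 2 = (1 :: 'a::idom)"
  by (simp add: fps_X_power_nth)

text \<open>Since \<open>e0 < e\<close>, the linear and the quadratic part become binomials at
  different slopes, so no edge mixes them. The two critical slopes give five ranges.\<close>

lemma nondegenerate_cubic:
  assumes N: "N > 0" and w: "w dvd 1"
    and lt: "leading_term \<phi>0 e0 c0" "leading_term \<phi>1 e c" "leading_term \<phi>2 e (- c)"
    and c: "c0 \<noteq> 0" "c \<noteq> 0" and e: "0 < e0" "e0 < e"
    and D: "ramify N (fps_of_cps2 D) = ramify N (fps_of_cps2 w) *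
      ((fps_X - fps_const \<phi>0) * ((fps_X - fps_const \<phi>1) * (fps_X - fps_const \<phi>2)))"
  shows "nondegenerate D"
  unfolding nondegenerate_def simple_edge_def[symmetric]
proof (intro allI impI)
  fix S assume S: "compact_edge S D"
  let ?L = "fps_X - fps_const \<phi>0" and ?Q = "(fps_X - fps_const \<phi>1) * (fps_X - fps_const \<phi>2)"
  obtain \<mu> \<nu> b where pos: "\<mu> > 0" "\<nu> > 0" and b: "b \<noteq> 0" and
    edge: "\<And>m. weight_ge \<mu> \<nu> m (?L * ?Q) \<Longrightarrow> weight_part \<mu> \<nu> m (?L * ?Q) \<noteq> 0 \<Longrightarrow>
       ramify N (edge_part D S) = fps_const (fps_const b) * weight_part \<mu> \<nu> m (?L * ?Q)"
    using compact_edge_initial_form[OF N w D S] by blast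
  have split: "ramify N (edge_part D S) = fps_const (fps_const b) * (weight_part \<mu> \<nu> m1 ?L * weight_part \<mu> \<nu> m2 ?Q)"
    if "weight_ge \<mu> \<nu> m1 ?L" "weight_ge \<mu> \<nu> m2 ?Q" "weight_part \<mu> \<nu> m1 ?L \<noteq> 0" "weight_part \<mu> \<nu> m2 ?Q \<noteq> 0" for m1 m2
    using edge[OF weight_ge_mult[OF that(1,2)]] that(3,4) by (simp add: weight_part_mult[OF that(1,2)])
  have less: "\<mu> * real e0 < \<mu> * real e" using pos e by simp
  have cc: "c * c \<noteq> 0" "e + e > 0" using c e by auto
  have neg: "fps_const (fps_const b) * (- fps_const (u_monom c0 e0) * Y) = fps_const (u_monom (- b * c0) e0) * Y" for Y
    by (simp add: mult.assoc flip: fps_const_mult fps_const_neg)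
  have bc: "- b * c0 \<noteq> 0" using b c by simp
  have q_nz: "fps_X ^ 2 - fps_const (u_monom (c * c) (e + e)) \<noteq> (0 :: complex fps fps)"
    using quadratic_factor_nth_2[of "u_monom (c * c) (e + e)"] by (metis fps_zero_nth zero_neq_one)
  note quad = weight_quadratic[OF pos lt(2,3)]
  consider "\<nu> < \<mu> * real e0" | "\<nu> = \<mu> * real e0" | "\<mu> * real e0 < \<nu>" "\<nu> < \<mu> * real e"
    | "\<nu> = \<mu> * real e" | "\<mu> * real e < \<nu>" by linarith
  then show "simple_edge D S"
  proof cases
    case 1
    have "\<nu> < \<mu> * real k" if "\<phi>0 $ k \<noteq> 0" for k
    proof -
      have "e0 \<le> k" using that lt(1) by (meson leading_term_def not_le)
      then have "\<mu> * real e0 \<le> \<mu> * real k" using pos by simp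
      then show ?thesis using 1 by linarith
    qed
    note L = weight_linear_factor_v[OF pos this]
    have "ramify N (edge_part D S) = fps_const (u_monom b 0) * fps_X ^ 3"
      using split[OF L(1) conjunct1[OF quad(1)]] quad(1) L(2) 1 less
      by (simp add: power2_eq_square power3_eq_cube)
    then show ?thesis by (rule simple_edge_monomial[OF N b])
  next
    case 2
    note L = weight_linear_factor_eq[OF pos lt(1) 2]
    have "ramify N (edge_part D S) = fps_const (u_monom b 0) * fps_X ^ 2 * (fps_X ^ 1 - fps_const (u_monom c0 e0))"
      using split[OF L(1) conjunct1[OF quad(1)]] quad(1) L(2) 2 less linear_factor_nonzero
      by (simp add: mult_ac)
    then show ?thesis by (rule simple_edge_binomial[OF N b c(1) e(1), rotated]) simp
  next
    case 3
    note L = weight_linear_factor_u[OF pos lt(1) 3(1)]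
    have "ramify N (edge_part D S) = fps_const (fps_const b) * (- fps_const (u_monom c0 e0) * fps_X ^ 2)"
      using split[OF L(1) conjunct1[OF quad(1)]] quad(1) L(2) 3 c by simp
    then show ?thesis unfolding neg by (rule simple_edge_monomial[OF N bc])
  next
    case 4
    then have gr: "\<mu> * real e0 < \<nu>" using less by simp
    note L = weight_linear_factor_u[OF pos lt(1) gr]
    have "ramify N (edge_part D S) = fps_const (fps_const b) *
        (- fps_const (u_monom c0 e0) * (fps_X ^ 2 - fps_const (u_monom (c * c) (e + e))))"
      using split[OF L(1) conjunct1[OF quad(2)]] quad(2) L(2) 4 c q_nz by simp
    then have "ramify N (edge_part D S) = fps_const (u_monom (- b * c0) e0) * fps_X ^ 0 *
        (fps_X ^ 2 - fps_const (u_monom (c * c) (e + e)))"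
      unfolding neg by simp
    then show ?thesis by (rule simple_edge_binomial[OF N bc cc, rotated]) simp
  next
    case 5
    then have gr: "\<mu> * real e0 < \<nu>" using less by simp
    note L = weight_linear_factor_u[OF pos lt(1) gr]
    have "ramify N (edge_part D S) = fps_const (fps_const b) *
        (- fps_const (u_monom c0 e0) * - fps_const (u_monom (c * c) (e + e)))"
      using split[OF L(1) conjunct1[OF quad(3)]] quad(3) L(2) 5 c by simp
    also have "\<dots> = fps_const (u_monom (b * c0 * (c * c)) (e0 + (e + e))) * fps_X ^ 0"
      by (simp add: power_add mult_ac flip: fps_const_mult fps_const_neg)
    finally show ?thesis by (rule simple_edge_monomial[OF N, rotated]) (use b c in simp)
  qed
qed

section \<open>The discriminant of a branch\<close>

text \<open>Retains from a Puiseux factorization what is used to compare roots, dropping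
  convergence.\<close>

definition splits_as :: "complex fps fps \<Rightarrow> nat \<Rightarrow> (nat \<Rightarrow> complex fps) \<Rightarrow> bool" where
  "splits_as G p \<alpha> \<longleftrightarrow> (\<forall>i<p. \<alpha> i $ 0 = 0) \<and>
     (\<exists>W. W $ 0 $ 0 \<noteq> 0 \<and> G = W * (\<Prod>i<p. fps_X - fps_const (\<alpha> i)))"

lemma splits_as_lift:
  assumes "puiseux_factorization g N p \<alpha>" and k: "k > 0"
  shows "splits_as (ramify (N * k) g) p (\<lambda>i. \<alpha> i oo fps_X ^ k)"
proof -
  obtain w where N: "N > 0" and \<alpha>: "\<And>i. i < p \<Longrightarrow> \<alpha> i $ 0 = 0" and w: "w dvd 1"
    and g: "ramify N g = ramify N (fps_of_cps2 w) * (\<Prod>i<p. fps_X - fps_const (\<alpha> i))"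
    using assms(1) by (auto simp: puiseux_factorization_def)
  have "ramify (N * k) g = ramify (N * k) (fps_of_cps2 w) * (\<Prod>i<p. fps_X - fps_const (\<alpha> i oo fps_X ^ k))"
    unfolding ramify_ramify[OF N k, symmetric] g
    by (simp add: comp_coeffs_mult comp_coeffs_linear_prod X_power_nth_0 k)
  moreover have "ramify (N * k) (fps_of_cps2 w) $ 0 $ 0 \<noteq> 0"
    using unit_nth_00[OF w] N k by (simp add: ramify_nth_00)
  ultimately show ?thesis using \<alpha> by (auto simp: splits_as_def)
qed

lemma splits_as_image_eq:
  assumes "splits_as G p \<alpha>" "splits_as G p' \<beta>"
  shows "\<alpha> ` {..<p} = \<beta> ` {..<p'}"
proof -
  obtain W W' where *: "W $ 0 $ 0 \<noteq> 0" "W' $ 0 $ 0 \<noteq> 0"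
    "W * (\<Prod>i<p. fps_X - fps_const (\<alpha> i)) = W' * (\<Prod>i<p'. fps_X - fps_const (\<beta> i))"
    "\<forall>i<p. \<alpha> i $ 0 = 0" "\<forall>i<p'. \<beta> i $ 0 = 0"
    using assms by (auto simp: splits_as_def)
  have "\<alpha> ` {..<p} \<subseteq> \<beta> ` {..<p'}"
    by (rule linear_prod_roots_subset[OF _ _ *(3)]) (use * in auto)
  moreover have "\<beta> ` {..<p'} \<subseteq> \<alpha> ` {..<p}"
    by (rule linear_prod_roots_subset[OF _ _ *(3)[symmetric]]) (use * in auto)
  ultimately show ?thesis by blast
qed

lemma compose_X_power_inject:
  assumes "k > 0" shows "a oo fps_X ^ k = b oo fps_X ^ k \<longleftrightarrow> a = (b :: 'a::idom fps)"
proof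
  assume *: "a oo fps_X ^ k = b oo fps_X ^ k"
  show "a = b"
  proof (rule fps_ext)
    fix n show "a $ n = b $ n"
      using arg_cong[OF *, of "\<lambda>h. h $ (k * n)"] assms by (simp add: compose_X_power_nth)
  qed
qed simp

lemma subdegree_compose_X_power:
  assumes "k > 0" shows "subdegree (a oo fps_X ^ k) = k * subdegree (a :: complex fps)"
proof (cases "a = 0")
  case False
  show ?thesis
  proof (rule subdegreeI)
    show "(a oo fps_X ^ k) $ (k * subdegree a) \<noteq> 0"
      using False assms by (simp add: compose_X_power_nth)
    fix i assume "i < k * subdegree a"
    then have "i div k < subdegree a" using assms by (simp add: div_less_iff_less_mult mult.commute)
    then have "a $ (i div k) = 0" by (rule nth_less_subdegree_zero)
    then show "(a oo fps_X ^ k) $ i = 0" using assms by (simp add: compose_X_power_nth)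
  qed
qed simp

text \<open>The definition collects exponents from all Puiseux factorizations. Over the product of
  two denominators their root sets coincide, so each factorization yields the whole set.\<close>

lemma char_exponents_eq:
  assumes fac: "puiseux_factorization (fps_of_cps2 f) N p \<alpha>" and p: "p = subdegree (at_x0 f)"
  shows "char_exponents f = {puiseux_ord N (\<alpha> i - \<alpha> j) | i j. i < p \<and> j < p \<and> \<alpha> i \<noteq> \<alpha> j}"
proof
  show "{puiseux_ord N (\<alpha> i - \<alpha> j) | i j. i < p \<and> j < p \<and> \<alpha> i \<noteq> \<alpha> j} \<subseteq> char_exponents f"
    using fac unfolding char_exponents_def p by blast
  show "char_exponents f \<subseteq> {puiseux_ord N (\<alpha> i - \<alpha> j) | i j. i < p \<and> j < p \<and> \<alpha> i \<noteq> \<alpha> j}"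
  proof
    fix r assume "r \<in> char_exponents f"
    then obtain N' \<beta> i j where r: "r = puiseux_ord N' (\<beta> i - \<beta> j)"
      and fac': "puiseux_factorization (fps_of_cps2 f) N' p \<beta>" and ij: "i < p" "j < p" "\<beta> i \<noteq> \<beta> j"
      by (auto simp: char_exponents_def p)
    have N: "N > 0" "N' > 0" using fac fac' by (auto simp: puiseux_factorization_def)
    have "(\<lambda>i. \<beta> i oo fps_X ^ N) ` {..<p} = (\<lambda>i. \<alpha> i oo fps_X ^ N') ` {..<p}"
      using splits_as_lift[OF fac N(2)] splits_as_lift[OF fac' N(1)]
      by (intro splits_as_image_eq) (simp_all add: mult.commute)
    then obtain i' j' where ij': "i' < p" "j' < p" "\<beta> i oo fps_X ^ N = \<alpha> i' oo fps_X ^ N'"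
        "\<beta> j oo fps_X ^ N = \<alpha> j' oo fps_X ^ N'"
      using ij by (metis (no_types, lifting) imageE imageI lessThan_iff)
    then have "(\<beta> i - \<beta> j) oo fps_X ^ N = (\<alpha> i' - \<alpha> j') oo fps_X ^ N'"
      by (simp add: fps_compose_sub_distrib)
    then have "N * subdegree (\<beta> i - \<beta> j) = N' * subdegree (\<alpha> i' - \<alpha> j')"
      using N by (metis subdegree_compose_X_power)
    then have "(of_nat N * of_nat (subdegree (\<beta> i - \<beta> j)) :: rat) = of_nat N' * of_nat (subdegree (\<alpha> i' - \<alpha> j'))"
      by (simp flip: of_nat_mult)
    then have "r = puiseux_ord N (\<alpha> i' - \<alpha> j')"
      using N by (simp add: r puiseux_ord_def field_simps)
    moreover have "\<alpha> i' \<noteq> \<alpha> j'" using ij ij' N by (metis compose_X_power_inject)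
    ultimately show "r \<in> {puiseux_ord N (\<alpha> i - \<alpha> j) | i j. i < p \<and> j < p \<and> \<alpha> i \<noteq> \<alpha> j}"
      using ij' by blast
  qed
qed

text \<open>The situation over a common denominator \<open>N\<close> for the roots of f and of its
  derivative: \<open>G\<close> stands for f(t^N, y), its roots are the \<open>p\<close> distinct
  conjugates of \<open>a\<close>, and the \<open>\<gamma> j\<close> are the polar roots.\<close>

locale branch =
  fixes N p :: nat and \<xi> :: complex and a :: "complex fps" and G W V :: "complex fps fps"
    and \<gamma> :: "nat \<Rightarrow> complex fps" and D w :: cps2
  assumes N: "N > 0" and \<xi>: "\<And>m. \<xi> ^ m = 1 \<longleftrightarrow> N dvd m" and p: "p > 1" and a0: "a $ 0 = 0"
    and cardR: "card (range (\<lambda>k. rot (\<xi> ^ k) a)) = p"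
    and G: "G = W * (\<Prod>x\<in>range (\<lambda>k. rot (\<xi> ^ k) a). fps_X - fps_const x)" and W: "W $ 0 $ 0 \<noteq> 0"
    and rotG: "rotY \<xi> G = G"
    and G': "fps_deriv G = V * (\<Prod>j<p - 1. fps_X - fps_const (\<gamma> j))" and V: "V $ 0 $ 0 \<noteq> 0"
    and \<gamma>0: "\<And>j. j < p - 1 \<Longrightarrow> \<gamma> j $ 0 = 0"
    and w: "w dvd 1"
    and D: "ramify N (fps_of_cps2 D) = ramify N (fps_of_cps2 w) *
      (\<Prod>j<p - 1. fps_X - fps_const (eval_y G (\<gamma> j)))"
begin

definition R :: "complex fps set" where "R = range (\<lambda>k. rot (\<xi> ^ k) a)"

text \<open>\<open>CS\<close> is the set of characteristic exponents multiplied by \<open>N\<close>.\<close>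

definition CS :: "nat set" where
  "CS = {subdegree (rot (\<xi> ^ k) a - a) | k. rot (\<xi> ^ k) a \<noteq> a}"

text \<open>The order in \<open>t\<close> of \<open>f\<close> along any \<open>\<gamma>\<^sub>j\<close> leaving the tree of roots at height \<open>d\<close>.\<close>

definition E :: "nat \<Rightarrow> nat" where "E d = (\<Sum>x\<in>R. contact d a x)"

lemma \<xi>_nz: "\<xi> \<noteq> 0"
proof
  assume "\<xi> = 0"
  then have "\<xi> ^ N = 0" using N by simp
  then show False using \<xi>[of N] by (metis dvd_refl zero_neq_one)
qed

lemma finR: "finite R"
  using cardR p unfolding R_def by (metis card.infinite not_one_less_zero)

lemma rot_pow_nth_eq: "(rot (\<xi> ^ k) a) $ m = a $ m \<longleftrightarrow> a $ m = 0 \<or> N dvd k * m"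
  using \<xi>[of "k * m"] by (auto simp: power_mult)

lemma period: "rot (\<xi> ^ k) a = a \<longleftrightarrow> p dvd k"
  using rot_orbit_period(1)[OF N \<xi> _ cardR] p by simp

lemma sum_R: "(\<Sum>x\<in>R. F x) = (\<Sum>k<p. F (rot (\<xi> ^ k) a))"
  using rot_orbit_period(2,3)[OF N \<xi> _ cardR] p unfolding R_def by (simp add: sum.reindex)

lemma subdegree_in_CS:
  assumes "rot (\<xi> ^ k) a \<noteq> a"
  defines "s \<equiv> subdegree (rot (\<xi> ^ k) a - a)"
  shows "s \<in> CS" "agree s (rot (\<xi> ^ k) a) a" "\<not> N dvd k * s" "a $ s \<noteq> 0"
proof -
  show "s \<in> CS" using assms by (auto simp: CS_def)
  have "(rot (\<xi> ^ k) a - a) $ s \<noteq> 0"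
    unfolding s_def by (rule nth_subdegree_nonzero) (use assms in simp)
  then have "(rot (\<xi> ^ k) a) $ s \<noteq> a $ s" by auto
  then show "\<not> N dvd k * s" "a $ s \<noteq> 0" using rot_pow_nth_eq by auto
  have "(rot (\<xi> ^ k) a - a) $ m = 0" if "m < s" for m
    using nth_less_subdegree_zero that unfolding s_def by blast
  then show "agree s (rot (\<xi> ^ k) a) a" unfolding agree_def by (metis eq_iff_diff_eq_0 fps_sub_nth)
qed

lemma agree_dvd: "agree d (rot (\<xi> ^ k) a) a \<Longrightarrow> s < d \<Longrightarrow> a $ s \<noteq> 0 \<Longrightarrow> N dvd k * s"
  using rot_pow_nth_eq unfolding agree_def by blast

lemma CS_nth: "s \<in> CS \<Longrightarrow> a $ s \<noteq> 0"
  unfolding CS_def using subdegree_in_CS(4) by blast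

lemma CS_pos: "s \<in> CS \<Longrightarrow> s > 0"
  using CS_nth a0 by (metis gr0I)

text \<open>The first place where a conjugate differs from \<open>a\<close> belongs to
  \<open>CS\<close>, so only these coefficients have to be tested.\<close>

lemma agreeI:
  assumes "\<And>s. s \<in> CS \<Longrightarrow> s < d \<Longrightarrow> N dvd k * s" shows "agree d (rot (\<xi> ^ k) a) a"
proof (cases "rot (\<xi> ^ k) a = a")
  case False
  then have "d \<le> subdegree (rot (\<xi> ^ k) a - a)"
    using subdegree_in_CS[OF False] assms by (meson not_less)
  then show ?thesis using subdegree_in_CS(2)[OF False] by (simp add: agree_def)
qed (simp add: agree_def)

lemma period_iff: "p dvd k \<longleftrightarrow> (\<forall>s\<in>CS. N dvd k * s)"
proof
  assume "p dvd k"
  then have "rot (\<xi> ^ k) a = a" by (simp add: period)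
  then show "\<forall>s\<in>CS. N dvd k * s" using rot_pow_nth_eq CS_nth by metis
next
  assume "\<forall>s\<in>CS. N dvd k * s"
  then have "rot (\<xi> ^ k) a = a" using subdegree_in_CS(1,3) by blast
  then show "p dvd k" by (simp add: period)
qed

text \<open>A conjugation whose difference from \<open>a\<close> has order \<open>d\<close> fixes
  all lower coefficients and moves the one at \<open>d\<close>. Hence each exponent imposes a
  condition not implied by the smaller ones.\<close>

lemma CS_jump:
  assumes "d \<in> CS"
  obtains k where "\<not> N dvd k * d" "\<And>s. s \<in> CS \<Longrightarrow> s < d \<Longrightarrow> N dvd k * s"
proof -
  obtain k where k: "rot (\<xi> ^ k) a \<noteq> a" "d = subdegree (rot (\<xi> ^ k) a - a)"
    using assms by (auto simp: CS_def)
  show ?thesis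
    by (rule that[of k]) (use subdegree_in_CS[OF k(1)] k(2) agree_dvd CS_nth in blast)+
qed

lemma R_nth:
  assumes "d \<in> CS" "x \<in> R" shows "x $ d \<noteq> 0"
  using assms CS_nth \<xi>_nz by (auto simp: R_def)

lemma R_nth_0: "x \<in> R \<Longrightarrow> x $ 0 = 0"
  using a0 by (auto simp: R_def)

lemma a_in_R: "a \<in> R"
  unfolding R_def using rangeI[of "\<lambda>k. rot (\<xi> ^ k) a" 0] by simp

text \<open>Conjugation by \<open>\<xi> ^ T\<close> preserves the bar and multiplies its free
  coefficient by \<open>\<xi> ^ (T * d)\<close>.\<close>

lemma bar_count:
  assumes d: "d \<in> CS" and T: "\<And>s. s \<in> CS \<Longrightarrow> s < d \<Longrightarrow> N dvd T * s"
    and n: "\<And>k. 0 < k \<Longrightarrow> k < n \<Longrightarrow> \<not> N dvd T * d * k"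
  shows "n - 1 \<le> card {j. j < p - 1 \<and> agree d (\<gamma> j) a \<and> \<gamma> j $ d = 0}"
proof (rule critical_points_on_bar[where z = "\<xi> ^ T", OF G[folded R_def] W finR R_nth_0 a_in_R G' V \<gamma>0 CS_pos[OF d] R_nth[OF d]])
  show "\<xi> ^ T \<noteq> 0" using \<xi>_nz by simp
  show "rot (\<xi> ^ T) ` R \<subseteq> R" by (auto simp: R_def rot_rot simp flip: power_add)
  show "agree d (rot (\<xi> ^ T) a) a" using T by (rule agreeI)
  show "((\<xi> ^ T) ^ d) ^ k \<noteq> 1" if "0 < k" "k < n" for k
    using n[OF that] \<xi>[of "T * d * k"] by (simp add: power_mult)
qed auto

lemma bar_value:
  assumes d: "d \<in> CS"
  obtains K where "K \<noteq> 0" "\<And>y. agree d y a \<Longrightarrow> y $ d = 0 \<Longrightarrow> leading_term (eval_y G y) (E d) K"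
  using leading_term_at_bar_center[OF G[folded R_def] W finR a0 CS_pos[OF d] R_nth[OF d]]
  unfolding E_def by blast

lemma E_pos:
  assumes "d \<in> CS" shows "E d > 0"
proof -
  have "contact d a a \<le> E d" unfolding E_def by (rule member_le_sum[OF a_in_R _ finR]) simp
  then show ?thesis using CS_pos[OF assms] by (simp add: contact_def agree_def)
qed

text \<open>A rotation of the bar of order at least 3 would leave two polar roots at its center,
  with equal leading values. Order at most 2 is the stated divisibility.\<close>

lemma nondegenerate_two_branches:
  assumes nd: "nondegenerate D" and d: "d \<in> CS" and T: "\<And>s. s \<in> CS \<Longrightarrow> s < d \<Longrightarrow> N dvd T * s"
  shows "N dvd 2 * (T * d)"
proof (rule ccontr)
  assume neg: "\<not> N dvd 2 * (T * d)"
  let ?J = "{j. j < p - 1 \<and> agree d (\<gamma> j) a \<and> \<gamma> j $ d = 0}"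
  have "\<not> N dvd T * d * k" if "0 < k" "k < 3" for k
  proof -
    have "\<not> N dvd T * d" using neg dvd_mult by blast
    moreover have "k = 1 \<or> k = 2" using that by auto
    ultimately show ?thesis using neg by (auto simp: mult.commute[of _ 2])
  qed
  then have "3 - 1 \<le> card ?J" using bar_count[OF d T] by blast
  then obtain j1 j2 where j: "j1 \<in> ?J" "j2 \<in> ?J" "j1 \<noteq> j2"
    using card_le_Suc0_iff_eq[of ?J] by fastforce
  obtain K where K: "K \<noteq> 0" "\<And>y. agree d y a \<Longrightarrow> y $ d = 0 \<Longrightarrow> leading_term (eval_y G y) (E d) K"
    using bar_value[OF d] by blast
  have "\<not> nondegenerate D"
    by (rule degenerate_if_equal_leading_terms[OF N w D, of j1 j2 "E d" K])
      (use j K E_pos[OF d] in auto)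
  then show False using nd by simp
qed

lemma \<gamma>_rot_closed: "j < p - 1 \<Longrightarrow> rot \<xi> (\<gamma> j) \<in> \<gamma> ` {..<p - 1}"
proof (rule linear_prod_rot_closed[OF _ G' V \<gamma>0])
  show "rotY \<xi> (fps_deriv G) = fps_deriv G"
    using rotG by (simp add: rotY_def comp_coeffs_deriv)
qed

lemma least_CS_not_dvd:
  assumes "d \<in> CS" shows "\<not> N dvd d"
proof
  assume "N dvd d"
  moreover obtain k where "\<not> N dvd k * d" using CS_jump[OF assms] by blast
  ultimately show False by simp
qed

lemma odd_multiple_not_dvd: "N dvd 2 * d \<Longrightarrow> \<not> N dvd d \<Longrightarrow> N dvd k * d \<Longrightarrow> even k"
proof (rule ccontr)
  assume *: "N dvd 2 * d" "\<not> N dvd d" "N dvd k * d" "odd k"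
  then obtain m where "k = 2 * m + 1" using oddE by blast
  then have "k * d = m * (2 * d) + d" by (simp add: algebra_simps)
  then show False using * by (metis dvd_add_right_iff dvd_mult)
qed

text \<open>Conjugations fixing the coefficient at \<open>d1\<close> have even exponents; one of
  them moves the coefficient at \<open>d2\<close>, which would be impossible if \<open>N\<close>
  divided 2 \<open>d2\<close>.\<close>

lemma second_CS_not_dvd:
  assumes "d1 \<in> CS" "d2 \<in> CS" "d1 < d2" "N dvd 2 * d1" shows "\<not> N dvd 2 * d2"
proof -
  obtain k where k: "\<not> N dvd k * d2" "N dvd k * d1" using CS_jump[OF assms(2)] assms(1,3) by metis
  then have "even k" using odd_multiple_not_dvd[OF assms(4) least_CS_not_dvd[OF assms(1)]] by blast
  then obtain m where "k = 2 * m" by blast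
  then have "k * d2 = m * (2 * d2)" by simp
  then show ?thesis using k(1) dvd_mult by metis
qed

lemma nonempty_of_card:
  assumes "n - 1 \<le> card A" "2 \<le> n" shows "\<exists>x. x \<in> A"
proof -
  have "card A \<noteq> 0" using assms by linarith
  then show ?thesis by (metis card.empty equals0I)
qed

lemma sum_alternating: "(\<Sum>k<2 * r. if even k then x else y) = r * (x + y :: nat)"
  by (induction r) auto

text \<open>
  The bars at height \<open>d2\<close> are exchanged by the rotation, hence so are the \<open>\<gamma>\<^sub>j\<close> on them, and the
  two values of \<open>f\<close> have leading coefficients that differ by the factor \<open>\<xi>\<^bsup>E d2\<^esup>\<close>.
\<close>

lemma second_bar:
  assumes d: "d1 \<in> CS" "d2 \<in> CS" "d1 < d2" and between: "\<And>s. s \<in> CS \<Longrightarrow> s < d2 \<Longrightarrow> s = d1"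
    and dvd: "N dvd 2 * d1" and p2: "even p"
  obtains j1 j2 K where "j1 < p - 1" "j2 < p - 1" "j1 \<noteq> j2" "\<gamma> j1 $ d1 \<noteq> 0" "\<gamma> j2 $ d1 \<noteq> 0" "K \<noteq> 0"
    "leading_term (eval_y G (\<gamma> j1)) (E d2) K"
    "leading_term (eval_y G (\<gamma> j2)) (E d2) (\<xi> ^ E d2 * K)"
    "E d2 = (p div 2) * (d2 + d1)"
proof -
  have nd1: "\<not> N dvd d1" and nd2: "\<not> N dvd 2 * d2"
    using least_CS_not_dvd[OF d(1)] second_CS_not_dvd[OF d dvd] by auto
  \<comment> \<open>Even powers stay on the bar of \<open>a\<close> at height \<open>d2\<close>; odd
    powers leave it at \<open>d1\<close>, the only smaller exponent.\<close>
  have con: "contact d2 a (rot (\<xi> ^ k) a) = (if even k then d2 else d1)" for k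
  proof (cases "even k")
    case True
    then obtain m where "k = 2 * m" by blast
    then have "N dvd k * d1" using dvd by (simp add: mult.assoc mult.left_commute)
    then have "agree d2 (rot (\<xi> ^ k) a) a" using between by (intro agreeI) blast
    then show ?thesis using True by (simp add: contact_def)
  next
    case False
    then have "\<not> N dvd k * d1" using odd_multiple_not_dvd[OF dvd nd1] by blast
    then have na: "\<not> agree d2 (rot (\<xi> ^ k) a) a" using agree_dvd d(3) CS_nth[OF d(1)] by blast
    have "subdegree (rot (\<xi> ^ k) a - a) = d1"
      using between subdegree_in_CS(1) not_agree_subdegree[OF na] by blast
    then show ?thesis using False na by (simp add: contact_def)
  qed
  have E2: "E d2 = (p div 2) * (d2 + d1)"
    unfolding E_def sum_R con using sum_alternating[of d2 d1 "p div 2"] p2 by simp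
  have dvd2: "N dvd 2 * s" if "s \<in> CS" "s < d2" for s using between[OF that] dvd by simp
  have "\<not> N dvd 2 * d2 * k" if "0 < k" "k < 2" for k
  proof -
    have "k = 1" using that by simp
    then show ?thesis using nd2 by simp
  qed
  then have "2 - 1 \<le> card {j. j < p - 1 \<and> agree d2 (\<gamma> j) a \<and> \<gamma> j $ d2 = 0}"
    using bar_count[OF d(2) dvd2] by blast
  from nonempty_of_card[OF this order_refl]
  obtain j1 where j1: "j1 < p - 1" "agree d2 (\<gamma> j1) a" "\<gamma> j1 $ d2 = 0" by blast
  obtain j2 where j2: "j2 < p - 1" "\<gamma> j2 = rot \<xi> (\<gamma> j1)" using \<gamma>_rot_closed[OF j1(1)] by auto
  obtain K where K: "K \<noteq> 0" "\<And>y. agree d2 y a \<Longrightarrow> y $ d2 = 0 \<Longrightarrow> leading_term (eval_y G y) (E d2) K"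
    using bar_value[OF d(2)] by blast
  have lt1: "leading_term (eval_y G (\<gamma> j1)) (E d2) K" using K j1 by blast
  have "eval_y G (\<gamma> j2) = rot \<xi> (eval_y G (\<gamma> j1))"
    using eval_y_rot[OF \<gamma>0[OF j1(1)], of \<xi> G] rotG j2 by simp
  then have lt2: "leading_term (eval_y G (\<gamma> j2)) (E d2) (\<xi> ^ E d2 * K)"
    using leading_term_rot[OF lt1] by simp
  have g1: "\<gamma> j1 $ d1 = a $ d1" using j1 d(3) by (simp add: agree_def)
  have g1nz: "\<gamma> j1 $ d1 \<noteq> 0" using g1 CS_nth[OF d(1)] by simp
  have g2: "\<gamma> j2 $ d1 = \<xi> ^ d1 * \<gamma> j1 $ d1" using j2 by simp
  \<comment> \<open>The coefficients at \<open>d1\<close> separate the two polar roots. Being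
    nonzero, they also tell both apart from a polar root at the center of the bar at height
    \<open>d1\<close>.\<close>
  have "\<xi> ^ d1 \<noteq> 1" using \<xi> nd1 by simp
  then have "j1 \<noteq> j2" using g1nz g2 by auto
  moreover have "\<gamma> j2 $ d1 \<noteq> 0" using g1nz g2 \<xi>_nz by simp
  ultimately show ?thesis using that[of j1 j2 K] j1(1) j2(1) g1nz K(1) lt1 lt2 E2 by blast
qed

section \<open>The cases of one, two and more exponents\<close>

lemma one_exponent:
  assumes CS: "CS = {d}" shows "nondegenerate D \<longleftrightarrow> p = 2"
proof
  assume nd: "nondegenerate D"
  have "N dvd 2 * (1 * d)" by (rule nondegenerate_two_branches[OF nd]) (use CS in auto)
  then have "p dvd 2" using CS by (simp add: period_iff)
  then show "p = 2" using p dvd_imp_le[of p 2] by simp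
next
  assume p2: "p = 2"
  have "eval_y G (\<gamma> 0) $ 0 = G $ 0 $ 0" by (rule eval_y_nth_0)
  also have "\<dots> = 0"
    unfolding G using linear_prod_nth_00[OF finR a_in_R, of "\<lambda>x. x"] a0 by (simp add: R_def)
  finally show "nondegenerate D"
    by (rule nondegenerate_linear[OF N w]) (use D p2 in simp)
qed

lemma two_exponents:
  assumes CS: "CS = {d1, d2}" and d12: "d1 < d2" shows "nondegenerate D \<longleftrightarrow> p = 4"
proof
  assume nd: "nondegenerate D"
  have "N dvd 2 * (1 * d1)" by (rule nondegenerate_two_branches[OF nd]) (use CS d12 in auto)
  then have 1: "N dvd 2 * d1" by simp
  have n2: "\<not> N dvd 2 * d2" using second_CS_not_dvd[OF _ _ d12 1] CS by simp
  have "N dvd 2 * (2 * d2)" by (rule nondegenerate_two_branches[OF nd]) (use CS d12 1 in auto)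
  moreover have "N dvd 2 * (2 * d1)" using 1 by (rule dvd_mult)
  ultimately have "p dvd 4" using CS by (auto simp: period_iff)
  moreover have "\<not> p dvd 2" using n2 CS by (auto simp: period_iff)
  moreover have "p \<noteq> 3"
  proof
    assume "p = 3"
    with \<open>p dvd 4\<close> have "(3::nat) dvd 4" by simp
    then show False by simp
  qed
  moreover have "p \<le> 4" using \<open>p dvd 4\<close> by (rule dvd_imp_le) simp
  moreover have "p \<noteq> 2" using \<open>\<not> p dvd 2\<close> by auto
  ultimately show "p = 4" using p by linarith
next
  assume p4: "p = 4"
  have d: "d1 \<in> CS" "d2 \<in> CS" using CS by auto
  have all4: "N dvd 4 * d1" "N dvd 4 * d2" using period_iff[of 4] p4 d by auto
  have n1: "\<not> N dvd d1" by (rule least_CS_not_dvd[OF d(1)])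
  \<comment> \<open>If \<open>d1\<close> had order 4 modulo \<open>N\<close>, a conjugation fixing
    the coefficient at \<open>d1\<close> would have exponent divisible by 4 and hence be trivial,
    leaving no room for \<open>d2\<close>.\<close>
  have dvd1: "N dvd 2 * d1"
  proof (rule ccontr)
    assume neg: "\<not> N dvd 2 * d1"
    obtain k where k: "\<not> N dvd k * d2" "N dvd k * d1" using CS_jump[OF d(2)] d(1) d12 by metis
    have dvd4: "N dvd 2 * (2 * d1)" using all4 by simp
    have "k * (2 * d1) = 2 * (k * d1)" by simp
    then have "N dvd k * (2 * d1)" using k(2) by (metis dvd_mult)
    then have "even k" by (rule odd_multiple_not_dvd[OF dvd4 neg])
    then obtain m where m: "k = 2 * m" by blast
    have "N dvd m * (2 * d1)" using k(2) unfolding m by (simp only: mult_ac)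
    then have "even m" by (rule odd_multiple_not_dvd[OF dvd4 neg])
    then obtain m' where "k = m' * 4" using m by auto
    then show False using k(1) all4(2) by (simp add: mult.assoc)
  qed
  have n2: "\<not> N dvd 2 * d2" by (rule second_CS_not_dvd[OF d d12 dvd1])
  have "2 - 1 \<le> card {j. j < p - 1 \<and> agree d1 (\<gamma> j) a \<and> \<gamma> j $ d1 = 0}"
  proof (rule bar_count[OF d(1), of 1])
    show "N dvd 1 * s" if "s \<in> CS" "s < d1" for s using that CS d12 by auto
    show "\<not> N dvd 1 * d1 * k" if "0 < k" "k < 2" for k
    proof -
      have "k = 1" using that by simp
      then show ?thesis using n1 by simp
    qed
  qed
  from nonempty_of_card[OF this order_refl]
  obtain j0 where j0: "j0 < p - 1" "agree d1 (\<gamma> j0) a" "\<gamma> j0 $ d1 = 0" by blast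
  obtain K0 where K0: "K0 \<noteq> 0" "leading_term (eval_y G (\<gamma> j0)) (E d1) K0"
    using bar_value[OF d(1)] j0 by metis
  obtain j1 j2 K where j: "j1 < p - 1" "j2 < p - 1" "j1 \<noteq> j2" "\<gamma> j1 $ d1 \<noteq> 0" "\<gamma> j2 $ d1 \<noteq> 0"
    and K: "K \<noteq> 0" "leading_term (eval_y G (\<gamma> j1)) (E d2) K"
      "leading_term (eval_y G (\<gamma> j2)) (E d2) (\<xi> ^ E d2 * K)"
    and E2: "E d2 = (p div 2) * (d2 + d1)"
    by (rule second_bar[OF d d12 _ dvd1]) (use CS p4 in auto)
  \<comment> \<open>The part 2 \<open>d1\<close> vanishes modulo \<open>N\<close>, and 2
    \<open>d2\<close> has order exactly 2, so conjugation multiplies the leading coefficient by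
    -1.\<close>
  have "E d2 = 2 * d2 + 2 * d1" using E2 p4 by simp
  then have "\<xi> ^ E d2 = \<xi> ^ (2 * d2)" using \<xi>[of "2 * d1"] dvd1 by (simp add: power_add)
  moreover have "(\<xi> ^ (2 * d2))\<^sup>2 = 1" using \<xi>[of "2 * d2 * 2"] all4(2) by (simp add: power_mult[symmetric] mult_ac)
  moreover have "\<xi> ^ (2 * d2) \<noteq> 1" using \<xi> n2 by simp
  ultimately have "\<xi> ^ E d2 = - 1" by (simp add: power2_eq_1_iff)
  then have K2: "leading_term (eval_y G (\<gamma> j2)) (E d2) (- K)" using K(3) by simp
  \<comment> \<open>Contacts at height \<open>d1\<close> are at most \<open>d1\<close>, so
    \<open>E d1\<close> is at most 4 \<open>d1\<close>. The strict inequality keeps the slopes of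
    the linear and the quadratic part apart.\<close>
  have "E d1 \<le> (\<Sum>k<p. d1)" unfolding E_def sum_R by (intro sum_mono contact_le)
  then have E12: "E d1 < E d2" using \<open>E d2 = 2 * d2 + 2 * d1\<close> d12 p4 by simp
  have ne: "j0 \<noteq> j1" "j0 \<noteq> j2" using j j0 by auto
  \<comment> \<open>As p - 1 = 3, the polar root from the lower bar and the two from the upper bars
    exhaust all factors.\<close>
  have "{j0, j1, j2} \<subseteq> {..<p - 1}" using j0 j by auto
  moreover have "card {j0, j1, j2} = card {..<p - 1}" using ne j p4 by simp
  ultimately have "{..<p - 1} = {j0, j1, j2}" by (metis card_subset_eq finite_lessThan)
  then have "(\<Prod>j<p - 1. fps_X - fps_const (eval_y G (\<gamma> j))) = (fps_X - fps_const (eval_y G (\<gamma> j0))) *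
     ((fps_X - fps_const (eval_y G (\<gamma> j1))) * (fps_X - fps_const (eval_y G (\<gamma> j2))))"
    using ne j by simp
  then show "nondegenerate D"
    using nondegenerate_cubic[OF N w K0(2) K(2) K2 K0(1) K(1) E_pos[OF d(1)] E12] D by simp
qed

lemma many_exponents:
  assumes fin: "finite CS" and card: "card CS > 2" shows "\<not> nondegenerate D"
proof
  assume nd: "nondegenerate D"
  define d1 where "d1 = Min CS"
  define d2 where "d2 = Min (CS - {d1})"
  define d3 where "d3 = Min (CS - {d1, d2})"
  have c1: "CS \<noteq> {}" using card by auto
  have d1: "d1 \<in> CS" "\<And>s. s \<in> CS \<Longrightarrow> d1 \<le> s" using fin c1 by (auto simp: d1_def)
  have "card (CS - {d1}) > 1" using card d1 by simp
  then have c2: "CS - {d1} \<noteq> {}" by force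
  have d2_in: "d2 \<in> CS - {d1}" unfolding d2_def using fin c2 by (intro Min_in) auto
  have d2_min: "d2 \<le> s" if "s \<in> CS" "s \<noteq> d1" for s unfolding d2_def using fin that by (intro Min_le) auto
  have "d1 < d2" using d2_in d1(2)[of d2] by auto
  then have d2: "d2 \<in> CS" "d1 < d2" "\<And>s. s \<in> CS \<Longrightarrow> s < d2 \<Longrightarrow> s = d1"
    using d2_in d2_min by (auto dest: leD)
  have "card (CS - {d1, d2}) = card CS - card {d1, d2}"
    by (rule card_Diff_subset) (use d1(1) d2(1) in auto)
  also have "card {d1, d2} = 2" using d2(2) by simp
  finally have "card (CS - {d1, d2}) > 0" using card by simp
  then have c3: "CS - {d1, d2} \<noteq> {}" by (metis card.empty less_irrefl)
  have d3_in: "d3 \<in> CS - {d1, d2}" unfolding d3_def using fin c3 by (intro Min_in) auto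
  have d3_min: "d3 \<le> s" if "s \<in> CS" "s \<noteq> d1" "s \<noteq> d2" for s
    unfolding d3_def using fin that by (intro Min_le) auto
  have "d2 < d3" using d3_in d2_min[of d3] by auto
  then have d3: "d3 \<in> CS" "d2 < d3" "d1 < d3" "\<And>s. s \<in> CS \<Longrightarrow> s < d3 \<Longrightarrow> s = d1 \<or> s = d2"
    using d3_in d2(2) by (auto dest: leD[OF d3_min])
  have n1: "\<not> N dvd d1" by (rule least_CS_not_dvd[OF d1(1)])
  have "N dvd 2 * (1 * d1)" by (rule nondegenerate_two_branches[OF nd d1(1)]) (use d1(2) in \<open>auto dest: leD\<close>)
  then have v1: "N dvd 2 * d1" by simp
  have n2: "\<not> N dvd 2 * d2" by (rule second_CS_not_dvd[OF d1(1) d2(1,2) v1])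
  have v2: "N dvd 2 * (2 * d2)" by (rule nondegenerate_two_branches[OF nd d2(1)]) (use d2(3) v1 in auto)
  \<comment> \<open>Both \<open>d1\<close> and 2 \<open>d2\<close> have order 2 modulo
    \<open>N\<close>, and each contributes one factor 2 to k.\<close>
  have mult4: "\<exists>m. k = 4 * m" if k: "N dvd k * d1" "N dvd k * d2" for k
  proof -
    have "even k" by (rule odd_multiple_not_dvd[OF v1 n1 k(1)])
    then obtain m where m: "k = 2 * m" by blast
    then have "N dvd m * (2 * d2)" using k(2) by (simp add: mult_ac)
    then have "even m" by (rule odd_multiple_not_dvd[OF v2 n2])
    then show ?thesis using m by auto
  qed
  have n3: "\<not> N dvd 4 * d3"
  proof
    assume dvd: "N dvd 4 * d3"
    obtain k where k: "\<not> N dvd k * d3" "N dvd k * d1" "N dvd k * d2"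
      using CS_jump[OF d3(1)] d1(1) d2(1) d3(2,3) by metis
    then obtain m where "k = 4 * m" using mult4 by blast
    then have "k * d3 = m * (4 * d3)" by simp
    then show False using dvd k(1) by (metis dvd_mult)
  qed
  have "N dvd 4 * s" if "s \<in> CS" "s < d3" for s
    using d3(4)[OF that] v1 v2 by (auto intro: dvd_mult[of N "2 * d1" 2, simplified])
  then have v3: "N dvd 2 * (4 * d3)" by (intro nondegenerate_two_branches[OF nd d3(1)]) auto
  have pd: "N dvd p * s" if "s \<in> CS" for s using period_iff[of p] that by simp
  obtain m where m: "p = 4 * m" using mult4[OF pd[OF d1(1)] pd[OF d2(1)]] by blast
  then have "N dvd m * (4 * d3)" using pd[OF d3(1)] by (simp add: mult_ac)
  then have "even m" by (rule odd_multiple_not_dvd[OF v3 n3])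
  then obtain r where r: "p = 8 * r" using m by auto
  obtain j1 j2 K where j: "j1 < p - 1" "j2 < p - 1" "j1 \<noteq> j2"
    and K: "K \<noteq> 0" "leading_term (eval_y G (\<gamma> j1)) (E d2) K"
      "leading_term (eval_y G (\<gamma> j2)) (E d2) (\<xi> ^ E d2 * K)"
    and E2: "E d2 = (p div 2) * (d2 + d1)"
    by (rule second_bar[OF d1(1) d2 v1]) (use r in auto)
  \<comment> \<open>Here p/2 = 4r, while \<open>N\<close> divides 4 \<open>d2\<close> and 2
    \<open>d1\<close>. The third factor 2 of \<open>p\<close>, due to \<open>d3\<close>, is what
    makes the order a multiple of \<open>N\<close>.\<close>
  have "E d2 = r * (2 * (2 * d2)) + 2 * r * (2 * d1)" unfolding E2 using r by (simp add: algebra_simps)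
  then have "N dvd E d2" using v1 v2 by (simp only: dvd_add dvd_mult)
  then have "\<xi> ^ E d2 = 1" using \<xi> by simp
  then have "\<not> nondegenerate D"
    using degenerate_if_equal_leading_terms[OF N w D j K(2) _ K(1) E_pos[OF d2(1)]] K(3) by simp
  then show False using nd by simp
qed

end

theorem corollary4p4:
  fixes f D :: cps2 and h :: nat
  assumes "irreducible f"
    and "at_x0 f \<noteq> 0" and "1 < subdegree (at_x0 f)"
    and "card (char_exponents f) = h"
    and "is_discriminant f D"
  shows "(h = 1 \<longrightarrow> (nondegenerate D \<longleftrightarrow> subdegree (at_x0 f) = 2)) \<and>
         (h = 2 \<longrightarrow> (nondegenerate D \<longleftrightarrow> subdegree (at_x0 f) = 4)) \<and>
         (h > 2 \<longrightarrow> \<not> nondegenerate D)"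
proof (cases "h = 0")
  case False
  define p where "p = subdegree (at_x0 f)"
  have p: "p > 1" using assms by (simp add: p_def)
  \<comment> \<open>An element of this set carries a Puiseux factorization of f, so the existence of
    Puiseux roots is read off from \<open>h \<noteq> 0\<close>; for h = 0 the three claims are
    vacuous.\<close>
  have "char_exponents f \<noteq> {}" using False assms(4) by auto
  then obtain N0 \<alpha> where fac: "puiseux_factorization (fps_of_cps2 f) N0 p \<alpha>"
    unfolding char_exponents_def p_def by blast
  obtain N1 \<gamma> w where fac': "puiseux_factorization (fps_deriv (fps_of_cps2 f)) N1 (p - 1) \<gamma>"
    and w: "w dvd 1" and D: "ramify N1 (fps_of_cps2 D) = ramify N1 (fps_of_cps2 w) *
          (\<Prod>j<p - 1. fps_X - fps_const (subst_puiseux N1 (fps_of_cps2 f) (\<gamma> j)))"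
    using assms(5) unfolding is_discriminant_def p_def by blast
  have N01: "N0 > 0" "N1 > 0" using fac fac' by (auto simp: puiseux_factorization_def)
  define N where "N = N0 * N1"
  have N: "N > 0" using N01 by (simp add: N_def)
  obtain \<xi> :: complex where \<xi>: "\<And>m. \<xi> ^ m = 1 \<longleftrightarrow> N dvd m"
    using ex_primitive_root_of_unity[OF N] by blast
  \<comment> \<open>The roots \<open>\<alpha> i\<close> are series in a coarser parameter than t,
    for which the matching primitive root of unity is \<open>\<xi> ^ N1\<close>.\<close>
  have \<xi>': "(\<xi> ^ N1) ^ m = 1 \<longleftrightarrow> N0 dvd m" for m
    using \<xi>[of "N1 * m"] N01 by (simp add: N_def power_mult mult.commute[of N0])
  define b where "b = (\<lambda>i. \<alpha> i oo fps_X ^ N1)"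
  define c where "c = (\<lambda>j. \<gamma> j oo fps_X ^ N0)"
  define a where "a = b 0"
  define Rt where "Rt = range (\<lambda>k. rot (\<xi> ^ k) a)"
  define G where "G = ramify N (fps_of_cps2 f)"
  have inj: "inj_on \<alpha> {..<p}" and orb: "\<alpha> ` {..<p} = range (\<lambda>k. rot ((\<xi> ^ N1) ^ k) (\<alpha> 0))"
    using puiseux_roots_orbit[OF assms(1) fac _ \<xi>'] p by auto
  have injb: "inj_on b {..<p}"
    using inj N01 by (auto simp: b_def inj_on_def compose_X_power_inject)
  have rot_lift: "rot (z ^ N1) x oo fps_X ^ N1 = rot z (x oo fps_X ^ N1)" for z and x :: "complex fps"
    using N01 by (intro fps_ext) (auto simp: compose_X_power_nth power_mult[symmetric])
  have "b ` {..<p} = (\<lambda>x. x oo fps_X ^ N1) ` \<alpha> ` {..<p}" by (simp add: b_def image_image)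
  also have "\<dots> = Rt"
    unfolding orb Rt_def a_def b_def image_image
    using rot_lift[of "\<xi> ^ _" "\<alpha> 0"] by (simp add: power_mult[symmetric] mult.commute)
  finally have bR: "b ` {..<p} = Rt" .
  have cardR: "card Rt = p" using card_image[OF injb] bR by simp
  have sb: "splits_as G p b" unfolding G_def N_def b_def by (rule splits_as_lift[OF fac N01(2)])
  then obtain W where W: "W $ 0 $ 0 \<noteq> 0" "G = W * (\<Prod>i<p. fps_X - fps_const (b i))"
    and b0: "\<And>i. i < p \<Longrightarrow> b i $ 0 = 0" by (auto simp: splits_as_def)
  have GR: "G = W * (\<Prod>x\<in>Rt. fps_X - fps_const x)"
    unfolding bR[symmetric] W(2) using injb by (simp add: prod.reindex)
  have "splits_as (ramify N (fps_deriv (fps_of_cps2 f))) (p - 1) c"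
    unfolding N_def c_def using splits_as_lift[OF fac' N01(1)] by (simp add: mult.commute)
  moreover have "ramify N (fps_deriv (fps_of_cps2 f)) = fps_deriv G"
    by (simp add: G_def ramify_eq_comp_coeffs comp_coeffs_deriv)
  ultimately obtain V where V: "V $ 0 $ 0 \<noteq> 0" "fps_deriv G = V * (\<Prod>j<p - 1. fps_X - fps_const (c j))"
    and c0: "\<And>j. j < p - 1 \<Longrightarrow> c j $ 0 = 0" by (auto simp: splits_as_def)
  have lift1: "ramify N F = comp_coeffs (fps_X ^ N0) (ramify N1 F)" for F
    using ramify_ramify[OF N01(2,1)] by (simp add: N_def mult.commute)
  have \<gamma>0: "\<gamma> j $ 0 = 0" if "j < p - 1" for j using fac' that by (auto simp: puiseux_factorization_def)
  have "subst_puiseux N1 (fps_of_cps2 f) (\<gamma> j) oo fps_X ^ N0 = eval_y G (c j)" if "j < p - 1" for j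
    using that N01 by (simp add: subst_puiseux_eq_eval \<gamma>0 G_def lift1 c_def eval_y_comp_coeffs X_power_nth_0)
  then have D': "ramify N (fps_of_cps2 D) = ramify N (fps_of_cps2 w) *
      (\<Prod>j<p - 1. fps_X - fps_const (eval_y G (c j)))"
    unfolding lift1 D using N01 by (simp add: comp_coeffs_mult comp_coeffs_linear_prod X_power_nth_0)
  have "\<xi> ^ N = 1" using \<xi> by simp
  then have rotG: "rotY \<xi> G = G" unfolding G_def by (rule rotY_ramify[OF N])
  interpret branch N p \<xi> a G W V c D w
    by unfold_locales
      (use N \<xi> p b0 cardR GR W V rotG c0 w D' in \<open>auto simp: a_def Rt_def\<close>)
  \<comment> \<open>Rotation preserves orders, so differences of two conjugates reduce to
    differences from \<open>a\<close>.\<close>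
  have CSR: "CS = {subdegree (x - y) | x y. x \<in> Rt \<and> y \<in> Rt \<and> x \<noteq> y}"
  proof
    show "CS \<subseteq> {subdegree (x - y) | x y. x \<in> Rt \<and> y \<in> Rt \<and> x \<noteq> y}"
    proof
      fix s assume "s \<in> CS"
      then obtain k where "s = subdegree (rot (\<xi> ^ k) a - a)" "rot (\<xi> ^ k) a \<noteq> a" by (auto simp: CS_def)
      moreover have "rot (\<xi> ^ k) a \<in> Rt" by (simp add: Rt_def)
      moreover have "a \<in> Rt" using bR p by (auto simp: a_def)
      ultimately show "s \<in> {subdegree (x - y) | x y. x \<in> Rt \<and> y \<in> Rt \<and> x \<noteq> y}" by blast
    qed
    show "{subdegree (x - y) | x y. x \<in> Rt \<and> y \<in> Rt \<and> x \<noteq> y} \<subseteq> CS"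
    proof
      fix s assume "s \<in> {subdegree (x - y) | x y. x \<in> Rt \<and> y \<in> Rt \<and> x \<noteq> y}"
      then obtain k l where s: "s = subdegree (rot (\<xi> ^ k) a - rot (\<xi> ^ l) a)" "rot (\<xi> ^ k) a \<noteq> rot (\<xi> ^ l) a"
        by (auto simp: Rt_def)
      \<comment> \<open>The summand \<open>(N - 1) * l\<close> represents -l modulo \<open>N\<close>
        by a natural exponent.\<close>
      define k' where "k' = k + (N - 1) * l"
      obtain n where "N = Suc n" using N gr0_conv_Suc by blast
      then have "l + k' = k + N * l" by (simp add: k'_def)
      then have "\<xi> ^ l * \<xi> ^ k' = \<xi> ^ k" using \<xi>[of "N * l"] by (simp add: power_add[symmetric]) (simp add: power_add)
      then have k: "rot (\<xi> ^ k) a = rot (\<xi> ^ l) (rot (\<xi> ^ k') a)" by (simp add: rot_rot)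
      then have "s = subdegree (rot (\<xi> ^ k') a - a)"
        using s(1) \<xi>_nz by (simp add: rot_diff[symmetric] subdegree_rot)
      moreover have "rot (\<xi> ^ k') a \<noteq> a" using s(2) k by auto
      ultimately show "s \<in> CS" by (auto simp: CS_def)
    qed
  qed
  have "char_exponents f = {puiseux_ord N0 (\<alpha> i - \<alpha> j) | i j. i < p \<and> j < p \<and> \<alpha> i \<noteq> \<alpha> j}"
    by (rule char_exponents_eq[OF fac p_def])
  also have "\<dots> = (\<lambda>d. of_nat d / of_nat N) ` CS"
  proof -
    have ord: "puiseux_ord N0 (\<alpha> i - \<alpha> j) = of_nat (subdegree (b i - b j)) / of_nat N" for i j
      using N01 by (simp add: puiseux_ord_def b_def fps_compose_sub_distrib[symmetric]
        subdegree_compose_X_power N_def)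
    have ne: "\<alpha> i \<noteq> \<alpha> j \<longleftrightarrow> b i \<noteq> b j" for i j using N01 by (simp add: b_def compose_X_power_inject)
    show ?thesis unfolding CSR bR[symmetric] ord ne by blast
  qed
  finally have ce: "char_exponents f = (\<lambda>d. of_nat d / of_nat N) ` CS" .
  have "inj_on (\<lambda>d. of_nat d / of_nat N :: rat) CS" using N by (auto simp: inj_on_def)
  then have cardCS: "card CS = h" using card_image assms(4) ce by metis
  then have finCS: "finite CS" using False by (metis card.infinite)
  have "nondegenerate D \<longleftrightarrow> p = 2" if "h = 1"
    using cardCS that one_exponent by (metis card_1_singletonE)
  moreover have "nondegenerate D \<longleftrightarrow> p = 4" if "h = 2"
  proof -
    have "card CS = 2" using cardCS that by simp
    then obtain x y where "CS = {x, y}" "x \<noteq> y" unfolding card_2_iff by blast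
    then consider "CS = {x, y}" "x < y" | "CS = {y, x}" "y < x" by (metis insert_commute nat_neq_iff)
    then show ?thesis by cases (use two_exponents in auto)
  qed
  moreover have "\<not> nondegenerate D" if "h > 2" using many_exponents[OF finCS] that cardCS by simp
  ultimately show ?thesis by (simp add: p_def)
qed simp

end
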